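(* Let $n\ge 3$ be an integer and $r>0$. The density function $g_{n,r}$ of the distance $\varDelta_{n,r}$ between two uniformly and independently distributed random points in the regular polygon $\mathcal{P}_{n,r}$ is given by $$g_{n,r}(x)=\begin{cases}\dfrac{2x}{A}\left[\pi-\dfrac{L\,\phi^\flat(x)}{A\,\ell_1}\right] & \text{if } x\in[0,\ell_{K+1}),\\[2mm] 0 & \text{if } x\in\mathbb{R}\setminus[0,\ell_{K+1}),\end{cases}$$ where $$\phi^\flat(x)=\sum_{\nu=0}^{k-1}J^\flat_\nu(\ell_{\nu+1})+J^\flat_k(x)\quad\text{if } \ell_k\le x<\ell_{k+1},\ k=0,\ldots,K,$$ with, for $\ell_k\le x\le\ell_{k+1}$, $$J^\flat_k(x)=\begin{cases} H^\flat_{0,k}(x) & \text{if } k=0 \text{ and } x<\lambda,\\ H^\flat_{1,k}(x)-H^\flat_{1,k}(\ell_k) & \text{if } (n\text{ is even and }1\le k\le K-1)\text{ or }(n\text{ is odd and }1\le k\le K\text{ and }x<\lambda),\\ H^\flat_{2,k}(x)-H^\flat_{2,k}(\ell_k) & \text{if } n\text{ is even and }k=K,\\ H^\flat_{3,k}(x)-H^\flat_{3,k}(\lambda)+H^\flat_{0,k}(\lambda) & \text{if } n=3,\ k=0\text{ and }x\ge\lambda,\\ H^\flat_{3,k}(x)-H^\flat_{3,k}(\lambda)+H^\flat_{1,k}(\lambda)-H^\flat_{1,k}(\ell_k) & \text{if } n\text{ is odd},\ n>3\text{ and }x\ge\lambda, \end{cases}$$ and \begin{align*} H^\flat_{0,k}(x)={}&\ell_1x-[1+\alpha(\tan\alpha-\cot\alpha)]\,x^2/4,\\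 H^\flat_{1,k}(x)={}&p_k\,\widetilde\sigma_{1,h_k}(x)-[k\alpha\cot(2k\alpha)-(k+1)\alpha\cot(2(k+1)\alpha)]\,x^2/2-(h_kp_k+2rq_k\cos\alpha)\,\widetilde\tau_{-1,h_k}(x),\\ H^\flat_{2,k}(x)={}&[1/2-k\alpha\cot(2k\alpha)]\,x^2/2+\cot(2k\alpha)\,\widetilde\sigma_{1,h_k}(x)-(h_k-2r\cos\alpha)\,h_k\ln x\\ &-[h_k\cot(2k\alpha)+2r\cos\alpha\tan(k\alpha)]\,\widetilde\tau_{-1,h_k}(x),\\ H^\flat_{3,k}(x)={}&p_k\,\widetilde\sigma_{1,h_k}(x)+2\cot(2(k+1)\alpha)\,\widetilde\sigma_{1,\lambda}(x)-[(\pi-\alpha)\cot(2(k+1)\alpha)+s_k]\,x^2/2\\ &-(h_kp_k+2rq_k\cos\alpha)\,\widetilde\tau_{-1,h_k}(x)\\ &-2\cos\alpha\,[2r\cos(\alpha/2)\sec((k+1)\alpha)-\lambda\csc(2(k+1)\alpha)]\,\widetilde\tau_{-1,\lambda}(x). \end{align*}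
   Context: $\mathcal{P}_{n,r}$ is the (filled) regular polygon with $n$ sides whose circumscribed circle has radius $r$. $\varDelta_{n,r}$ is the Euclidean distance between two points chosen independently and uniformly (w.r.t. area) from $\mathcal{P}_{n,r}$. Notation: $\alpha=\pi/n$; $K=\lfloor n/2\rfloor-1$; $\ell_k=2r\sin(k\alpha)$; $\lambda=2r\cos^2(\alpha/2)=r+r\cos\alpha$; $L=2nr\sin\alpha$ (perimeter of $\mathcal{P}_{n,r}$); $A=\tfrac12nr^2\sin(2\alpha)$ (area of $\mathcal{P}_{n,r}$); $h_k=2r\sin(k\alpha)\sin((k+1)\alpha)$; $p_k=0$ if $n=3$ and $p_k=\cot(2k\alpha)-\cot(2(k+1)\alpha)$ if $n>3$; $q_k=\tan(k\alpha)-\tan((k+1)\alpha)$; $s_k=1/2$ if $n=3$ and $s_k=k\alpha p_k$ if $n>3$. (These quantities are only used for those $k$ for which the trigonometric functions involved are defined.) One has $\ell_K<\lambda<\ell_{K+1}$, so for odd $n$ the condition $x\ge\lambda$ forces $k=K$. For $a\ge0$ and $x\ge a$, $x>0$: $$\widetilde\sigma_{1,a}(x)=\frac12\left(x^2\arcsin\frac ax+a\sqrt{x^2-a^2}\right),\qquad \widetilde\tau_{-1,a}(x)=\sqrt{x^2-a^2}+a\arcsin\frac ax.$$ *)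

theory Defs
  imports "HOL-Probability.Probability"
begin

text \<open>
  The plane is identified with \<^typ>\<open>complex\<close>. The centre \<open>c\<close> and the argument \<open>\<theta>\<close> of one
  vertex (seen from the centre) are free parameters, so that every regular \<open>n\<close>-gon of
  circumradius \<open>r\<close> is covered.
\<close>

definition regular_polygon :: "nat \<Rightarrow> real \<Rightarrow> complex \<Rightarrow> real \<Rightarrow> complex set" where
  "regular_polygon n r c \<theta> =
     convex hull ((\<lambda>j. c + of_real r * cis (\<theta> + 2 * pi * real j / real n)) ` {..<n})"

definition alpha :: "nat \<Rightarrow> real" where
  "alpha n = pi / real n"

definition kmax :: "nat \<Rightarrow> nat" where
  "kmax n = n div 2 - 1"

definition ell :: "nat \<Rightarrow> real \<Rightarrow> nat \<Rightarrow> real" where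
  "ell n r k = 2 * r * sin (real k * alpha n)"

definition lam :: "nat \<Rightarrow> real \<Rightarrow> real" where
  "lam n r = 2 * r * (cos (alpha n / 2))\<^sup>2"

definition perimeter :: "nat \<Rightarrow> real \<Rightarrow> real" where
  "perimeter n r = 2 * real n * r * sin (alpha n)"

definition area :: "nat \<Rightarrow> real \<Rightarrow> real" where
  "area n r = 1 / 2 * real n * r\<^sup>2 * sin (2 * alpha n)"

definition hh :: "nat \<Rightarrow> real \<Rightarrow> nat \<Rightarrow> real" where
  "hh n r k = 2 * r * sin (real k * alpha n) * sin (real (k + 1) * alpha n)"

definition pp :: "nat \<Rightarrow> nat \<Rightarrow> real" where
  "pp n k = (if n = 3 then 0
     else cot (2 * real k * alpha n) - cot (2 * real (k + 1) * alpha n))"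

definition qq :: "nat \<Rightarrow> nat \<Rightarrow> real" where
  "qq n k = tan (real k * alpha n) - tan (real (k + 1) * alpha n)"

definition ss :: "nat \<Rightarrow> nat \<Rightarrow> real" where
  "ss n k = (if n = 3 then 1 / 2 else real k * alpha n * pp n k)"

text \<open>The functions \<open>\<sigma>\<^sub>1\<^sub>,\<^sub>a\<close> and \<open>\<tau>\<^sub>-\<^sub>1\<^sub>,\<^sub>a\<close> (with tilde), meant for \<open>0 \<le> a \<le> x\<close> and \<open>0 < x\<close>.\<close>

definition sigma1 :: "real \<Rightarrow> real \<Rightarrow> real" where
  "sigma1 a x = 1 / 2 * (x\<^sup>2 * arcsin (a / x) + a * sqrt (x\<^sup>2 - a\<^sup>2))"

definition tau_m1 :: "real \<Rightarrow> real \<Rightarrow> real" where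
  "tau_m1 a x = sqrt (x\<^sup>2 - a\<^sup>2) + a * arcsin (a / x)"

definition H0 :: "nat \<Rightarrow> real \<Rightarrow> nat \<Rightarrow> real \<Rightarrow> real" where
  "H0 n r k x =
     ell n r 1 * x - (1 + alpha n * (tan (alpha n) - cot (alpha n))) * x\<^sup>2 / 4"

definition H1 :: "nat \<Rightarrow> real \<Rightarrow> nat \<Rightarrow> real \<Rightarrow> real" where
  "H1 n r k x =
     pp n k * sigma1 (hh n r k) x
     - (real k * alpha n * cot (2 * real k * alpha n)
        - real (k + 1) * alpha n * cot (2 * real (k + 1) * alpha n)) * x\<^sup>2 / 2
     - (hh n r k * pp n k + 2 * r * qq n k * cos (alpha n)) * tau_m1 (hh n r k) x"

definition H2 :: "nat \<Rightarrow> real \<Rightarrow> nat \<Rightarrow> real \<Rightarrow> real" where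
  "H2 n r k x =
     (1 / 2 - real k * alpha n * cot (2 * real k * alpha n)) * x\<^sup>2 / 2
     + cot (2 * real k * alpha n) * sigma1 (hh n r k) x
     - (hh n r k - 2 * r * cos (alpha n)) * hh n r k * ln x
     - (hh n r k * cot (2 * real k * alpha n)
        + 2 * r * cos (alpha n) * tan (real k * alpha n)) * tau_m1 (hh n r k) x"

text \<open>Secant and cosecant are written as \<open>1 / cos\<close> and \<open>1 / sin\<close>.\<close>

definition H3 :: "nat \<Rightarrow> real \<Rightarrow> nat \<Rightarrow> real \<Rightarrow> real" where
  "H3 n r k x =
     pp n k * sigma1 (hh n r k) x
     + 2 * cot (2 * real (k + 1) * alpha n) * sigma1 (lam n r) x
     - ((pi - alpha n) * cot (2 * real (k + 1) * alpha n) + ss n k) * x\<^sup>2 / 2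
     - (hh n r k * pp n k + 2 * r * qq n k * cos (alpha n)) * tau_m1 (hh n r k) x
     - 2 * cos (alpha n)
       * (2 * r * cos (alpha n / 2) * (1 / cos (real (k + 1) * alpha n))
          - lam n r * (1 / sin (2 * real (k + 1) * alpha n))) * tau_m1 (lam n r) x"

text \<open>
  For \<open>n \<ge> 3\<close>, \<open>k \<le> kmax n\<close> and \<open>ell n r k \<le> x \<le> ell n r (k + 1)\<close> exactly one of the five
  conditions below holds; the final value \<open>0\<close> is then never reached.
\<close>

definition J_flat :: "nat \<Rightarrow> real \<Rightarrow> nat \<Rightarrow> real \<Rightarrow> real" where
  "J_flat n r k x =
     (if k = 0 \<and> x < lam n r
      then H0 n r k x
      else if (even n \<and> 1 \<le> k \<and> k + 1 \<le> kmax n) \<or>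
              (odd n \<and> 1 \<le> k \<and> k \<le> kmax n \<and> x < lam n r)
      then H1 n r k x - H1 n r k (ell n r k)
      else if even n \<and> k = kmax n
      then H2 n r k x - H2 n r k (ell n r k)
      else if n = 3 \<and> k = 0 \<and> lam n r \<le> x
      then H3 n r k x - H3 n r k (lam n r) + H0 n r k (lam n r)
      else if odd n \<and> 3 < n \<and> lam n r \<le> x
      then H3 n r k x - H3 n r k (lam n r) + H1 n r k (lam n r) - H1 n r k (ell n r k)
      else 0)"

definition ell_index :: "nat \<Rightarrow> real \<Rightarrow> real \<Rightarrow> nat" where
  "ell_index n r x = (THE k. k \<le> kmax n \<and> ell n r k \<le> x \<and> x < ell n r (k + 1))"

definition phi_flat :: "nat \<Rightarrow> real \<Rightarrow> real \<Rightarrow> real" where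
  "phi_flat n r x =
     (let k = ell_index n r x
      in (\<Sum>\<nu><k. J_flat n r \<nu> (ell n r (\<nu> + 1))) + J_flat n r k x)"

definition distance_density :: "nat \<Rightarrow> real \<Rightarrow> real \<Rightarrow> real" where
  "distance_density n r x =
     (if 0 \<le> x \<and> x < ell n r (kmax n + 1)
      then 2 * x / area n r *
           (pi - perimeter n r * phi_flat n r x / (area n r * ell n r 1))
      else 0)"

lemma ell_strict_mono:
  assumes "n \<ge> 3" "r > 0" "i < j" "j \<le> kmax n + 1"
  shows "ell n r i < ell n r j"
proof -
  have "2 * j \<le> n"
    using assms by (auto simp: kmax_def)
  then have "2 * real j \<le> real n"
    by linarith
  then have "real j * alpha n \<le> pi / 2"
    using assms mult_right_mono[of "2 * real j" "real n" pi]
    by (simp add: alpha_def field_simps)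
  moreover have "0 \<le> real i * alpha n" "real i * alpha n < real j * alpha n"
    using assms by (simp_all add: alpha_def field_simps)
  ultimately have "sin (real i * alpha n) < sin (real j * alpha n)"
    by (intro sin_monotone_2pi) auto
  then show ?thesis
    using assms by (simp add: ell_def)
qed

text \<open>The index used in \<^const>\<open>phi_flat\<close> is well defined on the support of the density.\<close>

lemma ell_index_ex1:
  assumes "n \<ge> 3" "r > 0" "0 \<le> x" "x < ell n r (kmax n + 1)"
  shows "\<exists>!k. k \<le> kmax n \<and> ell n r k \<le> x \<and> x < ell n r (k + 1)"
proof (rule ex_ex1I)
  define k where "k = (LEAST k. x < ell n r (k + 1))"
  have 1: "x < ell n r (k + 1)"
    unfolding k_def by (rule LeastI) (rule assms(4))
  have 2: "k \<le> kmax n"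
    unfolding k_def by (rule Least_le) (rule assms(4))
  have 3: "ell n r k \<le> x"
  proof (cases k)
    case 0
    then show ?thesis using assms by (simp add: ell_def)
  next
    case (Suc m)
    then have "\<not> x < ell n r (m + 1)"
      unfolding k_def by (intro not_less_Least) simp
    then show ?thesis using Suc by simp
  qed
  from 1 2 3 show "\<exists>k. k \<le> kmax n \<and> ell n r k \<le> x \<and> x < ell n r (k + 1)"
    by blast
next
  have *: False
    if "i < j" "j \<le> kmax n" "x < ell n r (i + 1)" "ell n r j \<le> x" for i j
  proof -
    have "ell n r (i + 1) \<le> ell n r j"
      using that ell_strict_mono[OF assms(1,2), of "i + 1" j] by (cases "i + 1 = j") auto
    with that show False by linarith
  qed
  fix i j
  assume "i \<le> kmax n \<and> ell n r i \<le> x \<and> x < ell n r (i + 1)"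
    and "j \<le> kmax n \<and> ell n r j \<le> x \<and> x < ell n r (j + 1)"
  then show "i = j"
    using *[of i j] *[of j i] by (cases i j rule: linorder_cases) auto
qed

end

theory Submission
  imports Defs
begin

text \<open>
  For a convex body \<open>P\<close> of area \<open>A\<close> with covariogram \<open>C(v) = |P \<inter> (P - v)|\<close>, the distance of two
  uniform points has density \<open>\<rho> / A\<^sup>2\<close> times the integral \<open>W(\<rho>)\<close> of \<open>C\<close> over the circle of
  radius \<open>\<rho>\<close>. Slicing in the direction of \<open>v\<close> turns \<open>C\<close> into an integral over \<open>t > |v|\<close> of the
  measure of those offsets whose chord in this direction has length at least \<open>t\<close>. For a regular
  polygon these offsets form an interval, whose right end point \<open>supp\<close> inherits the dihedral
  symmetry of the polygon, so that \<open>W(\<rho>)\<close> is \<open>4 n\<close> times the integral over \<open>t > \<rho>\<close> of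
  \<open>J(t)\<close>, the integral of \<open>supp\<close> over directions in \<open>[0, \<alpha>]\<close>. In a given direction, the extremal
  chord of length \<open>t\<close> joins two known edges, which are found from the position of \<open>t\<close> among
  the numbers \<open>\<ell>\<^sub>k\<close>, and optimality is certified by a positive combination of the two
  corresponding half-plane inequalities. The integral over the directions is then elementary, and
  \<open>2 J\<close> is the derivative of the function \<open>\<phi>\<close> of the theorem. The constant of integration is fixed
  by \<open>W(0) = 2 \<pi> A\<close>.
\<close>

section \<open>Lebesgue measure on the complex plane: rotations and polar coordinates\<close>

text \<open>The factor 4 n counts 2 n sectors of width \<alpha> in a full turn, twice, because the
  left end of the interval of offsets is minus the right end for the opposite direction. Note that
  \<open>ell n r k\<close> is the distance of two vertices k edges apart. For t between two such
  lengths and \<psi> running through [0, \<alpha>], the extremal chord slides along a fixed pair of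
  edges until one end reaches a vertex, at \<psi> = \<open>psi k t\<close>; then that end passes to
  the neighbouring edge. The vertex condition reads t sin (\<open>beta k\<close> - \<psi>) =
  \<open>hh n r k\<close>, which is the origin of the constants h_k and of arcsin (h_k / t). In the
  top strip part of the sector carries no chord. For even n the pair before the switch is parallel
  and too close together. For odd n and t > \<lambda>, with \<lambda> the height of the polygon, a
  gap of directions around the height opens, with end points given by arcsin (\<lambda> / t). The
  integrals of the closed form come from the fundamental theorem as gauge integrals, while the
  probabilistic side uses nonnegative Lebesgue integrals; joint measurability, which links the two,
  comes from the closedness of the set of all (direction, length, offset).\<close>

lemma lborel_complex_eq:
  "(lborel :: complex measure) = distr (lborel \<Otimes>\<^sub>M lborel) borel (\<lambda>(x, y). Complex x y)"
proof (rule lborel_eqI)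
  have m[measurable]: "(\<lambda>(x, y). Complex x y) \<in> borel_measurable (lborel \<Otimes>\<^sub>M lborel)"
    unfolding Complex_eq by measurable
  fix l u :: complex
  assume "\<And>b. b \<in> Basis \<Longrightarrow> l \<bullet> b \<le> u \<bullet> b"
  from this[of 1] this[of \<i>] have lu: "Re l \<le> Re u" "Im l \<le> Im u"
    by (auto simp: Basis_complex_def)
  have "(\<lambda>(x, y). Complex x y) -` box l u = {Re l<..<Re u} \<times> {Im l<..<Im u}"
    by (auto simp: box_def Basis_complex_def complex_inner_1_right complex_inner_i_right)
  then show "emeasure (distr (lborel \<Otimes>\<^sub>M lborel) borel (\<lambda>(x, y). Complex x y)) (box l u)
      = ennreal (\<Prod>b\<in>Basis. (u - l) \<bullet> b)"
    using lu
    by (simp add: emeasure_distr space_pair_measure lborel.emeasure_pair_measure_Times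
        Basis_complex_def inner_diff_left ennreal_mult)
qed simp

lemma borel_measurable_Complex[measurable (raw)]:
  assumes [measurable]: "f \<in> borel_measurable M" "g \<in> borel_measurable M"
  shows "(\<lambda>x. Complex (f x) (g x)) \<in> borel_measurable M"
  unfolding Complex_eq by measurable

lemma nn_integral_lborel_complex:
  assumes [measurable]: "f \<in> borel_measurable borel"
  shows "(\<integral>\<^sup>+z. f z \<partial>lborel) = (\<integral>\<^sup>+x. \<integral>\<^sup>+y. f (Complex x y) \<partial>lborel \<partial>lborel)"
  by (subst lborel_complex_eq)
     (simp add: nn_integral_distr case_prod_beta lborel.nn_integral_fst[symmetric])

lemma nn_integral_lborel_complex':
  assumes [measurable]: "f \<in> borel_measurable borel"
  shows "(\<integral>\<^sup>+z. f z \<partial>lborel) = (\<integral>\<^sup>+y. \<integral>\<^sup>+x. f (Complex x y) \<partial>lborel \<partial>lborel)"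
  by (subst nn_integral_lborel_complex) (auto intro: lborel_pair.Fubini'[symmetric])

lemma nn_integral_lborel_shift:
  fixes f :: "'a::euclidean_space \<Rightarrow> ennreal"
  assumes [measurable]: "f \<in> borel_measurable borel"
  shows "(\<integral>\<^sup>+x. f (x + c) \<partial>lborel) = (\<integral>\<^sup>+x. f x \<partial>lborel)"
  by (subst (2) lborel_distr_plus[of c, symmetric]) (simp add: nn_integral_distr add.commute)

lemma nn_integral_shear1:
  assumes [measurable]: "f \<in> borel_measurable borel"
  shows "(\<integral>\<^sup>+z. f (Complex (Re z + a * Im z) (Im z)) \<partial>lborel) = (\<integral>\<^sup>+z. f z \<partial>lborel)"
  by (simp add: nn_integral_lborel_complex' nn_integral_lborel_shift[of "\<lambda>x. f (Complex x _)"])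

lemma nn_integral_shear2:
  assumes [measurable]: "f \<in> borel_measurable borel"
  shows "(\<integral>\<^sup>+z. f (Complex (Re z) (Im z + b * Re z)) \<partial>lborel) = (\<integral>\<^sup>+z. f z \<partial>lborel)"
  by (simp add: nn_integral_lborel_complex nn_integral_lborel_shift[of "\<lambda>y. f (Complex _ y)"])

text \<open>A rotation is a product of three shears, except for the rotation by \<open>\<pi>\<close>.\<close>

lemma nn_integral_rotate_aux:
  assumes f[measurable]: "f \<in> borel_measurable borel" and c: "cos (\<phi> / 2) \<noteq> 0"
  shows "(\<integral>\<^sup>+z. f (cis \<phi> * z) \<partial>lborel) = (\<integral>\<^sup>+z. f z \<partial>lborel)"
proof -
  \<comment> \<open>The product of the shears with coefficients a, b, a has diagonal entries 1 + a b
    and lower left entry b. So b = sin \<phi>, and 1 + a b = cos \<phi> gives a = (cos \<phi> - 1) /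
    sin \<phi> = - tan (\<phi> / 2).\<close>
  define a where "a = - tan (\<phi> / 2)"
  define b where "b = sin \<phi>"
  have s: "sin \<phi> = 2 * sin (\<phi> / 2) * cos (\<phi> / 2)" and c2: "cos \<phi> = 1 - 2 * (sin (\<phi> / 2))\<^sup>2"
    using sin_double[of "\<phi> / 2"] cos_double_sin[of "\<phi> / 2"] by simp_all
  have ab: "a * b = cos \<phi> - 1"
    using c by (simp add: a_def b_def s c2 tan_def power2_eq_square)
  have p: "(sin (\<phi> / 2))\<^sup>2 + (cos (\<phi> / 2))\<^sup>2 = 1" by simp
  have a2: "a + (a * b + 1) * a = - sin \<phi>"
  proof -
    have "cos \<phi> + 1 = 2 * (cos (\<phi> / 2))\<^sup>2" using p c2 by linarith
    moreover have "a + (a * b + 1) * a = (cos \<phi> + 1) * a"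
      unfolding ab by (simp add: algebra_simps)
    ultimately have "a + (a * b + 1) * a = 2 * (cos (\<phi> / 2))\<^sup>2 * a" by simp
    also have "\<dots> = - (tan (\<phi> / 2) * (2 * (cos (\<phi> / 2))\<^sup>2))" by (simp add: a_def)
    also have "\<dots> = - sin \<phi>" using c by (simp add: tan_def s power2_eq_square)
    finally show ?thesis .
  qed
  define g where "g = (\<lambda>z. f (Complex (Re z + a * Im z) (Im z)))"
  define h where "h = (\<lambda>z. g (Complex (Re z) (Im z + b * Re z)))"
  have m[measurable]: "g \<in> borel_measurable borel" "h \<in> borel_measurable borel"
    unfolding g_def h_def by measurable
  have "f (cis \<phi> * z) = h (Complex (Re z + a * Im z) (Im z))" for z
  proof -
    let ?x = "Re z" and ?y = "Im z"
    have "?x + a * ?y + a * (?y + b * (?x + a * ?y)) = (1 + a * b) * ?x + (a + (a * b + 1) * a) * ?y"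
      by (simp add: algebra_simps)
    also have "\<dots> = cos \<phi> * ?x - sin \<phi> * ?y"
      by (simp only: a2) (simp add: ab)
    finally have 1: "?x + a * ?y + a * (?y + b * (?x + a * ?y)) = cos \<phi> * ?x - sin \<phi> * ?y" .
    have "?y + b * (?x + a * ?y) = b * ?x + (1 + a * b) * ?y"
      by (simp add: algebra_simps)
    also have "\<dots> = sin \<phi> * ?x + cos \<phi> * ?y"
      unfolding ab by (simp add: b_def)
    finally have 2: "?y + b * (?x + a * ?y) = sin \<phi> * ?x + cos \<phi> * ?y" .
    show ?thesis
      unfolding h_def g_def complex.sel
      by (subst 1, subst 2, rule arg_cong[of _ _ f]) (simp add: complex_eq_iff)
  qed
  then have "(\<integral>\<^sup>+z. f (cis \<phi> * z) \<partial>lborel) = (\<integral>\<^sup>+z. h (Complex (Re z + a * Im z) (Im z)) \<partial>lborel)"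
    by simp
  also have "\<dots> = (\<integral>\<^sup>+z. h z \<partial>lborel)" by (rule nn_integral_shear1) measurable
  also have "\<dots> = (\<integral>\<^sup>+z. g z \<partial>lborel)" unfolding h_def by (rule nn_integral_shear2) measurable
  also have "\<dots> = (\<integral>\<^sup>+z. f z \<partial>lborel)" unfolding g_def by (rule nn_integral_shear1) measurable
  finally show ?thesis .
qed

text \<open>Where the tangent of the shears is infinite, the rotation is split into two rotations by
  half the angle; the duplication formula shows that their tangents are finite.\<close>

lemma nn_integral_rotate:
  assumes f[measurable]: "f \<in> borel_measurable borel"
  shows "(\<integral>\<^sup>+z. f (cis \<phi> * z) \<partial>lborel) = (\<integral>\<^sup>+z. f z \<partial>lborel)"
proof (cases "cos (\<phi> / 2) = 0")
  case True
  have "cos (\<phi> / 2) = 2 * (cos (\<phi> / 2 / 2))\<^sup>2 - 1"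
    using cos_double_cos[of "\<phi> / 2 / 2"] by simp
  with True have c: "cos (\<phi> / 2 / 2) \<noteq> 0" by auto
  have "(\<integral>\<^sup>+z. f (cis \<phi> * z) \<partial>lborel) = (\<integral>\<^sup>+z. f (cis (\<phi> / 2) * (cis (\<phi> / 2) * z)) \<partial>lborel)"
    by (simp add: cis_mult mult.assoc[symmetric])
  also have "\<dots> = (\<integral>\<^sup>+z. f (cis (\<phi> / 2) * z) \<partial>lborel)"
    by (rule nn_integral_rotate_aux[OF _ c, of "\<lambda>z. f (cis (\<phi> / 2) * z)"]) measurable
  also have "\<dots> = (\<integral>\<^sup>+z. f z \<partial>lborel)"
    by (rule nn_integral_rotate_aux[OF f c])
  finally show ?thesis .
qed (rule nn_integral_rotate_aux[OF f])

section \<open>Polar coordinates in the plane\<close>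

lemma borel_measurable_trig[measurable (raw)]:
  fixes f :: "'a \<Rightarrow> real"
  assumes f[measurable]: "f \<in> borel_measurable M"
  shows "(\<lambda>x. cos (f x)) \<in> borel_measurable M" "(\<lambda>x. sin (f x)) \<in> borel_measurable M"
    "(\<lambda>x. cis (f x)) \<in> borel_measurable M"
proof -
  have "(cos :: real \<Rightarrow> real) \<in> borel_measurable borel" "(sin :: real \<Rightarrow> real) \<in> borel_measurable borel"
    "cis \<in> borel_measurable borel"
    by (intro borel_measurable_continuous_onI continuous_intros)+
  note this[measurable]
  show "(\<lambda>x. cos (f x)) \<in> borel_measurable M" "(\<lambda>x. sin (f x)) \<in> borel_measurable M"
    "(\<lambda>x. cis (f x)) \<in> borel_measurable M"
    by measurable
qed

text \<open>The substitution s = tan \<phi> as an identity of measures, so that it applies to any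
  nonnegative measurable integrand on the whole line. On a box it is the fundamental theorem between
  \<open>arctan l\<close> and \<open>arctan u\<close>.\<close>

lemma lborel_tan:
  "(lborel :: real measure) =
    distr (density lborel (\<lambda>x. indicator {- pi / 2 <..< pi / 2} x * ennreal (inverse ((cos x)\<^sup>2)))) borel tan"
  (is "_ = distr (density lborel ?w) borel tan")
proof (rule lborel_eqI)
  have tanm[measurable]: "(tan :: real \<Rightarrow> real) \<in> borel_measurable borel"
    unfolding tan_def[abs_def] by measurable
  have wm[measurable]: "?w \<in> borel_measurable borel" by measurable
  fix l u :: real
  assume "\<And>b. b \<in> Basis \<Longrightarrow> l \<bullet> b \<le> u \<bullet> b"
  then have lu: "l \<le> u" by simp
  have "emeasure (distr (density lborel ?w) borel tan) (box l u)
      = (\<integral>\<^sup>+x. ?w x * indicator (tan -` {l<..<u}) x \<partial>lborel)"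
    by (simp add: emeasure_distr emeasure_density measurable_sets_borel[OF tanm] box_real)
  also have "\<dots> = (\<integral>\<^sup>+x. ennreal (inverse ((cos x)\<^sup>2)) * indicator {arctan l..arctan u} x \<partial>lborel)"
  proof (rule nn_integral_cong_AE)
    have "AE x in lborel. x \<noteq> arctan l \<and> x \<noteq> arctan u"
      using AE_lborel_singleton[of "arctan l"] AE_lborel_singleton[of "arctan u"] by eventually_elim simp
    then show "AE x in lborel. ?w x * indicator (tan -` {l<..<u}) x
       = ennreal (inverse ((cos x)\<^sup>2)) * indicator {arctan l..arctan u} x"
    proof eventually_elim
      case (elim x)
      have "(- pi / 2 < x \<and> x < pi / 2 \<and> l < tan x \<and> tan x < u) \<longleftrightarrow> (arctan l \<le> x \<and> x \<le> arctan u)"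
        (is "?L \<longleftrightarrow> ?R")
      proof
        assume L: ?L
        then have "arctan (tan x) = x" by (intro arctan_tan) auto
        with L show ?R using arctan_less_iff[of l "tan x"] arctan_less_iff[of "tan x" u] by linarith
      next
        assume R: ?R
        then have "- pi / 2 < x" "x < pi / 2"
          using arctan_lbound[of l] arctan_ubound[of u] by auto
        moreover from this have "arctan (tan x) = x" by (intro arctan_tan) auto
        ultimately show ?L using R elim arctan_less_iff[of l "tan x"] arctan_less_iff[of "tan x" u] by auto
      qed
      then show ?case by (auto simp: indicator_def)
    qed
  qed
  also have "\<dots> = ennreal (tan (arctan u) - tan (arctan l))"
  proof (rule nn_integral_FTC_Icc)
    show "arctan l \<le> arctan u" using lu by (simp add: arctan_le_iff)
    fix x assume x: "x \<in> {arctan l..arctan u}"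
    then have "cos x \<noteq> 0"
      using cos_gt_zero_pi[of x] arctan_lbound[of l] arctan_ubound[of u] by auto
    then show "(tan has_real_derivative inverse ((cos x)\<^sup>2)) (at x)" by (rule DERIV_tan)
  qed auto
  finally show "emeasure (distr (density lborel ?w) borel tan) (box l u) = ennreal (\<Prod>b\<in>Basis. (u - l) \<bullet> b)"
    by (simp add: tan_arctan)
qed simp


text \<open>Polar coordinates from substitutions in one variable only: on x > 0 put y = x s, then s
  = tan \<phi>, then x = \<rho> cos \<phi>. The Jacobians x, 1 / cos^2 and cos multiply to \<rho>.
  The half-plane x < 0 is folded over by the point reflection, whence the second summand.\<close>

lemma nn_integral_half_polar:
  assumes f[measurable]: "f \<in> borel_measurable borel"
  shows "(\<integral>\<^sup>+z. f z \<partial>lborel) =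
    (\<integral>\<^sup>+\<phi>. indicator {- pi / 2 <..< pi / 2} \<phi> *
       (\<integral>\<^sup>+\<rho>. indicator {0<..} \<rho> * (ennreal \<rho> *
          (f (of_real \<rho> * cis \<phi>) + f (of_real \<rho> * - cis \<phi>))) \<partial>lborel) \<partial>lborel)"
proof -
  define g where "g x y = f (Complex x y) + f (Complex (- x) (- y))" for x y
  have gm[measurable]: "(\<lambda>x. g (a x) (b x)) \<in> borel_measurable M"
    if [measurable]: "a \<in> borel_measurable M" "b \<in> borel_measurable M" for a b and M :: "'z measure"
    unfolding g_def by measurable
  define F where "F x = (\<integral>\<^sup>+y. f (Complex x y) \<partial>lborel)" for x
  have F[measurable]: "F \<in> borel_measurable borel" unfolding F_def by measurable
  have "(\<integral>\<^sup>+z. f z \<partial>lborel) = (\<integral>\<^sup>+x. F x \<partial>lborel)"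
    unfolding F_def by (rule nn_integral_lborel_complex) measurable
  also have "\<dots> = (\<integral>\<^sup>+x. (indicator {0<..} x * F x + indicator {..<0} x * F x) \<partial>lborel)"
    by (rule nn_integral_cong_AE, use AE_lborel_singleton[of "0::real"] in eventually_elim)
       (auto simp: indicator_def)
  also have "\<dots> = (\<integral>\<^sup>+x. indicator {0<..} x * F x \<partial>lborel) + (\<integral>\<^sup>+x. indicator {..<0} x * F x \<partial>lborel)"
    by (rule nn_integral_add) auto
  also have "(\<integral>\<^sup>+x. indicator {..<0} x * F x \<partial>lborel) = (\<integral>\<^sup>+x. indicator {0<..} x * F (- x) \<partial>lborel)"
    by (subst nn_integral_real_affine[of _ "-1" 0]) (auto intro!: nn_integral_cong simp: indicator_def)
  also have "(\<integral>\<^sup>+x. indicator {0<..} x * F x \<partial>lborel) + \<dots>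
      = (\<integral>\<^sup>+x. (indicator {0<..} x * F x + indicator {0<..} x * F (- x)) \<partial>lborel)"
    by (rule nn_integral_add[symmetric]) auto
  also have "\<dots> = (\<integral>\<^sup>+x. (\<integral>\<^sup>+s. indicator {0<..} x * (ennreal x * g x (x * s)) \<partial>lborel) \<partial>lborel)"
  proof (rule nn_integral_cong)
    fix x :: real
    show "indicator {0<..} x * F x + indicator {0<..} x * F (- x)
        = (\<integral>\<^sup>+s. indicator {0<..} x * (ennreal x * g x (x * s)) \<partial>lborel)"
    proof (cases "x > 0")
      case True
      have "F (- x) = (\<integral>\<^sup>+y. f (Complex (- x) (- y)) \<partial>lborel)"
        unfolding F_def by (subst nn_integral_real_affine[of _ "-1" 0]) auto
      then have "F x + F (- x) = (\<integral>\<^sup>+y. g x y \<partial>lborel)"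
        unfolding g_def F_def by (simp add: nn_integral_add)
      also have "\<dots> = (\<integral>\<^sup>+s. ennreal x * g x (x * s) \<partial>lborel)"
        using True by (subst nn_integral_real_affine[of _ x 0]) (auto simp: nn_integral_cmult)
      finally show ?thesis using True by simp
    qed simp
  qed
  also have "\<dots> = (\<integral>\<^sup>+s. (\<integral>\<^sup>+x. indicator {0<..} x * (ennreal x * g x (x * s)) \<partial>lborel) \<partial>lborel)"
    by (rule lborel_pair.Fubini') measurable
  also have "\<dots> = (\<integral>\<^sup>+\<phi>. indicator {- pi / 2 <..< pi / 2} \<phi> * ennreal (inverse ((cos \<phi>)\<^sup>2)) *
      (\<integral>\<^sup>+x. indicator {0<..} x * (ennreal x * g x (x * tan \<phi>)) \<partial>lborel) \<partial>lborel)"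
  proof -
    have [measurable]: "(tan :: real \<Rightarrow> real) \<in> borel_measurable borel"
      unfolding tan_def[abs_def] by measurable
    show ?thesis
      by (subst (1) lborel_tan) (simp add: nn_integral_distr nn_integral_density mult.assoc)
  qed
  also have "\<dots> = (\<integral>\<^sup>+\<phi>. indicator {- pi / 2 <..< pi / 2} \<phi> *
       (\<integral>\<^sup>+\<rho>. indicator {0<..} \<rho> * (ennreal \<rho> * g (\<rho> * cos \<phi>) (\<rho> * sin \<phi>)) \<partial>lborel) \<partial>lborel)"
  proof (rule nn_integral_cong)
    fix \<phi> :: real
    show "indicator {- pi / 2 <..< pi / 2} \<phi> * ennreal (inverse ((cos \<phi>)\<^sup>2)) *
      (\<integral>\<^sup>+x. indicator {0<..} x * (ennreal x * g x (x * tan \<phi>)) \<partial>lborel) =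
      indicator {- pi / 2 <..< pi / 2} \<phi> *
       (\<integral>\<^sup>+\<rho>. indicator {0<..} \<rho> * (ennreal \<rho> * g (\<rho> * cos \<phi>) (\<rho> * sin \<phi>)) \<partial>lborel)"
    proof (cases "\<phi> \<in> {- pi / 2 <..< pi / 2}")
      case True
      then have c: "cos \<phi> > 0" by (intro cos_gt_zero_pi) auto
      have "ennreal (inverse ((cos \<phi>)\<^sup>2)) * (\<integral>\<^sup>+x. indicator {0<..} x * (ennreal x * g x (x * tan \<phi>)) \<partial>lborel)
        = ennreal (inverse ((cos \<phi>)\<^sup>2)) * (ennreal (cos \<phi>) *
            (\<integral>\<^sup>+x. indicator {0<..} (cos \<phi> * x) * (ennreal (cos \<phi> * x) * g (cos \<phi> * x) (cos \<phi> * x * tan \<phi>)) \<partial>lborel))"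
        using c by (subst nn_integral_real_affine[of _ "cos \<phi>" 0]) auto
      also have "\<dots> = (\<integral>\<^sup>+x. ennreal (inverse ((cos \<phi>)\<^sup>2)) * (ennreal (cos \<phi>) *
          (indicator {0<..} (cos \<phi> * x) * (ennreal (cos \<phi> * x) * g (cos \<phi> * x) (cos \<phi> * x * tan \<phi>)))) \<partial>lborel)"
        by (simp add: nn_integral_cmult)
      also have "\<dots> = (\<integral>\<^sup>+\<rho>. indicator {0<..} \<rho> * (ennreal \<rho> * g (\<rho> * cos \<phi>) (\<rho> * sin \<phi>)) \<partial>lborel)"
      proof (rule nn_integral_cong)
        fix x :: real
        have 1: "cos \<phi> * x * tan \<phi> = x * sin \<phi>" using c by (simp add: tan_def)
        have 2: "ennreal (inverse ((cos \<phi>)\<^sup>2)) * (ennreal (cos \<phi>) * (ennreal (cos \<phi> * x) * G)) = ennreal x * G"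
          if "x > 0" for G
        proof -
          have "ennreal (inverse ((cos \<phi>)\<^sup>2)) * (ennreal (cos \<phi>) * (ennreal (cos \<phi> * x) * G))
             = ennreal (inverse ((cos \<phi>)\<^sup>2) * (cos \<phi> * (cos \<phi> * x))) * G"
            using c that by (simp add: ennreal_mult mult.assoc)
          also have "inverse ((cos \<phi>)\<^sup>2) * (cos \<phi> * (cos \<phi> * x)) = x"
            using c by (simp add: power2_eq_square field_simps)
          finally show ?thesis .
        qed
        show "ennreal (inverse ((cos \<phi>)\<^sup>2)) * (ennreal (cos \<phi>) *
          (indicator {0<..} (cos \<phi> * x) * (ennreal (cos \<phi> * x) * g (cos \<phi> * x) (cos \<phi> * x * tan \<phi>))))
          = indicator {0<..} x * (ennreal x * g (x * cos \<phi>) (x * sin \<phi>))"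
          unfolding 1 using c 2[of "g (x * cos \<phi>) (x * sin \<phi>)"]
          by (cases "x > 0") (auto simp: zero_less_mult_iff mult.commute[of "cos \<phi>" x])
      qed
      finally show ?thesis using True by simp
    qed simp
  qed
  also have "\<dots> = (\<integral>\<^sup>+\<phi>. indicator {- pi / 2 <..< pi / 2} \<phi> *
       (\<integral>\<^sup>+\<rho>. indicator {0<..} \<rho> * (ennreal \<rho> *
          (f (of_real \<rho> * cis \<phi>) + f (of_real \<rho> * - cis \<phi>))) \<partial>lborel) \<partial>lborel)"
  proof -
    have "Complex (\<rho> * cos \<phi>) (\<rho> * sin \<phi>) = of_real \<rho> * cis \<phi>"
      "Complex (- (\<rho> * cos \<phi>)) (- (\<rho> * sin \<phi>)) = of_real \<rho> * - cis \<phi>" for \<rho> \<phi>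
      by (simp_all add: complex_eq_iff)
    then show ?thesis unfolding g_def by simp
  qed
  finally show ?thesis .
qed

text \<open>A quarter turn moves the angles of the right half-plane to (0, pi), and those of its
  point reflection to (pi, 2 pi).\<close>

lemma nn_integral_polar:
  assumes f[measurable]: "f \<in> borel_measurable borel"
  shows "(\<integral>\<^sup>+z. f z \<partial>lborel) =
    (\<integral>\<^sup>+\<rho>. indicator {0<..} \<rho> * (ennreal \<rho> *
       (\<integral>\<^sup>+\<phi>. indicator {0<..<2 * pi} \<phi> * f (of_real \<rho> * cis \<phi>) \<partial>lborel)) \<partial>lborel)"
proof -
  define G where "G \<phi> = (\<integral>\<^sup>+\<rho>. indicator {0<..} \<rho> * (ennreal \<rho> * f (of_real \<rho> * cis \<phi>)) \<partial>lborel)" for \<phi>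
  have G[measurable]: "G \<in> borel_measurable borel" unfolding G_def by measurable
  have i: "\<i> * (of_real \<rho> * cis \<phi>) = of_real \<rho> * cis (\<phi> + pi / 2)"
    "\<i> * (of_real \<rho> * - cis \<phi>) = of_real \<rho> * cis (\<phi> + 3 * pi / 2)" for \<rho> \<phi>
  proof -
    have e: "\<phi> + 3 * pi / 2 = \<phi> + pi / 2 + pi" by simp
    have "cos (\<phi> + 3 * pi / 2) = sin \<phi>" "sin (\<phi> + 3 * pi / 2) = - cos \<phi>"
      unfolding e by (simp_all only: sin_periodic_pi cos_periodic_pi) (simp_all add: cos_add sin_add)
    then show "\<i> * (of_real \<rho> * cis \<phi>) = of_real \<rho> * cis (\<phi> + pi / 2)"
      "\<i> * (of_real \<rho> * - cis \<phi>) = of_real \<rho> * cis (\<phi> + 3 * pi / 2)"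
      by (simp_all add: complex_eq_iff) (simp_all add: cos_add sin_add)
  qed
  have "(\<integral>\<^sup>+z. f z \<partial>lborel) = (\<integral>\<^sup>+z. f (\<i> * z) \<partial>lborel)"
    using nn_integral_rotate[OF f, of "pi / 2"] by simp
  also have "\<dots> = (\<integral>\<^sup>+\<phi>. indicator {- pi / 2 <..< pi / 2} \<phi> *
      (\<integral>\<^sup>+\<rho>. indicator {0<..} \<rho> * (ennreal \<rho> *
         (f (of_real \<rho> * cis (\<phi> + pi / 2)) + f (of_real \<rho> * cis (\<phi> + 3 * pi / 2)))) \<partial>lborel) \<partial>lborel)"
    by (subst nn_integral_half_polar) (auto simp only: i, measurable)
  also have "\<dots> = (\<integral>\<^sup>+\<phi>. indicator {- pi / 2 <..< pi / 2} \<phi> * (G (\<phi> + pi / 2) + G (\<phi> + 3 * pi / 2)) \<partial>lborel)"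
    unfolding G_def by (simp add: distrib_left nn_integral_add)
  also have "\<dots> = (\<integral>\<^sup>+\<phi>. indicator {0 <..< pi} (\<phi> + pi / 2) * G (\<phi> + pi / 2) \<partial>lborel) +
     (\<integral>\<^sup>+\<phi>. indicator {pi <..< 2 * pi} (\<phi> + 3 * pi / 2) * G (\<phi> + 3 * pi / 2) \<partial>lborel)"
    by (subst nn_integral_add[symmetric]) (auto intro!: nn_integral_cong simp: indicator_def)
  also have "(\<integral>\<^sup>+\<phi>. indicator {0 <..< pi} (\<phi> + pi / 2) * G (\<phi> + pi / 2) \<partial>lborel)
      = (\<integral>\<^sup>+\<phi>. indicator {0 <..< pi} \<phi> * G \<phi> \<partial>lborel)"
    by (rule nn_integral_lborel_shift[of "\<lambda>\<phi>. indicator {0 <..< pi} \<phi> * G \<phi>"]) measurable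
  also have "(\<integral>\<^sup>+\<phi>. indicator {pi <..< 2 * pi} (\<phi> + 3 * pi / 2) * G (\<phi> + 3 * pi / 2) \<partial>lborel)
      = (\<integral>\<^sup>+\<phi>. indicator {pi <..< 2 * pi} \<phi> * G \<phi> \<partial>lborel)"
    by (rule nn_integral_lborel_shift[of "\<lambda>\<phi>. indicator {pi <..< 2 * pi} \<phi> * G \<phi>"]) measurable
  also have "(\<integral>\<^sup>+\<phi>. indicator {0 <..< pi} \<phi> * G \<phi> \<partial>lborel) + (\<integral>\<^sup>+\<phi>. indicator {pi <..< 2 * pi} \<phi> * G \<phi> \<partial>lborel)
     = (\<integral>\<^sup>+\<phi>. (indicator {0 <..< pi} \<phi> * G \<phi> + indicator {pi <..< 2 * pi} \<phi> * G \<phi>) \<partial>lborel)"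
    by (rule nn_integral_add[symmetric]) auto
  also have "\<dots> = (\<integral>\<^sup>+\<phi>. indicator {0 <..< 2 * pi} \<phi> * G \<phi> \<partial>lborel)"
    by (rule nn_integral_cong_AE, use AE_lborel_singleton[of pi] in eventually_elim)
       (auto simp: indicator_def)
  also have "\<dots> = (\<integral>\<^sup>+\<phi>. \<integral>\<^sup>+\<rho>. indicator {0 <..< 2 * pi} \<phi> * (indicator {0<..} \<rho> * (ennreal \<rho> * f (of_real \<rho> * cis \<phi>))) \<partial>lborel \<partial>lborel)"
    unfolding G_def by (simp add: nn_integral_cmult)
  also have "\<dots> = (\<integral>\<^sup>+\<rho>. \<integral>\<^sup>+\<phi>. indicator {0 <..< 2 * pi} \<phi> * (indicator {0<..} \<rho> * (ennreal \<rho> * f (of_real \<rho> * cis \<phi>))) \<partial>lborel \<partial>lborel)"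
    by (rule lborel_pair.Fubini') measurable
  also have "\<dots> = (\<integral>\<^sup>+\<rho>. \<integral>\<^sup>+\<phi>. indicator {0<..} \<rho> * (ennreal \<rho> * (indicator {0 <..< 2 * pi} \<phi> * f (of_real \<rho> * cis \<phi>))) \<partial>lborel \<partial>lborel)"
    by (simp only: mult.left_commute)
  also have "\<dots> = (\<integral>\<^sup>+\<rho>. indicator {0<..} \<rho> * (ennreal \<rho> *
       (\<integral>\<^sup>+\<phi>. indicator {0<..<2 * pi} \<phi> * f (of_real \<rho> * cis \<phi>) \<partial>lborel)) \<partial>lborel)"
    by (simp add: nn_integral_cmult)
  finally show ?thesis .
qed

section \<open>Chords and the covariogram of a convex body\<close>

definition covariogram :: "'a::euclidean_space set \<Rightarrow> 'a \<Rightarrow> ennreal" where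
  "covariogram P v = emeasure lborel {y. y \<in> P \<and> y + v \<in> P}"

text \<open>The line in question has normal \<open>cis \<phi>\<close>, direction
  \<open>\<i> * cis \<phi>\<close> and signed distance s from the origin. For compact convex P and t
  >= 0, membership says that P cuts this line in a segment of length at least t.\<close>

definition offs :: "complex set \<Rightarrow> real \<Rightarrow> real \<Rightarrow> real set" where
  "offs P \<phi> t = {s. \<exists>y. cis \<phi> * Complex s y \<in> P \<and> cis \<phi> * Complex s (y + t) \<in> P}"

text \<open>This is the projection of a set that also records the height y of the lower point. The
  lifted set is compact, since both ends lie in the bounded set P and therefore t <= 2 R; continuous
  images of compact sets are compact, so no measurability of general projections is
  involved.\<close>

lemma closed_chord_set:
  assumes P: "compact P"
  shows "closed {(\<phi>, t, s). 0 \<le> \<phi> \<and> \<phi> \<le> 2 * pi \<and> 0 \<le> t \<and> s \<in> offs P \<phi> t}"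
proof -
  obtain R where R: "\<And>z. z \<in> P \<Longrightarrow> norm z \<le> R"
    using compact_imp_bounded[OF P] by (auto simp: bounded_iff)
  define C where "C = {p :: real \<times> real \<times> real \<times> real. 0 \<le> fst p \<and> fst p \<le> 2 * pi \<and> 0 \<le> fst (snd p)
    \<and> cis (fst p) * Complex (fst (snd (snd p))) (snd (snd (snd p))) \<in> P
    \<and> cis (fst p) * Complex (fst (snd (snd p))) (snd (snd (snd p)) + fst (snd p)) \<in> P}"
  have cl: "closed P" using P by (rule compact_imp_closed)
  have "closed C"
    unfolding C_def Complex_eq
    by (intro closed_Collect_conj closed_Collect_le continuous_intros
        closed_vimage[OF cl, unfolded vimage_def])
  moreover have "C \<subseteq> {0..2 * pi} \<times> {0..2 * R} \<times> {-R..R} \<times> {-R..R}"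
  proof
    fix p assume p: "p \<in> C"
    obtain \<phi> t s y where pe: "p = (\<phi>, t, s, y)" by (cases p) auto
    from p have h: "0 \<le> \<phi>" "\<phi> \<le> 2 * pi" "0 \<le> t" "norm (Complex s y) \<le> R" "norm (Complex s (y + t)) \<le> R"
      using R[of "cis \<phi> * Complex s y"] R[of "cis \<phi> * Complex s (y + t)"]
      by (auto simp: C_def pe norm_mult)
    have "\<bar>s\<bar> \<le> R" "\<bar>y\<bar> \<le> R" "\<bar>y + t\<bar> \<le> R"
      using abs_Re_le_cmod[of "Complex s y"] abs_Im_le_cmod[of "Complex s y"]
        abs_Im_le_cmod[of "Complex s (y + t)"] h by auto
    with h show "p \<in> {0..2 * pi} \<times> {0..2 * R} \<times> {-R..R} \<times> {-R..R}"
      by (auto simp: pe)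
  qed
  moreover have "compact ({0..2 * pi} \<times> {0..2 * R} \<times> {-R..R} \<times> {-R..R})"
    by (intro compact_Times compact_Icc)
  ultimately have "compact C"
    by (metis compact_Int_closed inf.absorb_iff2)
  moreover have "continuous_on C (\<lambda>p. (fst p, fst (snd p), fst (snd (snd p))))"
    by (intro continuous_intros)
  ultimately have cc: "compact ((\<lambda>p. (fst p, fst (snd p), fst (snd (snd p)))) ` C)"
    by (intro compact_continuous_image)
  have eq: "(\<lambda>p. (fst p, fst (snd p), fst (snd (snd p)))) ` C
      = {(\<phi>, t, s). 0 \<le> \<phi> \<and> \<phi> \<le> 2 * pi \<and> 0 \<le> t \<and> s \<in> offs P \<phi> t}"
  proof (intro set_eqI iffI)
    fix q :: "real \<times> real \<times> real"
    obtain \<phi> t s where q: "q = (\<phi>, t, s)" by (cases q) auto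
    {
      assume "q \<in> (\<lambda>p. (fst p, fst (snd p), fst (snd (snd p)))) ` C"
      then obtain p where "p \<in> C" "q = (fst p, fst (snd p), fst (snd (snd p)))" by blast
      then show "q \<in> {(\<phi>, t, s). 0 \<le> \<phi> \<and> \<phi> \<le> 2 * pi \<and> 0 \<le> t \<and> s \<in> offs P \<phi> t}"
        unfolding C_def offs_def by blast
    next
      assume "q \<in> {(\<phi>, t, s). 0 \<le> \<phi> \<and> \<phi> \<le> 2 * pi \<and> 0 \<le> t \<and> s \<in> offs P \<phi> t}"
      then obtain y where "(\<phi>, t, s, y) \<in> C"
        unfolding q C_def offs_def by auto
      then show "q \<in> (\<lambda>p. (fst p, fst (snd p), fst (snd (snd p)))) ` C"
        unfolding q by (intro image_eqI[of _ _ "(\<phi>, t, s, y)"]) simp_all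
    }
  qed
  from compact_imp_closed[OF cc] show ?thesis unfolding eq .
qed

text \<open>The joint measurability that Tonelli's theorem requires when directions and lengths are
  exchanged: the sections of a closed set have a measure that depends measurably on the
  parameter.\<close>

lemma chord_measurable:
  assumes P: "compact P"
  shows "(\<lambda>(\<phi>, t). indicator {0<..<2 * pi} \<phi> * (indicator {0<..} t * emeasure lborel (offs P \<phi> t)))
      \<in> borel_measurable (borel \<Otimes>\<^sub>M borel)"
proof -
  define E where "E = {((\<phi>, t), s). 0 \<le> \<phi> \<and> \<phi> \<le> 2 * pi \<and> 0 \<le> t \<and> s \<in> offs P \<phi> t}"
  have cl: "closed E"
  proof -
    have "closed ((\<lambda>((\<phi>, t), s). (\<phi>, t, s)) -`
        {(\<phi>, t, s). 0 \<le> \<phi> \<and> \<phi> \<le> 2 * pi \<and> 0 \<le> t \<and> s \<in> offs P \<phi> t})"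
      unfolding case_prod_beta
      by (rule closed_vimage[OF closed_chord_set[OF P, unfolded case_prod_beta]]) (intro continuous_intros)
    also have "(\<lambda>((\<phi>, t), s). (\<phi>, t, s)) -`
        {(\<phi>, t, s). 0 \<le> \<phi> \<and> \<phi> \<le> 2 * pi \<and> 0 \<le> t \<and> s \<in> offs P \<phi> t} = E"
      by (auto simp: E_def)
    finally show ?thesis .
  qed
  have "E \<in> sets ((borel \<Otimes>\<^sub>M borel) \<Otimes>\<^sub>M (lborel :: real measure))"
    using borel_closed[OF cl] by (simp add: borel_prod[symmetric] cong: sets_pair_measure_cong)
  from lborel.measurable_emeasure_Pair[OF this]
  have [measurable]: "(\<lambda>p. emeasure lborel (Pair p -` E)) \<in> borel_measurable (borel \<Otimes>\<^sub>M borel)" .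
  have "(\<lambda>p. indicator {0<..<2 * pi} (fst p) * (indicator {0<..} (snd p) * emeasure lborel (Pair p -` E)))
      \<in> borel_measurable (borel \<Otimes>\<^sub>M borel)"
    by measurable
  also have "(\<lambda>p. indicator {0<..<2 * pi} (fst p) * (indicator {0<..} (snd p) * emeasure lborel (Pair p -` E)))
    = (\<lambda>(\<phi>, t). indicator {0<..<2 * pi} \<phi> * (indicator {0<..} t * emeasure lborel (offs P \<phi> t)))"
  proof (rule ext, clarify)
    fix \<phi> t :: real
    have "Pair (\<phi>, t) -` E = offs P \<phi> t" if "\<phi> \<in> {0<..<2 * pi}" "t > 0"
      using that by (auto simp: E_def)
    then show "indicator {0<..<2 * pi} (fst (\<phi>, t)) * (indicator {0<..} (snd (\<phi>, t)) * emeasure lborel (Pair (\<phi>, t) -` E))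
      = indicator {0<..<2 * pi} \<phi> * (indicator {0<..} t * emeasure lborel (offs P \<phi> t))"
      by (auto simp: indicator_def)
  qed
  finally show ?thesis .
qed

lemma compact_offs:
  assumes "compact P" "0 \<le> \<phi>" "\<phi> \<le> 2 * pi" "0 \<le> t"
  shows "compact (offs P \<phi> t)"
proof -
  have "closed ((\<lambda>s. (\<phi>, t, s)) -`
      {(\<phi>, t, s). 0 \<le> \<phi> \<and> \<phi> \<le> 2 * pi \<and> 0 \<le> t \<and> s \<in> offs P \<phi> t})"
    by (rule closed_vimage[OF closed_chord_set[OF assms(1)]]) (intro continuous_intros)
  also have "(\<lambda>s. (\<phi>, t, s)) -`
      {(\<phi>, t, s). 0 \<le> \<phi> \<and> \<phi> \<le> 2 * pi \<and> 0 \<le> t \<and> s \<in> offs P \<phi> t} = offs P \<phi> t"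
    using assms by auto
  finally have "closed (offs P \<phi> t)" .
  moreover obtain R where R: "\<And>z. z \<in> P \<Longrightarrow> norm z \<le> R"
    using compact_imp_bounded[OF assms(1)] by (auto simp: bounded_iff)
  have "norm s \<le> R" if "s \<in> offs P \<phi> t" for s
  proof -
    from that obtain y where "cis \<phi> * Complex s y \<in> P" by (auto simp: offs_def)
    then have "norm (Complex s y) \<le> R" using R by (fastforce simp: norm_mult)
    then show ?thesis using abs_Re_le_cmod[of "Complex s y"] by simp
  qed
  then have "bounded (offs P \<phi> t)" by (auto simp: bounded_iff)
  ultimately show ?thesis by (simp add: compact_eq_bounded_closed)
qed

lemma convex_offs:
  assumes P: "convex P"
  shows "convex (offs P \<phi> t)"
proof (rule convexI)
  fix s s' u v :: real
  assume "s \<in> offs P \<phi> t" "s' \<in> offs P \<phi> t" and uv: "0 \<le> u" "0 \<le> v" "u + v = 1"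
  then obtain y y' where y: "cis \<phi> * Complex s y \<in> P" "cis \<phi> * Complex s (y + t) \<in> P"
    "cis \<phi> * Complex s' y' \<in> P" "cis \<phi> * Complex s' (y' + t) \<in> P"
    by (auto simp: offs_def)
  have e: "u *\<^sub>R (cis \<phi> * Complex s a) + v *\<^sub>R (cis \<phi> * Complex s' b)
      = cis \<phi> * Complex (u * s + v * s') (u * a + v * b)" for a b
    by (simp add: complex_eq_iff algebra_simps)
  have "u * (y + t) + v * (y' + t) = u * y + v * y' + (u + v) * t"
    by (simp add: algebra_simps)
  with uv have t: "u * (y + t) + v * (y' + t) = u * y + v * y' + t" by simp
  from convexD[OF P y(1,3) uv] convexD[OF P y(2,4) uv]
  show "u *\<^sub>R s + v *\<^sub>R s' \<in> offs P \<phi> t"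
    unfolding offs_def e t by auto
qed

lemma compact_slice:
  assumes "compact P"
  shows "compact {y. cis \<phi> * Complex s y \<in> P}"
proof -
  have "closed {y. cis \<phi> * Complex s y \<in> P}"
    unfolding Complex_eq
    by (rule closed_vimage[OF compact_imp_closed[OF assms], unfolded vimage_def]) (intro continuous_intros)
  moreover obtain R where R: "\<And>z. z \<in> P \<Longrightarrow> norm z \<le> R"
    using compact_imp_bounded[OF assms(1)] by (auto simp: bounded_iff)
  have "norm y \<le> R" if "cis \<phi> * Complex s y \<in> P" for y
    using R[OF that] abs_Im_le_cmod[of "Complex s y"] by (simp add: norm_mult)
  then have "bounded {y. cis \<phi> * Complex s y \<in> P}" by (auto simp: bounded_iff)
  ultimately show ?thesis by (simp add: compact_eq_bounded_closed)
qed

lemma convex_slice: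
  assumes P: "convex P"
  shows "convex {y. cis \<phi> * Complex s y \<in> P}"
proof (rule convexI, clarify)
  fix a b u v :: real
  assume y: "cis \<phi> * Complex s a \<in> P" "cis \<phi> * Complex s b \<in> P" and uv: "0 \<le> u" "0 \<le> v" "u + v = 1"
  have "u *\<^sub>R (cis \<phi> * Complex s a) + v *\<^sub>R (cis \<phi> * Complex s b)
      = cis \<phi> * Complex ((u + v) * s) (u * a + v * b)"
    by (simp add: complex_eq_iff algebra_simps)
  with convexD[OF P y uv] uv show "cis \<phi> * Complex s (u *\<^sub>R a + v *\<^sub>R b) \<in> P" by simp
qed

lemma compact_convex_real:
  fixes S :: "real set"
  assumes "compact S" "convex S" "S \<noteq> {}"
  shows "S = {Inf S..Sup S}" "Inf S \<le> Sup S"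
proof -
  have b: "bdd_above S" "bdd_below S"
    using compact_imp_bounded[OF assms(1)] bounded_imp_bdd_above bounded_imp_bdd_below by auto
  have i: "Inf S \<in> S" "Sup S \<in> S"
    using assms b compact_imp_closed closed_contains_Inf closed_contains_Sup by blast+
  show "S = {Inf S..Sup S}"
  proof
    show "S \<subseteq> {Inf S..Sup S}" using b by (auto intro: cInf_lower cSup_upper)
    have "is_interval S" using assms(2) by (simp add: is_interval_convex_1)
    then show "{Inf S..Sup S} \<subseteq> S"
      using i unfolding is_interval_1 by (meson atLeastAtMost_iff subsetI)
  qed
  show "Inf S \<le> Sup S" using i b by (auto intro: cInf_lower)
qed

text \<open>A slice is an interval, of length l say. It overlaps its translate by x in length max 0
  (l - x), which is the measure of the t in (x, l]; and t <= l means that s is an offset for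
  t.\<close>

lemma emeasure_slice_chords:
  assumes P: "compact P" "convex P" and x: "0 \<le> x"
  shows "emeasure lborel {y. cis \<phi> * Complex s y \<in> P \<and> cis \<phi> * Complex s (y + x) \<in> P}
    = (\<integral>\<^sup>+t. indicator {x<..} t * indicator (offs P \<phi> t) s \<partial>lborel)"
proof -
  define I where "I = {y. cis \<phi> * Complex s y \<in> P}"
  have c: "compact I" "convex I"
    unfolding I_def using P compact_slice convex_slice by auto
  have L: "{y. cis \<phi> * Complex s y \<in> P \<and> cis \<phi> * Complex s (y + x) \<in> P} = {y. y \<in> I \<and> y + x \<in> I}"
    by (simp add: I_def)
  have R: "(indicator (offs P \<phi> t) s :: ennreal) = indicator {t. \<exists>y. y \<in> I \<and> y + t \<in> I} t" for t
    by (simp add: offs_def I_def indicator_def)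
  show ?thesis
  proof (cases "I = {}")
    case True
    then show ?thesis unfolding L R by simp
  next
    case False
    define a b where "a = Inf I" and "b = Sup I"
    have I: "I = {a..b}" and ab: "a \<le> b"
      using compact_convex_real[OF c False] by (simp_all add: a_def b_def)
    have "{y. y \<in> I \<and> y + x \<in> I} = {a..b - x}" using x by (auto simp: I)
    moreover have "(\<integral>\<^sup>+t. indicator {x<..} t * indicator {t. \<exists>y. y \<in> I \<and> y + t \<in> I} t \<partial>lborel)
        = (\<integral>\<^sup>+t. indicator {x<..b - a} t \<partial>lborel)"
    proof (rule nn_integral_cong)
      fix t :: real
      have "(x < t \<and> (\<exists>y. y \<in> I \<and> y + t \<in> I)) \<longleftrightarrow> x < t \<and> t \<le> b - a"
      proof safe
        fix y assume "y \<in> I" "y + t \<in> I" then show "t \<le> b - a" by (auto simp: I)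
      next
        assume "x < t" "t \<le> b - a"
        then have "a \<in> I" "a + t \<in> I" using x ab by (auto simp: I)
        then show "\<exists>y. y \<in> I \<and> y + t \<in> I" by blast
      qed
      then show "indicator {x<..} t * indicator {t. \<exists>y. y \<in> I \<and> y + t \<in> I} t
        = (indicator {x<..b - a} t :: ennreal)"
        by (auto simp: indicator_def)
    qed
    moreover have "emeasure lborel {a..b - x} = emeasure lborel {x<..b - a}"
      by (cases "x \<le> b - a") (auto simp: algebra_simps)
    ultimately show ?thesis unfolding L R by simp
  qed
qed

text \<open>Rotating by \<phi> makes the translation vertical, so that each vertical line is treated
  by \<open>emeasure_slice_chords\<close>; Tonelli's theorem then exchanges offset and
  length.\<close>

lemma covariogram_direction:
  assumes P: "compact P" "convex P" and x: "0 \<le> x" and \<phi>: "\<phi> \<in> {0<..<2 * pi}"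
  shows "covariogram P (of_real x * (\<i> * cis \<phi>))
    = (\<integral>\<^sup>+t. indicator {x<..} t * emeasure lborel (offs P \<phi> t) \<partial>lborel)"
proof -
  have cl: "closed P" using P(1) by (rule compact_imp_closed)
  define S where "S = {z. z \<in> P \<and> z + of_real x * (\<i> * cis \<phi>) \<in> P}"
  have "closed S"
    unfolding S_def
    by (intro closed_Collect_conj closed_vimage[OF cl, unfolded vimage_def] continuous_intros)
  then have [measurable]: "S \<in> sets borel" by (rule borel_closed)
  have e: "cis \<phi> * Complex s y \<in> S \<longleftrightarrow> cis \<phi> * Complex s y \<in> P \<and> cis \<phi> * Complex s (y + x) \<in> P" for s y
  proof -
    have "cis \<phi> * Complex s y + of_real x * (\<i> * cis \<phi>) = cis \<phi> * Complex s (y + x)"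
      by (simp add: complex_eq_iff algebra_simps)
    then show ?thesis by (simp add: S_def)
  qed
  have "covariogram P (of_real x * (\<i> * cis \<phi>)) = (\<integral>\<^sup>+z. indicator S z \<partial>lborel)"
    by (simp add: covariogram_def S_def[symmetric])
  also have "\<dots> = (\<integral>\<^sup>+z. indicator S (cis \<phi> * z) \<partial>lborel)"
    by (rule nn_integral_rotate[symmetric]) measurable
  also have "\<dots> = (\<integral>\<^sup>+s. \<integral>\<^sup>+y. indicator S (cis \<phi> * Complex s y) \<partial>lborel \<partial>lborel)"
    by (rule nn_integral_lborel_complex) measurable
  also have "\<dots> = (\<integral>\<^sup>+s. \<integral>\<^sup>+t. indicator {x<..} t * indicator (offs P \<phi> t) s \<partial>lborel \<partial>lborel)"
  proof (rule nn_integral_cong)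
    fix s :: real
    have [measurable]: "{y. cis \<phi> * Complex s y \<in> S} \<in> sets borel" by measurable
    have "(\<integral>\<^sup>+y. indicator S (cis \<phi> * Complex s y) \<partial>lborel) = (\<integral>\<^sup>+y. indicator {y. cis \<phi> * Complex s y \<in> S} y \<partial>lborel)"
      by (auto intro!: nn_integral_cong simp: indicator_def)
    also have "\<dots> = emeasure lborel {y. cis \<phi> * Complex s y \<in> S}" by simp
    also have "\<dots> = (\<integral>\<^sup>+t. indicator {x<..} t * indicator (offs P \<phi> t) s \<partial>lborel)"
      unfolding e by (rule emeasure_slice_chords[OF P x])
    finally show "(\<integral>\<^sup>+y. indicator S (cis \<phi> * Complex s y) \<partial>lborel)
      = (\<integral>\<^sup>+t. indicator {x<..} t * indicator (offs P \<phi> t) s \<partial>lborel)" .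
  qed
  also have "\<dots> = (\<integral>\<^sup>+t. \<integral>\<^sup>+s. indicator {x<..} t * indicator (offs P \<phi> t) s \<partial>lborel \<partial>lborel)"
  proof (rule lborel_pair.Fubini')
    define D where "D = {(t, s). 0 \<le> t \<and> s \<in> offs P \<phi> t}"
    have "closed ((\<lambda>(t, s). (\<phi>, t, s)) -`
        {(\<phi>, t, s). 0 \<le> \<phi> \<and> \<phi> \<le> 2 * pi \<and> 0 \<le> t \<and> s \<in> offs P \<phi> t})"
      unfolding case_prod_beta
      by (rule closed_vimage[OF closed_chord_set[OF P(1), unfolded case_prod_beta]]) (intro continuous_intros)
    also have "(\<lambda>(t, s). (\<phi>, t, s)) -`
        {(\<phi>, t, s). 0 \<le> \<phi> \<and> \<phi> \<le> 2 * pi \<and> 0 \<le> t \<and> s \<in> offs P \<phi> t} = D"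
      using \<phi> by (auto simp: D_def)
    finally have "D \<in> sets borel" by (rule borel_closed)
    then have [measurable]: "D \<in> sets (borel \<Otimes>\<^sub>M borel)" unfolding borel_prod .
    have "(\<lambda>p. indicator {x<..} (fst p) * (indicator D p :: ennreal)) \<in> borel_measurable (lborel \<Otimes>\<^sub>M lborel)"
      by measurable
    also have "(\<lambda>p. indicator {x<..} (fst p) * (indicator D p :: ennreal))
      = (\<lambda>(t, s). indicator {x<..} t * indicator (offs P \<phi> t) s)"
      using x by (auto simp: D_def indicator_def fun_eq_iff)
    finally show "(\<lambda>(t, s). indicator {x<..} t * (indicator (offs P \<phi> t) s :: ennreal))
      \<in> borel_measurable (lborel \<Otimes>\<^sub>M lborel)" .
  qed
  also have "\<dots> = (\<integral>\<^sup>+t. indicator {x<..} t * emeasure lborel (offs P \<phi> t) \<partial>lborel)"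
  proof (rule nn_integral_cong)
    fix t :: real
    show "(\<integral>\<^sup>+s. indicator {x<..} t * indicator (offs P \<phi> t) s \<partial>lborel)
      = indicator {x<..} t * emeasure lborel (offs P \<phi> t)"
    proof (cases "x < t")
      case True
      then have "compact (offs P \<phi> t)" using x \<phi> P by (intro compact_offs) auto
      then have "offs P \<phi> t \<in> sets lborel" using borel_compact by auto
      from nn_integral_cmult_indicator[OF this] show ?thesis .
    qed simp
  qed
  finally show ?thesis .
qed

lemma covariogram_measurable:
  fixes P :: "'a::euclidean_space set"
  assumes [measurable]: "P \<in> sets borel"
  shows "covariogram P \<in> borel_measurable borel"
proof -
  have "covariogram P = (\<lambda>v. \<integral>\<^sup>+y. indicator P y * indicator P (y + v) \<partial>lborel)"
  proof
    fix v
    have [measurable]: "{y. y \<in> P \<and> y + v \<in> P} \<in> sets borel" by measurable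
    have "covariogram P v = (\<integral>\<^sup>+y. indicator {y. y \<in> P \<and> y + v \<in> P} y \<partial>lborel)"
      by (simp add: covariogram_def)
    also have "\<dots> = (\<integral>\<^sup>+y. indicator P y * indicator P (y + v) \<partial>lborel)"
      by (auto intro!: nn_integral_cong simp: indicator_def)
    finally show "covariogram P v = (\<integral>\<^sup>+y. indicator P y * indicator P (y + v) \<partial>lborel)" .
  qed
  then show ?thesis by simp
qed

text \<open>Independence gives a double integral over P, and y = x + v turns it into an integral
  over v of the measure of the x with x and x + v in P. Each uniform law contributes one
  division.\<close>

lemma emeasure_distr_dist:
  fixes P :: "'a::euclidean_space set" and X Y :: "'w \<Rightarrow> 'a"
  assumes M: "prob_space M" and ind: "prob_space.indep_var M borel X borel Y"
    and X: "distr M borel X = uniform_measure lborel P"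
    and Y: "distr M borel Y = uniform_measure lborel P"
    and P[measurable]: "P \<in> sets borel" and B[measurable]: "B \<in> sets borel"
  shows "emeasure (distr M lborel (\<lambda>\<omega>. dist (X \<omega>) (Y \<omega>))) B
    = (\<integral>\<^sup>+v. indicator B (norm v) * covariogram P v \<partial>lborel) / emeasure lborel P / emeasure lborel P"
proof -
  interpret prob_space M by (rule M)
  let ?U = "uniform_measure lborel P"
  have Xm[measurable]: "X \<in> borel_measurable M" and Ym[measurable]: "Y \<in> borel_measurable M"
    and j: "distr M borel X \<Otimes>\<^sub>M distr M borel Y = distr M (borel \<Otimes>\<^sub>M borel) (\<lambda>x. (X x, Y x))"
    using ind by (simp_all add: indep_var_distribution_eq)
  interpret U: prob_space ?U unfolding X[symmetric] by (rule prob_space_distr) simp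
  have "emeasure (distr M lborel (\<lambda>\<omega>. dist (X \<omega>) (Y \<omega>))) B
      = (\<integral>\<^sup>+\<omega>. indicator B (dist (X \<omega>) (Y \<omega>)) \<partial>M)"
  proof -
    have "emeasure (distr M lborel (\<lambda>\<omega>. dist (X \<omega>) (Y \<omega>))) B
      = (\<integral>\<^sup>+x. indicator B x \<partial>distr M lborel (\<lambda>\<omega>. dist (X \<omega>) (Y \<omega>)))" by simp
    also have "\<dots> = (\<integral>\<^sup>+\<omega>. indicator B (dist (X \<omega>) (Y \<omega>)) \<partial>M)"
      by (subst nn_integral_distr) auto
    finally show ?thesis .
  qed
  also have "\<dots> = (\<integral>\<^sup>+p. indicator B (dist (fst p) (snd p)) \<partial>distr M (borel \<Otimes>\<^sub>M borel) (\<lambda>x. (X x, Y x)))"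
    by (subst nn_integral_distr) auto
  also have "\<dots> = (\<integral>\<^sup>+p. indicator B (dist (fst p) (snd p)) \<partial>(?U \<Otimes>\<^sub>M ?U))"
    by (simp only: j[symmetric] X Y)
  also have "\<dots> = (\<integral>\<^sup>+x. \<integral>\<^sup>+y. indicator B (dist x y) \<partial>?U \<partial>?U)"
    by (subst U.nn_integral_fst[symmetric]) auto
  also have "\<dots> = (\<integral>\<^sup>+x. (\<integral>\<^sup>+y. indicator B (dist x y) * indicator P y \<partial>lborel) / emeasure lborel P \<partial>?U)"
    by (subst nn_integral_uniform_measure) auto
  also have "\<dots> = (\<integral>\<^sup>+x. ((\<integral>\<^sup>+y. indicator B (dist x y) * indicator P y \<partial>lborel) / emeasure lborel P) * indicator P x \<partial>lborel)
      / emeasure lborel P"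
    by (subst nn_integral_uniform_measure) auto
  also have "(\<integral>\<^sup>+x. ((\<integral>\<^sup>+y. indicator B (dist x y) * indicator P y \<partial>lborel) / emeasure lborel P) * indicator P x \<partial>lborel)
      = (\<integral>\<^sup>+x. (\<integral>\<^sup>+y. indicator B (dist x y) * indicator P y \<partial>lborel) * indicator P x / emeasure lborel P \<partial>lborel)"
    by (simp add: divide_ennreal_def mult_ac)
  also have "\<dots> = (\<integral>\<^sup>+x. (\<integral>\<^sup>+y. indicator B (dist x y) * indicator P y \<partial>lborel) * indicator P x \<partial>lborel) / emeasure lborel P"
    by (rule nn_integral_divide) measurable
  also have "(\<integral>\<^sup>+x. (\<integral>\<^sup>+y. indicator B (dist x y) * indicator P y \<partial>lborel) * indicator P x \<partial>lborel)
      = (\<integral>\<^sup>+x. (\<integral>\<^sup>+v. indicator B (norm v) * (indicator P x * indicator P (x + v)) \<partial>lborel) \<partial>lborel)"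
  proof (rule nn_integral_cong)
    fix x :: 'a
    have "(\<integral>\<^sup>+y. indicator B (dist x y) * indicator P y \<partial>lborel)
        = (\<integral>\<^sup>+y. indicator B (dist x (y + x)) * (indicator P (y + x) :: ennreal) \<partial>lborel)"
      by (rule nn_integral_lborel_shift[symmetric]) measurable
    also have "\<dots> = (\<integral>\<^sup>+v. indicator B (norm v) * indicator P (x + v) \<partial>lborel)"
      by (simp add: dist_norm add.commute)
    finally have e: "(\<integral>\<^sup>+y. indicator B (dist x y) * indicator P y \<partial>lborel)
        = (\<integral>\<^sup>+v. indicator B (norm v) * (indicator P (x + v) :: ennreal) \<partial>lborel)" .
    show "(\<integral>\<^sup>+y. indicator B (dist x y) * indicator P y \<partial>lborel) * indicator P x
       = (\<integral>\<^sup>+v. indicator B (norm v) * (indicator P x * indicator P (x + v)) \<partial>lborel)"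
      unfolding e by (cases "x \<in> P") auto
  qed
  also have "\<dots> = (\<integral>\<^sup>+v. (\<integral>\<^sup>+x. indicator B (norm v) * (indicator P x * indicator P (x + v)) \<partial>lborel) \<partial>lborel)"
    by (rule lborel_pair.Fubini') measurable
  also have "\<dots> = (\<integral>\<^sup>+v. indicator B (norm v) * covariogram P v \<partial>lborel)"
  proof (rule nn_integral_cong)
    fix v :: 'a
    have [measurable]: "{y. y \<in> P \<and> y + v \<in> P} \<in> sets borel" by measurable
    have "covariogram P v = (\<integral>\<^sup>+y. indicator {y. y \<in> P \<and> y + v \<in> P} y \<partial>lborel)"
      by (simp add: covariogram_def)
    also have "\<dots> = (\<integral>\<^sup>+x. indicator P x * indicator P (x + v) \<partial>lborel)"
      by (auto intro!: nn_integral_cong simp: indicator_def)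
    finally show "(\<integral>\<^sup>+x. indicator B (norm v) * (indicator P x * indicator P (x + v)) \<partial>lborel)
      = indicator B (norm v) * covariogram P v"
      by (simp add: nn_integral_cmult)
  qed
  finally show ?thesis .
qed

section \<open>Extremal chords of the regular polygon\<close>

locale regular_ngon =
  fixes n :: nat and r :: real
  assumes n3: "n \<ge> 3" and r0: "r > 0"
begin

abbreviation \<alpha> :: real where "\<alpha> \<equiv> alpha n"

text \<open>In this position the symmetries are multiplications by unit complex numbers and
  conjugation. The general position is reached at the very end by a rotation and a
  translation.\<close>

definition P :: "complex set" where "P = regular_polygon n r 0 0"

lemma alpha_pos: "\<alpha> > 0" and alpha_le: "\<alpha> \<le> pi / 3" and n_alpha: "real n * \<alpha> = pi"
proof -
  show "\<alpha> > 0" "real n * \<alpha> = pi" using n3 by (simp_all add: alpha_def)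
  have "pi * 3 \<le> pi * real n" by (rule mult_left_mono) (use n3 in auto)
  then show "\<alpha> \<le> pi / 3" using n3 by (simp add: alpha_def field_simps)
qed

lemma alpha_less_pi2: "\<alpha> < pi / 2"
  using alpha_le pi_gt_zero by linarith

lemma cos_alpha_pos: "cos \<alpha> > 0" and sin_alpha_pos: "sin \<alpha> > 0"
  using alpha_pos alpha_less_pi2 by (auto intro!: cos_gt_zero_pi sin_gt_zero)

definition vert :: "nat \<Rightarrow> complex" where "vert j = of_real r * cis (2 * real j * \<alpha>)"

lemma P_eq: "P = convex hull (vert ` {..<n})"
  unfolding P_def regular_polygon_def vert_def[abs_def] alpha_def by (simp add: mult_ac)

lemma vert_n: "vert n = vert 0"
proof -
  have e: "2 * real n * \<alpha> = 2 * pi" using n_alpha by simp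
  show ?thesis unfolding vert_def e by simp
qed

lemma convex_P: "convex P" and compact_P: "compact P"
  unfolding P_eq by (auto intro: finite_imp_compact_convex_hull)

text \<open>Linear maps commute with convex hulls, so a symmetry of the polygon has to be checked on
  the vertices only.\<close>

lemma closed_linear_P:
  assumes "linear f" "\<And>j. j < n \<Longrightarrow> f (vert j) \<in> vert ` {..<n}" "z \<in> P"
  shows "f z \<in> P"
proof -
  have "f ` P = convex hull (f ` vert ` {..<n})"
    unfolding P_eq by (rule convex_hull_linear_image[OF assms(1)])
  also have "\<dots> \<subseteq> P" unfolding P_eq by (rule hull_mono) (use assms(2) in auto)
  finally show ?thesis using assms(3) by auto
qed

lemma rotate_P: assumes "z \<in> P" shows "cis (2 * \<alpha>) * z \<in> P"
proof (rule closed_linear_P[OF _ _ assms])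
  show "linear ((*) (cis (2 * \<alpha>)))" by (rule linear_times)
  fix j assume j: "j < n"
  have e: "cis (2 * \<alpha>) * vert j = vert (Suc j)"
    by (simp add: vert_def mult.left_commute cis_mult algebra_simps)
  show "cis (2 * \<alpha>) * vert j \<in> vert ` {..<n}"
  proof (cases "Suc j = n")
    case True
    then show ?thesis unfolding e True vert_n using n3 by (intro imageI) auto
  next
    case False
    then show ?thesis unfolding e using j by (intro imageI) auto
  qed
qed

lemma cnj_P: assumes "z \<in> P" shows "cnj z \<in> P"
proof (rule closed_linear_P[OF _ _ assms])
  show "linear cnj" by (rule bounded_linear.linear[OF bounded_linear_cnj])
  fix j assume j: "j < n"
  show "cnj (vert j) \<in> vert ` {..<n}"
  proof (cases "j = 0")
    case True
    then show ?thesis using j by (auto simp: vert_def intro!: image_eqI[of _ _ 0])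
  next
    case False
    have "2 * real (n - j) * \<alpha> = 2 * pi - 2 * real j * \<alpha>"
      using j n_alpha by (simp add: of_nat_diff algebra_simps)
    then have "vert (n - j) = cnj (vert j)"
      by (simp add: vert_def complex_eq_iff)
    then show ?thesis using False j by (intro image_eqI[of _ _ "n - j"]) auto
  qed
qed

lemma rotate_P_int: assumes "z \<in> P" shows "cis (2 * of_int m * \<alpha>) * z \<in> P"
proof -
  have nat: "cis (2 * real m * \<alpha>) * z \<in> P" if "z \<in> P" for m z
  proof (induction m)
    case (Suc m)
    have "cis (2 * real (Suc m) * \<alpha>) * z = cis (2 * \<alpha>) * (cis (2 * real m * \<alpha>) * z)"
      by (simp add: mult.assoc[symmetric] cis_mult distrib_left distrib_right)
    then show ?case using rotate_P[OF Suc] by (simp only:)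
  qed (use that in simp)
  show ?thesis
  proof (cases "m \<ge> 0")
    case True
    then show ?thesis using nat[OF assms, of "nat m"] by simp
  next
    case False
    \<comment> \<open>Conjugation reverses the sense of rotation, which reduces negative m to
      natural exponents.\<close>
    from nat[OF cnj_P[OF assms], of "nat (- m)"]
    have "cnj (cis (2 * real (nat (- m)) * \<alpha>) * cnj z) \<in> P" by (rule cnj_P)
    then show ?thesis using False by (simp add: cis_cnj)
  qed
qed

lemma rotate_P_iff: "cis (2 * of_int m * \<alpha>) * z \<in> P \<longleftrightarrow> z \<in> P"
proof
  assume "cis (2 * of_int m * \<alpha>) * z \<in> P"
  from rotate_P_int[OF this, of "- m"] show "z \<in> P"
    by (simp add: mult.assoc[symmetric] cis_mult)
qed (rule rotate_P_int)

lemma cnj_P_iff: "cnj z \<in> P \<longleftrightarrow> z \<in> P"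
  using cnj_P[of z] cnj_P[of "cnj z"] by auto

lemma vertex_in_P: "of_real r * cis (2 * of_int m * \<alpha>) \<in> P"
proof -
  have "vert 0 \<in> P" unfolding P_eq by (rule hull_inc) (use n3 in auto)
  from rotate_P_int[OF this, of m] show ?thesis by (simp add: vert_def mult.commute)
qed

lemma norm_P: assumes "z \<in> P" shows "norm z \<le> r"
proof -
  have "P \<subseteq> cball 0 r"
    unfolding P_eq by (rule hull_minimal) (use r0 in \<open>auto simp: vert_def norm_mult\<close>)
  with assms show ?thesis by auto
qed

text \<open>A linear bound needs to be checked at the vertices only. Measured from the edge normal
  at angle \<alpha>, vertex 0 lies at angle - \<alpha> and the others in
  [\<alpha>, 2 pi - \<alpha>].\<close>

lemma halfplane_P: assumes "z \<in> P" shows "Re (z * cis (- \<alpha>)) \<le> r * cos \<alpha>"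
proof -
  have v: "cos (2 * real j * \<alpha> - \<alpha>) \<le> cos \<alpha>" if j: "j < n" for j
  proof (cases "j = 0")
    case False
    define x where "x = 2 * real j * \<alpha> - \<alpha>"
    have "real j * \<alpha> \<ge> 1 * \<alpha>" using False alpha_pos by (intro mult_right_mono) auto
    then have x1: "\<alpha> \<le> x" unfolding x_def by linarith
    have "(real j + 1) * \<alpha> \<le> real n * \<alpha>" using j alpha_pos by (intro mult_right_mono) auto
    then have x2: "x \<le> 2 * pi - \<alpha>"
      unfolding x_def n_alpha using alpha_pos by (simp add: algebra_simps)
    show ?thesis
    proof (cases "x \<le> pi")
      case True
      then show ?thesis using x1 alpha_pos unfolding x_def[symmetric] by (intro cos_monotone_0_pi_le) auto
    next
      case False
      have "cos (2 * pi - x) \<le> cos \<alpha>"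
        using x2 False alpha_pos by (intro cos_monotone_0_pi_le) auto
      then show ?thesis unfolding x_def[symmetric] by simp
    qed
  qed simp
  have "linear (\<lambda>z. Re (z * cis (- \<alpha>)))"
    by (intro bounded_linear.linear[OF bounded_linear_compose[OF bounded_linear_Re bounded_linear_mult_left]])
  then have "convex {z. Re (z * cis (- \<alpha>)) \<le> r * cos \<alpha>}"
    using convex_linear_vimage[of "\<lambda>z. Re (z * cis (- \<alpha>))" "{.. r * cos \<alpha>}"] by (simp add: vimage_def)
  moreover have "vert ` {..<n} \<subseteq> {z. Re (z * cis (- \<alpha>)) \<le> r * cos \<alpha>}"
  proof clarify
    fix j assume "j < n"
    have "Re (vert j * cis (- \<alpha>)) = r * cos (2 * real j * \<alpha> - \<alpha>)"
      by (simp add: vert_def mult.assoc cis_mult)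
    also have "\<dots> \<le> r * cos \<alpha>" using v[OF \<open>j < n\<close>] r0 by simp
    finally show "Re (vert j * cis (- \<alpha>)) \<le> r * cos \<alpha>" .
  qed
  ultimately have "P \<subseteq> {z. Re (z * cis (- \<alpha>)) \<le> r * cos \<alpha>}"
    unfolding P_eq by (intro hull_minimal)
  with assms show ?thesis by auto
qed

lemma halfplane_P_int: assumes "z \<in> P" shows "Re (z * cis (of_int (2 * m + 1) * \<alpha>)) \<le> r * cos \<alpha>"
proof -
  have "cis (2 * of_int (m + 1) * \<alpha>) * z * cis (- \<alpha>)
      = z * (cis (2 * of_int (m + 1) * \<alpha>) * cis (- \<alpha>))" by (simp only: mult_ac)
  also have "cis (2 * of_int (m + 1) * \<alpha>) * cis (- \<alpha>) = cis (of_int (2 * m + 1) * \<alpha>)"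
    unfolding cis_mult by (rule arg_cong[of _ _ cis]) (simp add: algebra_simps)
  finally show ?thesis using halfplane_P[OF rotate_P_int[OF assms, of "m + 1"]] by (simp only:)
qed

section \<open>Chord offsets of the polygon and their symmetries\<close>

abbreviation T :: "real \<Rightarrow> real \<Rightarrow> real set" where "T \<equiv> offs P"

lemma T_periodic: "T (\<phi> + 2 * \<alpha>) t = T \<phi> t"
proof -
  have "cis (\<phi> + 2 * \<alpha>) * w \<in> P \<longleftrightarrow> cis \<phi> * w \<in> P" for w
    using rotate_P_iff[of 1 "cis \<phi> * w"] by (simp add: mult.assoc[symmetric] cis_mult add.commute)
  then show ?thesis unfolding offs_def by simp
qed

lemma T_even: "T (- \<phi>) t = T \<phi> t"
proof -
  have c: "cis (- \<phi>) * Complex s y \<in> P \<longleftrightarrow> cis \<phi> * Complex s (- y) \<in> P" for s y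
    using cnj_P_iff[of "cis \<phi> * Complex s (- y)"] by (simp add: cis_cnj)
      (simp add: complex_cnj)
  have sub: "T \<phi> t \<subseteq> T (- \<phi>) t" if "\<And>s y. cis (- \<phi>) * Complex s y \<in> P \<longleftrightarrow> cis \<phi> * Complex s (- y) \<in> P" for \<phi>
  proof
    fix s assume "s \<in> T \<phi> t"
    then obtain y where "cis \<phi> * Complex s y \<in> P" "cis \<phi> * Complex s (y + t) \<in> P"
      by (auto simp: offs_def)
    then have "cis (- \<phi>) * Complex s (- y - t) \<in> P \<and> cis (- \<phi>) * Complex s (- y - t + t) \<in> P"
      unfolding that by (simp add: add.commute)
    then show "s \<in> T (- \<phi>) t" unfolding offs_def by blast
  qed
  have "T \<phi> t \<subseteq> T (- \<phi>) t" by (rule sub[OF c])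
  moreover have "T (- \<phi>) t \<subseteq> T (- (- \<phi>)) t"
    by (rule sub) (simp add: c)
  ultimately show ?thesis by simp
qed

text \<open>Turning the frame by pi exchanges the two ends of a chord and changes the sign of its
  offset. The polygon itself stays fixed, so this covers odd n, where there is no central
  symmetry.\<close>

lemma T_opposite: "T (\<phi> + pi) t = uminus ` T \<phi> t"
proof -
  have c: "cis (\<phi> + pi) * Complex s y \<in> P \<longleftrightarrow> cis \<phi> * Complex (- s) (- y) \<in> P" for s y
    by (rule arg_cong[of _ _ "\<lambda>z. z \<in> P"]) (simp add: complex_eq_iff)
  have "s \<in> T (\<phi> + pi) t \<longleftrightarrow> - s \<in> T \<phi> t" for s
  proof
    assume "s \<in> T (\<phi> + pi) t"
    then obtain y where "cis \<phi> * Complex (- s) (- y) \<in> P" "cis \<phi> * Complex (- s) (- (y + t)) \<in> P"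
      by (auto simp: offs_def c)
    then have "cis \<phi> * Complex (- s) (- y - t) \<in> P \<and> cis \<phi> * Complex (- s) (- y - t + t) \<in> P"
      by simp
    then show "- s \<in> T \<phi> t" unfolding offs_def by blast
  next
    assume "- s \<in> T \<phi> t"
    then obtain y where "cis \<phi> * Complex (- s) y \<in> P" "cis \<phi> * Complex (- s) (y + t) \<in> P"
      by (auto simp: offs_def)
    then have "cis (\<phi> + pi) * Complex s (- y - t) \<in> P \<and> cis (\<phi> + pi) * Complex s (- y - t + t) \<in> P"
      unfolding c by (simp add: add.commute)
    then show "s \<in> T (\<phi> + pi) t" unfolding offs_def by blast
  qed
  then show ?thesis by (force simp: image_iff)
qed

text \<open>The value 0 for an empty set of offsets keeps the width formula of
  \<open>emeasure_T\<close> valid there.\<close>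

definition supp :: "real \<Rightarrow> real \<Rightarrow> real" where
  "supp t \<phi> = (if T \<phi> t = {} then 0 else Sup (T \<phi> t))"

lemma supp_periodic: "supp t (\<phi> + 2 * \<alpha>) = supp t \<phi>"
  and supp_even: "supp t (- \<phi>) = supp t \<phi>"
  unfolding supp_def T_periodic T_even by simp_all

lemma emeasure_T:
  assumes "0 \<le> \<phi>" "\<phi> \<le> 2 * pi" "0 \<le> t"
  shows "emeasure lborel (T \<phi> t) = ennreal (supp t \<phi> + supp t (\<phi> + pi))"
    and "0 \<le> supp t \<phi> + supp t (\<phi> + pi)"
proof -
  have "emeasure lborel (T \<phi> t) = ennreal (supp t \<phi> + supp t (\<phi> + pi)) \<and> 0 \<le> supp t \<phi> + supp t (\<phi> + pi)"
  proof (cases "T \<phi> t = {}")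
    case True
    then show ?thesis unfolding supp_def T_opposite by simp
  next
    case False
    note I = compact_convex_real[OF compact_offs[OF compact_P assms] convex_offs[OF convex_P] False]
    have "supp t (\<phi> + pi) = - Inf (T \<phi> t)"
      using False unfolding supp_def T_opposite by (simp add: Inf_real_def image_image)
    moreover have "supp t \<phi> = Sup (T \<phi> t)" using False by (simp add: supp_def)
    ultimately show ?thesis using I by (metis add_uminus_conv_diff diff_ge_0_iff_ge emeasure_lborel_Icc)
  qed
  then show "emeasure lborel (T \<phi> t) = ennreal (supp t \<phi> + supp t (\<phi> + pi))"
    and "0 \<le> supp t \<phi> + supp t (\<phi> + pi)" by auto
qed

text \<open>In the coordinates rotated by \<open>k \<alpha>\<close>, a chord of direction \<open>\<i> cis \<psi>\<close> in the \<open>k\<close>-th strip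
  joins the two edges with normals \<open>\<plusminus> (k + 1) \<alpha>\<close>.\<close>

definition beta :: "nat \<Rightarrow> real" where "beta k = real (k + 1) * \<alpha>"

text \<open>All necessary conditions used below, with one common witness y: the two half-planes
  serve the extremal chord, the circumscribed disc serves the proofs that there is no chord.\<close>

lemma T_strip_bounds:
  assumes "s \<in> T (\<psi> - real k * \<alpha>) t"
  obtains y where "s * cos (beta k - \<psi>) + (y + t) * sin (beta k - \<psi>) \<le> r * cos \<alpha>"
    and "s * cos (beta k + \<psi>) - y * sin (beta k + \<psi>) \<le> r * cos \<alpha>"
    and "norm (Complex s y) \<le> r" and "norm (Complex s (y + t)) \<le> r"
proof -
  from assms obtain y where y: "cis (\<psi> - real k * \<alpha>) * Complex s y \<in> P"
    "cis (\<psi> - real k * \<alpha>) * Complex s (y + t) \<in> P" by (auto simp: offs_def)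
  have rot: "Re (cis a * Complex s u * cis b) = s * cos (a + b) - u * sin (a + b)" for a b u
    by (simp add: cos_add sin_add algebra_simps)
  have "\<psi> - real k * \<alpha> + of_int (2 * (- 1) + 1) * \<alpha> = \<psi> - beta k"
    by (simp add: beta_def algebra_simps)
  with halfplane_P_int[OF y(2), of "- 1"]
  have 1: "s * cos (\<psi> - beta k) - (y + t) * sin (\<psi> - beta k) \<le> r * cos \<alpha>"
    by (simp only: rot)
  have "\<psi> - real k * \<alpha> + of_int (2 * int k + 1) * \<alpha> = beta k + \<psi>"
    by (simp add: beta_def algebra_simps)
  with halfplane_P_int[OF y(1), of "int k"]
  have 2: "s * cos (beta k + \<psi>) - y * sin (beta k + \<psi>) \<le> r * cos \<alpha>"
    by (simp only: rot)
  have "cos (\<psi> - beta k) = cos (beta k - \<psi>)" "sin (\<psi> - beta k) = - sin (beta k - \<psi>)"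
    using cos_minus[of "beta k - \<psi>"] sin_minus[of "beta k - \<psi>"] by simp_all
  with 1 have "s * cos (beta k - \<psi>) + (y + t) * sin (beta k - \<psi>) \<le> r * cos \<alpha>" by simp
  moreover note 2
  moreover have "norm (Complex s y) \<le> r" "norm (Complex s (y + t)) \<le> r"
    using norm_P[OF y(1)] norm_P[OF y(2)] by (simp_all add: norm_mult)
  ultimately show ?thesis by (rule that)
qed

text \<open>In a rotated copy of the polygon an edge is described by the angle b of its normal, and
  Y is the position on it measured from its midpoint. The weight u of the convex combination of the
  two vertices solves Y = r sin \<alpha> (2 u - 1).\<close>

lemma edge_in_rotated_P:
  assumes z: "of_real r * cis (b + \<alpha>) \<in> (*) (cis c) ` P" "of_real r * cis (b - \<alpha>) \<in> (*) (cis c) ` P"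
    and Y: "\<bar>Y\<bar> \<le> r * sin \<alpha>"
  shows "Complex (r * cos \<alpha>) Y * cis b \<in> (*) (cis c) ` P"
proof -
  define u where "u = (1 + Y / (r * sin \<alpha>)) / 2"
  have rs: "r * sin \<alpha> > 0" using r0 sin_alpha_pos by simp
  have "\<bar>Y / (r * sin \<alpha>)\<bar> = \<bar>Y\<bar> / (r * sin \<alpha>)"
    by (simp only: abs_divide abs_of_pos[OF rs])
  then have "\<bar>Y / (r * sin \<alpha>)\<bar> \<le> 1" using Y rs by (simp add: divide_le_eq)
  then have "- 1 \<le> Y / (r * sin \<alpha>)" "Y / (r * sin \<alpha>) \<le> 1" unfolding abs_le_iff by linarith+
  then have "0 \<le> u" "u \<le> 1" by (simp_all add: u_def)
  then have u: "0 \<le> u" "0 \<le> 1 - u" "u + (1 - u) = 1" by simp_all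
  have "2 * ((1 + q) / 2) - 1 = q" for q :: real by (simp add: field_simps)
  then have "2 * u - 1 = Y / (r * sin \<alpha>)" unfolding u_def .
  then have Yu: "Y = r * sin \<alpha> * (2 * u - 1)" using sin_alpha_pos r0 by simp
  have "convex ((*) (cis c) ` P)"
    by (rule convex_linear_image[OF linear_times convex_P])
  from convexD[OF this z u]
  have "u *\<^sub>R (of_real r * cis (b + \<alpha>)) + (1 - u) *\<^sub>R (of_real r * cis (b - \<alpha>)) \<in> (*) (cis c) ` P" .
  also have "u *\<^sub>R (of_real r * cis (b + \<alpha>)) + (1 - u) *\<^sub>R (of_real r * cis (b - \<alpha>))
      = Complex (r * cos \<alpha>) Y * cis b"
    unfolding Yu by (simp add: complex_eq_iff cos_add sin_add cos_diff sin_diff algebra_simps)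
  finally show ?thesis .
qed

lemma in_rotated_P: "w \<in> (*) (cis c) ` P \<longleftrightarrow> cis (- c) * w \<in> P"
proof
  assume "cis (- c) * w \<in> P"
  then show "w \<in> (*) (cis c) ` P"
    by (intro image_eqI[of _ _ "cis (- c) * w"]) (simp_all add: mult.assoc[symmetric] cis_mult)
qed (auto simp: mult.assoc[symmetric] cis_mult)

lemma vertices_in_rotated_P:
  "of_real r * cis (beta k + \<alpha>) \<in> (*) (cis (real k * \<alpha>)) ` P"
  "of_real r * cis (beta k - \<alpha>) \<in> (*) (cis (real k * \<alpha>)) ` P"
  "of_real r * cis (- beta k + \<alpha>) \<in> (*) (cis (real k * \<alpha>)) ` P"
  "of_real r * cis (- beta k - \<alpha>) \<in> (*) (cis (real k * \<alpha>)) ` P"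
  unfolding in_rotated_P
  using vertex_in_P[of 1] vertex_in_P[of 0] vertex_in_P[of "- int k"] vertex_in_P[of "- int k - 1"]
  by (simp_all add: beta_def mult.left_commute cis_mult algebra_simps)

text \<open>The offset of the chord of length t whose ends lie on the two lines carrying the edges,
  that is, the optimum of the linear programme given by the two half-planes of
  \<open>T_strip_bounds\<close>.\<close>

definition splus :: "nat \<Rightarrow> real \<Rightarrow> real \<Rightarrow> real" where
  "splus k t \<psi> = r * cos \<alpha> * cos \<psi> / cos (beta k)
     - t * (sin (beta k - \<psi>) * sin (beta k + \<psi>)) / sin (2 * beta k)"

text \<open>The optimum of the linear programme is attained in the polygon if the ends lie on the
  edges and not only on their lines. This amounts to both t a and t b lying between
  \<open>hh n r k\<close> and \<open>hh n r (k + 1)\<close>; since a <= b, \<open>lower\<close> and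
  \<open>upper\<close> are enough.\<close>

lemma supp_strip:
  assumes \<psi>: "0 \<le> \<psi>" "\<psi> \<le> \<alpha>" and B: "beta k < pi / 2" and t: "0 \<le> t"
    and lower: "hh n r k \<le> t * sin (beta k - \<psi>)"
    and upper: "t * sin (beta k + \<psi>) \<le> hh n r (k + 1)"
  shows "supp t (\<psi> - real k * \<alpha>) = splus k t \<psi>"
proof -
  define B a b \<rho> where "B = beta k" and "a = sin (B - \<psi>)" and "b = sin (B + \<psi>)" and "\<rho> = r * cos \<alpha>"
  have Bge: "B \<ge> \<alpha>" unfolding B_def beta_def using alpha_pos by (simp add: algebra_simps)
  then have B0: "0 < B" "B < pi / 2" using alpha_pos B by (auto simp: B_def)
  have cB: "cos B > 0" and sB: "sin B > 0" using B0 by (auto intro!: cos_gt_zero_pi sin_gt_zero)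
  have s2B: "sin (2 * B) = 2 * sin B * cos B" by (rule sin_double)
  then have s2Bp: "sin (2 * B) > 0" using cB sB by simp
  have a0: "a \<ge> 0" unfolding a_def using \<psi> Bge B0 by (intro sin_ge_zero) auto
  have b0: "b > 0" unfolding b_def using \<psi> Bge B0 alpha_pos alpha_less_pi2 by (intro sin_gt_zero) auto
  have cpsi: "cos \<psi> \<ge> 0" "sin \<psi> \<ge> 0"
    using \<psi> alpha_less_pi2 by (auto intro!: cos_ge_zero sin_ge_zero)
  have apb: "a + b = 2 * sin B * cos \<psi>" unfolding a_def b_def by (simp add: sin_add sin_diff)
  have ab: "a \<le> b" unfolding a_def b_def using cpsi cB by (simp add: sin_add sin_diff)
  have sp: "splus k t \<psi> = \<rho> * cos \<psi> / cos B - t * (a * b) / sin (2 * B)"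
    by (simp add: splus_def a_def b_def B_def \<rho>_def)
  have sp': "splus k t \<psi> * sin (2 * B) = \<rho> * (a + b) - t * (a * b)"
  proof -
    have "\<rho> * cos \<psi> / cos B * sin (2 * B) = \<rho> * (a + b)"
      unfolding s2B apb using cB by simp
    then show ?thesis unfolding sp left_diff_distrib using s2Bp by simp
  qed
  have upper_bound: "s \<le> splus k t \<psi>" if s: "s \<in> T (\<psi> - real k * \<alpha>) t" for s
  proof -
    from s obtain y where y: "s * cos (B - \<psi>) + (y + t) * a \<le> \<rho>" "s * cos (B + \<psi>) - y * b \<le> \<rho>"
      unfolding a_def b_def \<rho>_def B_def by (rule T_strip_bounds)
    \<comment> \<open>The dual certificate: with the weights b and a the unknown y cancels, and s is
      left with the coefficient sin (2 B).\<close>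
    have "b * (s * cos (B - \<psi>) + (y + t) * a) + a * (s * cos (B + \<psi>) - y * b) \<le> b * \<rho> + a * \<rho>"
      using y a0 b0 by (intro add_mono mult_left_mono) auto
    also have "b * (s * cos (B - \<psi>) + (y + t) * a) + a * (s * cos (B + \<psi>) - y * b)
       = s * (b * cos (B - \<psi>) + a * cos (B + \<psi>)) + t * (a * b)"
      by (simp add: algebra_simps)
    also have "b * cos (B - \<psi>) + a * cos (B + \<psi>) = sin (2 * B)"
      using sin_add[of "B + \<psi>" "B - \<psi>"] by (simp add: a_def b_def algebra_simps)
    finally have "s * sin (2 * B) \<le> splus k t \<psi> * sin (2 * B)"
      unfolding sp' by (simp add: algebra_simps)
    with s2Bp show ?thesis by simp
  qed
  \<comment> \<open>Y and Z are the positions of the upper and the lower end on their edges,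
    measured from the midpoints. By \<open>h0\<close> and \<open>h1\<close>, the values
    \<open>hh n r k\<close> and \<open>hh n r (k + 1)\<close> are the ones at which an end reaches a
    vertex.\<close>
  define Y where "Y = t * b / sin (2 * B) - \<rho> * tan B"
  define Z where "Z = \<rho> * tan B - t * a / sin (2 * B)"
  have h1: "\<rho> * tan B * sin (2 * B) + r * sin \<alpha> * sin (2 * B) = hh n r (k + 1)"
  proof -
    have "hh n r (k + 1) = 2 * r * sin B * sin (B + \<alpha>)"
      by (simp add: hh_def B_def beta_def algebra_simps)
    then show ?thesis unfolding s2B \<rho>_def tan_def sin_add using cB by (simp add: field_simps)
  qed
  have h0: "\<rho> * tan B * sin (2 * B) - r * sin \<alpha> * sin (2 * B) = hh n r k"
  proof -
    have "hh n r k = 2 * r * sin B * sin (B - \<alpha>)"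
      by (simp add: hh_def B_def beta_def algebra_simps)
    then show ?thesis unfolding s2B \<rho>_def tan_def sin_diff using cB by (simp add: field_simps)
  qed
  have ta: "hh n r k \<le> t * a" "t * a \<le> hh n r (k + 1)" "hh n r k \<le> t * b" "t * b \<le> hh n r (k + 1)"
    using lower upper mult_left_mono[OF ab t] by (auto simp: a_def b_def B_def)
  have Y2: "Y * sin (2 * B) = t * b - \<rho> * tan B * sin (2 * B)"
    "Z * sin (2 * B) = \<rho> * tan B * sin (2 * B) - t * a"
    unfolding Y_def Z_def using s2Bp by (simp_all add: algebra_simps)
  have "Y * sin (2 * B) \<le> r * sin \<alpha> * sin (2 * B)" "(- Y) * sin (2 * B) \<le> r * sin \<alpha> * sin (2 * B)"
    "Z * sin (2 * B) \<le> r * sin \<alpha> * sin (2 * B)" "(- Z) * sin (2 * B) \<le> r * sin \<alpha> * sin (2 * B)"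
    unfolding Y2 minus_mult_left[symmetric] using ta h0 h1 by linarith+
  then have Yb: "\<bar>Y\<bar> \<le> r * sin \<alpha>" "\<bar>Z\<bar> \<le> r * sin \<alpha>"
    using mult_right_le_imp_le[OF _ s2Bp] unfolding abs_le_iff by blast+
  have w: "Complex \<rho> Y * cis B \<in> (*) (cis (real k * \<alpha>)) ` P"
    "Complex \<rho> Z * cis (- B) \<in> (*) (cis (real k * \<alpha>)) ` P"
    unfolding \<rho>_def B_def
    using vertices_in_rotated_P Yb by (auto intro!: edge_in_rotated_P)
  \<comment> \<open>The height of the lower end in the frame of the chord. Below, \<open>e1\<close>
    and \<open>e2\<close> say that both ends have the offset \<open>splus\<close>, and
    \<open>e3\<close> that their heights differ by t.\<close>
  define y where "y = Z * cos (B + \<psi>) - \<rho> * b"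
  have c1: "cos (B - \<psi>) * cos B + a * sin B = cos \<psi>" "cos (B + \<psi>) * cos B + b * sin B = cos \<psi>"
    using cos_diff[of "B - \<psi>" B] cos_diff[of "B + \<psi>" B] by (simp_all add: a_def b_def)
  have e1: "\<rho> * cos (B - \<psi>) - Y * a = splus k t \<psi>"
  proof -
    have "\<rho> * cos (B - \<psi>) - Y * a = \<rho> * (cos (B - \<psi>) + tan B * a) - t * (a * b) / sin (2 * B)"
      by (simp add: Y_def algebra_simps)
    also have "cos (B - \<psi>) + tan B * a = cos \<psi> / cos B"
      unfolding c1(1)[symmetric] using cB by (simp add: tan_def field_simps)
    finally show ?thesis by (simp add: sp)
  qed
  have e2: "\<rho> * cos (B + \<psi>) + Z * b = splus k t \<psi>"
  proof -
    have "\<rho> * cos (B + \<psi>) + Z * b = \<rho> * (cos (B + \<psi>) + tan B * b) - t * (a * b) / sin (2 * B)"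
      by (simp add: Z_def algebra_simps)
    also have "cos (B + \<psi>) + tan B * b = cos \<psi> / cos B"
      unfolding c1(2)[symmetric] using cB by (simp add: tan_def field_simps)
    finally show ?thesis by (simp add: sp)
  qed
  have e3: "\<rho> * a + Y * cos (B - \<psi>) = y + t"
  proof -
    have "\<rho> * a + Y * cos (B - \<psi>) - y
      = \<rho> * (a + b - tan B * (cos (B - \<psi>) + cos (B + \<psi>))) + t * ((b * cos (B - \<psi>) + a * cos (B + \<psi>)) / sin (2 * B))"
      unfolding y_def Y_def Z_def by (simp add: algebra_simps add_divide_distrib)
    also have "b * cos (B - \<psi>) + a * cos (B + \<psi>) = sin (2 * B)"
      using sin_add[of "B + \<psi>" "B - \<psi>"] by (simp add: a_def b_def algebra_simps)
    also have "a + b - tan B * (cos (B - \<psi>) + cos (B + \<psi>)) = 0"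
      unfolding apb using cB by (simp add: cos_add cos_diff tan_def)
    finally show ?thesis using s2Bp by simp
  qed
  have "splus k t \<psi> \<in> T (\<psi> - real k * \<alpha>) t"
  proof -
    have "cis (- \<psi>) * (Complex \<rho> Y * cis B) = Complex (splus k t \<psi>) (y + t)"
      unfolding e1[symmetric] e3[symmetric]
      by (simp add: complex_eq_iff a_def cos_diff sin_diff algebra_simps)
    moreover have "cis (- \<psi>) * (Complex \<rho> Z * cis (- B)) = Complex (splus k t \<psi>) y"
      unfolding e2[symmetric] y_def
      by (simp add: complex_eq_iff b_def cos_add sin_add algebra_simps)
    moreover have "cis (\<psi> - real k * \<alpha>) * (cis (- \<psi>) * w) = cis (- (real k * \<alpha>)) * w" for w
      by (simp add: mult.assoc[symmetric] cis_mult)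
    ultimately have "cis (\<psi> - real k * \<alpha>) * Complex (splus k t \<psi>) (y + t) \<in> P"
      "cis (\<psi> - real k * \<alpha>) * Complex (splus k t \<psi>) y \<in> P"
      using w unfolding in_rotated_P by metis+
    then show ?thesis unfolding offs_def by blast
  qed
  moreover from this have "Sup (T (\<psi> - real k * \<alpha>) t) = splus k t \<psi>"
    using upper_bound by (rule cSup_eq_maximum)
  ultimately show ?thesis unfolding supp_def by auto
qed

lemma supp_shift: "supp t (\<phi> + 2 * real m * \<alpha>) = supp t \<phi>"
proof (induction m)
  case (Suc m)
  have "\<phi> + 2 * real (Suc m) * \<alpha> = (\<phi> + 2 * real m * \<alpha>) + 2 * \<alpha>" by (simp add: algebra_simps)
  then show ?case using Suc supp_periodic by metis
qed simp

text \<open>The reflection \<psi> -> \<alpha> - \<psi> carries the directions of strip k + 1 to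
  those of strip k up to a symmetry of the polygon. Hence one sector can be read with either of two
  neighbouring pairs of edges.\<close>

lemma supp_strip_below:
  assumes \<psi>: "0 \<le> \<psi>" "\<psi> \<le> \<alpha>" and B: "beta k < pi / 2" and t: "0 \<le> t"
    and lower: "hh n r k \<le> t * sin (real k * \<alpha> + \<psi>)"
    and upper: "t * sin (beta (k + 1) - \<psi>) \<le> hh n r (k + 1)"
  shows "supp t (\<psi> - real (k + 1) * \<alpha>) = splus k t (\<alpha> - \<psi>)"
proof -
  have "supp t ((\<alpha> - \<psi>) - real k * \<alpha>) = splus k t (\<alpha> - \<psi>)"
    by (rule supp_strip[OF _ _ B t]) (use \<psi> lower upper in \<open>simp_all add: beta_def algebra_simps\<close>)
  moreover have "supp t ((\<alpha> - \<psi>) - real k * \<alpha>) = supp t (\<psi> - real (k + 1) * \<alpha>)"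
  proof -
    have "supp t ((\<alpha> - \<psi>) - real k * \<alpha>) = supp t (- ((\<alpha> - \<psi>) - real k * \<alpha>))" by (simp only: supp_even)
    also have "- ((\<alpha> - \<psi>) - real k * \<alpha>) = \<psi> - real (k + 1) * \<alpha> + 2 * real k * \<alpha>"
      by (simp add: algebra_simps)
    finally show ?thesis by (simp only: supp_shift)
  qed
  ultimately show ?thesis by simp
qed

section \<open>Directions without a chord of the given length\<close>

text \<open>The two edges are parallel at distance 2 r cos \<alpha>, and the sum of their
  inequalities bounds the extent t cos \<psi> of the chord across them.\<close>

lemma supp_empty_even:
  assumes "beta k = pi / 2" "t * cos \<psi> > 2 * r * cos \<alpha>"
  shows "supp t (\<psi> - real k * \<alpha>) = 0"
proof -
  have "T (\<psi> - real k * \<alpha>) t = {}"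
  proof (rule ccontr)
    assume "T (\<psi> - real k * \<alpha>) t \<noteq> {}"
    then obtain s where "s \<in> T (\<psi> - real k * \<alpha>) t" by auto
    then obtain y where "s * cos (beta k - \<psi>) + (y + t) * sin (beta k - \<psi>) \<le> r * cos \<alpha>"
      "s * cos (beta k + \<psi>) - y * sin (beta k + \<psi>) \<le> r * cos \<alpha>"
      by (rule T_strip_bounds)
    then show False
      using assms(2) unfolding assms(1) by (simp add: cos_add cos_diff sin_add sin_diff algebra_simps)
  qed
  then show ?thesis by (simp add: supp_def)
qed

text \<open>Here t sin (\<open>beta k\<close> + \<psi>) is the extent of the chord along the normal
  of the lower edge. Between the line of that edge and the far side of the disc there is only r cos
  \<alpha> + r = \<lambda>.\<close>

lemma supp_empty_odd:
  assumes "t * sin (beta k + \<psi>) > lam n r"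
  shows "supp t (\<psi> - real k * \<alpha>) = 0"
proof -
  have "T (\<psi> - real k * \<alpha>) t = {}"
  proof (rule ccontr)
    assume "T (\<psi> - real k * \<alpha>) t \<noteq> {}"
    then obtain s where "s \<in> T (\<psi> - real k * \<alpha>) t" by auto
    then obtain y where y: "s * cos (beta k + \<psi>) - y * sin (beta k + \<psi>) \<le> r * cos \<alpha>"
      "norm (Complex s (y + t)) \<le> r"
      by (rule T_strip_bounds)
    have "\<bar>Re (Complex s (y + t) * cis (beta k + \<psi>))\<bar> \<le> norm (Complex s (y + t) * cis (beta k + \<psi>))"
      by (rule abs_Re_le_cmod)
    then have "- r \<le> s * cos (beta k + \<psi>) - (y + t) * sin (beta k + \<psi>)"
      using y(2) by (simp add: norm_mult)
    with y(1) have "t * sin (beta k + \<psi>) \<le> r + r * cos \<alpha>" by (simp add: algebra_simps)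
    also have "\<dots> = r * (1 + cos \<alpha>)" by (simp add: algebra_simps)
    also have "1 + cos \<alpha> = 2 * (cos (\<alpha> / 2))\<^sup>2"
      using cos_double_cos[of "\<alpha> / 2"] by simp
    finally have "t * sin (beta k + \<psi>) \<le> lam n r" by (simp add: lam_def mult_ac)
    then show False using assms by simp
  qed
  then show ?thesis by (simp add: supp_def)
qed

lemma supp_empty_far:
  assumes "t > 2 * r"
  shows "supp t \<phi> = 0"
proof -
  have "T \<phi> t = {}"
  proof (rule ccontr)
    assume "T \<phi> t \<noteq> {}"
    then obtain s y where y: "cis \<phi> * Complex s y \<in> P" "cis \<phi> * Complex s (y + t) \<in> P"
      by (auto simp: offs_def)
    have "\<bar>y\<bar> \<le> r" "\<bar>y + t\<bar> \<le> r"
      using norm_P[OF y(1)] norm_P[OF y(2)] abs_Im_le_cmod[of "Complex s y"]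
        abs_Im_le_cmod[of "Complex s (y + t)"] by (simp_all add: norm_mult)
    then show False using assms by linarith
  qed
  then show ?thesis by (simp add: supp_def)
qed

end

section \<open>Integration over the directions\<close>

lemma has_integral_reflect_at:
  fixes f :: "real \<Rightarrow> real"
  assumes "(f has_integral I) {a..b}"
  shows "((\<lambda>x. f (c - x)) has_integral I) {c - b..c - a}"
proof -
  have "(\<lambda>x. - x + c) ` {a..b} = {c - b..c - a}"
    by (auto simp: image_iff intro!: bexI[of _ "c - _"])
  then show ?thesis
    using has_integral_affinity[OF assms[folded cbox_interval], of "- 1" c]
    by (simp add: uminus_add_conv_diff)
qed

section \<open>Calculus of \<open>sigma1\<close> and \<open>tau_m1\<close>\<close>

lemma arcsin_quotient_deriv:
  assumes "0 \<le> a" "a < x"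
  shows "((\<lambda>x. arcsin (a / x)) has_real_derivative - a / (x * sqrt (x\<^sup>2 - a\<^sup>2))) (at x)"
    and "((\<lambda>x. sqrt (x\<^sup>2 - a\<^sup>2)) has_real_derivative x / sqrt (x\<^sup>2 - a\<^sup>2)) (at x)"
    and "sqrt (x\<^sup>2 - a\<^sup>2) > 0"
proof -
  have x: "x > 0" using assms by simp
  define w where "w = sqrt (x\<^sup>2 - a\<^sup>2)"
  have "a\<^sup>2 < x\<^sup>2" using assms by (intro power_strict_mono) auto
  then have p: "x\<^sup>2 - a\<^sup>2 > 0" and w: "w > 0" "w\<^sup>2 = x\<^sup>2 - a\<^sup>2" by (auto simp: w_def)
  from w(1) show "sqrt (x\<^sup>2 - a\<^sup>2) > 0" unfolding w_def .
  have q: "- 1 < a / x" "a / x < 1" using assms x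
    by (auto simp: less_divide_eq intro: order_less_le_trans[of "-1" 0])
  have "1 - (a / x)\<^sup>2 = (x\<^sup>2 - a\<^sup>2) / x\<^sup>2" using x by (simp add: power_divide diff_divide_distrib)
  then have sq: "sqrt (1 - (a / x)\<^sup>2) = w / x" using x by (simp add: w_def real_sqrt_divide)
  have "((\<lambda>x. a / x) has_real_derivative - a / x\<^sup>2) (at x)"
    using x by (auto intro!: derivative_eq_intros simp: power2_eq_square)
  from DERIV_chain2[OF DERIV_arcsin[OF q] this]
  have "((\<lambda>x. arcsin (a / x)) has_real_derivative inverse (w / x) * (- a / x\<^sup>2)) (at x)"
    unfolding sq .
  also have "inverse (w / x) * (- a / x\<^sup>2) = - a / (x * w)"
    using x w(1) by (simp add: power2_eq_square)
  finally show "((\<lambda>x. arcsin (a / x)) has_real_derivative - a / (x * sqrt (x\<^sup>2 - a\<^sup>2))) (at x)"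
    unfolding w_def .
  have "((\<lambda>x. x\<^sup>2 - a\<^sup>2) has_real_derivative 2 * x) (at x)"
    by (auto intro!: derivative_eq_intros)
  from DERIV_chain2[OF DERIV_real_sqrt[OF p] this]
  have "((\<lambda>x. sqrt (x\<^sup>2 - a\<^sup>2)) has_real_derivative inverse w / 2 * (2 * x)) (at x)"
    unfolding w_def .
  also have "inverse w / 2 * (2 * x) = x / w" by (simp add: field_simps)
  finally show "((\<lambda>x. sqrt (x\<^sup>2 - a\<^sup>2)) has_real_derivative x / sqrt (x\<^sup>2 - a\<^sup>2)) (at x)"
    unfolding w_def .
qed

text \<open>With \<eta> = arcsin (a / x), the derivatives of \<open>sigma1\<close> and
  \<open>tau_m1\<close> are x \<eta> and cos \<eta>. These are the only non-rational ingredients of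
  the integrals over directions.\<close>

lemma sigma1_deriv:
  assumes "0 \<le> a" "a < x"
  shows "(sigma1 a has_real_derivative x * arcsin (a / x)) (at x)"
proof -
  have x: "x > 0" using assms by simp
  define w where "w = sqrt (x\<^sup>2 - a\<^sup>2)"
  note d = arcsin_quotient_deriv[OF assms, folded w_def]
  have sq: "((\<lambda>x. x\<^sup>2) has_real_derivative 2 * x) (at x)"
    by (auto intro!: derivative_eq_intros)
  have "(sigma1 a has_real_derivative
      1 / 2 * (2 * x * arcsin (a / x) + - a / (x * w) * x\<^sup>2 + a * (x / w))) (at x)"
    unfolding sigma1_def[abs_def]
    by (rule DERIV_cmult[OF DERIV_add[OF DERIV_mult[OF sq d(1)] DERIV_cmult[OF d(2)]]])
  also have "1 / 2 * (2 * x * arcsin (a / x) + - a / (x * w) * x\<^sup>2 + a * (x / w)) = x * arcsin (a / x)"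
  proof -
    have "- a / (x * w) * x\<^sup>2 + a * (x / w) = 0" using x d(3) by (simp add: power2_eq_square)
    then show ?thesis by (simp add: add.assoc)
  qed
  finally show ?thesis .
qed

lemma tau_m1_deriv:
  assumes "0 \<le> a" "a < x"
  shows "(tau_m1 a has_real_derivative sqrt (x\<^sup>2 - a\<^sup>2) / x) (at x)"
proof -
  have x: "x > 0" using assms by simp
  define w where "w = sqrt (x\<^sup>2 - a\<^sup>2)"
  note d = arcsin_quotient_deriv[OF assms, folded w_def]
  have w2: "w\<^sup>2 = x\<^sup>2 - a\<^sup>2"
    using assms by (simp add: w_def power_mono)
  have "(tau_m1 a has_real_derivative x / w + a * (- a / (x * w))) (at x)"
    unfolding tau_m1_def[abs_def] by (rule DERIV_add[OF d(2) DERIV_cmult[OF d(1)]])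
  also have "x / w + a * (- a / (x * w)) = (x\<^sup>2 - a\<^sup>2) / (x * w)"
    using x d(3) by (simp add: field_simps power2_eq_square)
  also have "\<dots> = w / x" unfolding w2[symmetric] using d(3) by (simp add: power2_eq_square)
  finally show ?thesis unfolding w_def .
qed

text \<open>The derivative lemmas stop short of x = a, which occurs as a left end point of
  integration. Continuity up to the end point is what the fundamental theorem then asks for.\<close>

lemma continuous_on_sigma1: assumes "0 \<le> a" "a \<le> l" "0 < l" shows "continuous_on {l..u} (sigma1 a)"
  and continuous_on_tau_m1: "continuous_on {l..u} (tau_m1 a)"
proof -
  have q: "\<forall>x\<in>{l..u}. - 1 \<le> a / x \<and> a / x \<le> 1"
  proof
    fix x assume "x \<in> {l..u}"
    then have "a \<le> x" "x > 0" using assms by auto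
    moreover from this have "0 \<le> a / x" using assms by simp
    ultimately show "- 1 \<le> a / x \<and> a / x \<le> 1" by (simp add: divide_le_eq)
  qed
  show "continuous_on {l..u} (sigma1 a)" "continuous_on {l..u} (tau_m1 a)"
    unfolding sigma1_def[abs_def] tau_m1_def[abs_def]
    by (intro continuous_intros q; use assms in auto)+
qed

context regular_ngon
begin

section \<open>Integrals of functions with dihedral symmetry\<close>

lemma dihedral_shift:
  fixes f :: "real \<Rightarrow> real"
  assumes "\<And>x. f (x + 2 * \<alpha>) = f x"
  shows "f (x + 2 * real m * \<alpha>) = f x"
proof (induction m)
  case (Suc m)
  have "x + 2 * real (Suc m) * \<alpha> = (x + 2 * real m * \<alpha>) + 2 * \<alpha>" by (simp add: algebra_simps)
  then show ?case using Suc assms by metis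
qed simp

text \<open>Neighbouring sectors are exchanged by the reflection in their common end point (k + 1)
  \<alpha>, which leaves f invariant. The equivalence is used in both directions: to bring a sector
  back to [0, \<alpha>] and to spread the integral over a full turn.\<close>

lemma dihedral_has_integral:
  fixes f :: "real \<Rightarrow> real"
  assumes per: "\<And>x. f (x + 2 * \<alpha>) = f x" and even: "\<And>x. f (- x) = f x"
  shows "(f has_integral J) {real k * \<alpha>..real (k + 1) * \<alpha>} \<longleftrightarrow> (f has_integral J) {0..\<alpha>}"
proof (induction k)
  case (Suc k)
  have sym: "f (2 * real m * \<alpha> - x) = f x" for m x
    using dihedral_shift[of f "- x" m, OF per] even[of x] by (simp add: add.commute)
  have "(f has_integral J) {real k * \<alpha>..real (k + 1) * \<alpha>}
    \<longleftrightarrow> (f has_integral J) {real (k + 1) * \<alpha>..real (k + 1 + 1) * \<alpha>}" for k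
    using has_integral_reflect_at[of f J "real k * \<alpha>" "real (k + 1) * \<alpha>" "2 * real (k + 1) * \<alpha>"]
      has_integral_reflect_at[of f J "real (k + 1) * \<alpha>" "real (k + 1 + 1) * \<alpha>" "2 * real (k + 1) * \<alpha>"]
    by (auto simp only: sym) (simp_all add: algebra_simps)
  with Suc show ?case by simp
qed simp

lemma dihedral_has_integral_period:
  fixes f :: "real \<Rightarrow> real"
  assumes per: "\<And>x. f (x + 2 * \<alpha>) = f x" and even: "\<And>x. f (- x) = f x"
    and I: "(f has_integral J) {0..\<alpha>}"
  shows "(f has_integral (real m * J)) {real k * \<alpha>..real (k + m) * \<alpha>}"
proof (induction m)
  case (Suc m)
  have "(f has_integral (real m * J + J)) {real k * \<alpha>..real (k + m + 1) * \<alpha>}"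
    by (rule has_integral_combine[OF _ _ Suc dihedral_has_integral[OF per even, THEN iffD2]])
       (use I alpha_pos in \<open>auto intro!: mult_right_mono\<close>)
  then show ?case by (simp add: algebra_simps)
next
  case 0
  show ?case using has_integral_refl[of f "real k * \<alpha>"] by simp
qed

text \<open>The strip lemmas compute with directions \<psi> - k \<alpha>, hence in a different
  sector for each k; by symmetry all sectors have the same integral.\<close>

lemma supp_has_integral_sector:
  assumes "((\<lambda>\<psi>. supp t (\<psi> - real k * \<alpha>)) has_integral J) {0..\<alpha>}"
  shows "(supp t has_integral J) {0..\<alpha>}"
proof -
  have "((\<lambda>x. supp t (real k * \<alpha> - x - real k * \<alpha>)) has_integral J) {real k * \<alpha> - \<alpha>..real k * \<alpha> - 0}"
    by (rule has_integral_reflect_at[OF assms])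
  then have I: "(supp t has_integral J) {real k * \<alpha> - \<alpha>..real k * \<alpha>}"
    by (simp add: supp_even)
  show ?thesis
  proof (cases k)
    case 0
    with I has_integral_reflect_at[of "supp t" J "- \<alpha>" 0 0] show ?thesis by (simp add: supp_even)
  next
    case (Suc m)
    with I show ?thesis
      by (intro dihedral_has_integral[of "supp t" J m, OF supp_periodic supp_even, THEN iffD1])
         (simp add: algebra_simps)
  qed
qed

text \<open>The antiderivative of \<open>splus k t\<close> that vanishes at \<open>0\<close>.\<close>

definition Sfun :: "nat \<Rightarrow> real \<Rightarrow> real \<Rightarrow> real" where
  "Sfun k t \<psi> = r * cos \<alpha> * sin \<psi> / cos (beta k)
     - t * (sin (2 * \<psi>) / (4 * sin (2 * beta k)) - \<psi> * cot (2 * beta k) / 2)"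

lemma Sfun_0: "Sfun k t 0 = 0" and Sfun_minus: "Sfun k t (- x) = - Sfun k t x"
  by (simp_all add: Sfun_def algebra_simps)

lemma splus_has_integral:
  assumes "a \<le> b" "sin (2 * beta k) \<noteq> 0"
  shows "(splus k t has_integral (Sfun k t b - Sfun k t a)) {a..b}"
proof (rule fundamental_theorem_of_calculus[OF assms(1)])
  fix x assume "x \<in> {a..b}"
  have c: "cos (beta k) \<noteq> 0" using assms(2) by (auto simp: sin_double)
  have e: "2 * (sin (beta k - x) * sin (beta k + x)) = cos (2 * x) - cos (2 * beta k)"
    using cos_diff[of "beta k - x" "beta k + x"] cos_add[of "beta k - x" "beta k + x"]
      cos_minus[of "2 * x"] by simp
  have "(Sfun k t has_real_derivative
      r * cos \<alpha> * cos x / cos (beta k) - t * (2 * cos (2 * x) / (4 * sin (2 * beta k)) - cot (2 * beta k) / 2)) (at x)"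
    unfolding Sfun_def[abs_def]
    by (auto intro!: derivative_eq_intros simp: c assms(2))
  also have "2 * cos (2 * x) / (4 * sin (2 * beta k)) - cot (2 * beta k) / 2
    = (cos (2 * x) - cos (2 * beta k)) / 2 / sin (2 * beta k)"
    by (simp add: cot_def diff_divide_distrib)
  also have "(cos (2 * x) - cos (2 * beta k)) / 2 = sin (beta k - x) * sin (beta k + x)"
    using e by simp
  finally have "(Sfun k t has_real_derivative splus k t x) (at x)"
    by (simp add: splus_def)
  then show "(Sfun k t has_vector_derivative splus k t x) (at x within {a..b})"
    by (simp add: has_real_derivative_iff_has_vector_derivative has_vector_derivative_at_within)
qed

text \<open>End points of integration have the form \<open>beta k\<close> - \<eta> with t sin \<eta>
  a constant h. After multiplication by t, the terms in sin^2, sin cos and \<eta> become h sin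
  \<eta>, h cos \<eta> and t \<eta>: the derivatives of the logarithm, of \<open>tau_m1\<close> and
  of \<open>sigma1\<close>, up to constants.\<close>

lemma Sfun_shift:
  assumes "sin (2 * beta k) \<noteq> 0"
  shows "2 * Sfun k t (beta k - \<eta>) = 2 * r * cos \<alpha> * (tan (beta k) * cos \<eta> - sin \<eta>)
    - t * (1 / 2 - (sin \<eta>)\<^sup>2 - cot (2 * beta k) * (sin \<eta> * cos \<eta>) - (beta k - \<eta>) * cot (2 * beta k))"
proof -
  have c: "cos (beta k) \<noteq> 0" using assms by (auto simp: sin_double)
  have "sin (2 * (beta k - \<eta>)) = sin (2 * beta k) * cos (2 * \<eta>) - cos (2 * beta k) * sin (2 * \<eta>)"
    using sin_diff[of "2 * beta k" "2 * \<eta>"] by (simp add: algebra_simps)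
  then have "sin (2 * (beta k - \<eta>)) / sin (2 * beta k) = cos (2 * \<eta>) - cot (2 * beta k) * sin (2 * \<eta>)"
    using assms by (simp add: cot_def field_simps)
  also have "\<dots> = 1 - 2 * (sin \<eta>)\<^sup>2 - 2 * cot (2 * beta k) * (sin \<eta> * cos \<eta>)"
    unfolding cos_double_sin sin_double[of \<eta>] by (simp add: algebra_simps)
  finally have 1: "sin (2 * (beta k - \<eta>)) / sin (2 * beta k) = 1 - 2 * (sin \<eta>)\<^sup>2 - 2 * cot (2 * beta k) * (sin \<eta> * cos \<eta>)" .
  have 2: "sin (beta k - \<eta>) / cos (beta k) = tan (beta k) * cos \<eta> - sin \<eta>"
    using c by (simp add: sin_diff tan_def field_simps)
  have "2 * Sfun k t (beta k - \<eta>) = 2 * r * cos \<alpha> * (sin (beta k - \<eta>) / cos (beta k))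
    - t * (sin (2 * (beta k - \<eta>)) / sin (2 * beta k) / 2 - (beta k - \<eta>) * cot (2 * beta k))"
  proof -
    have h: "2 * (t * (S / (4 * D) - y * C / 2)) = t * (S / D / 2 - y * C)" for t S D y C :: real
      by (cases "D = 0") (simp_all add: field_simps)
    show ?thesis unfolding Sfun_def right_diff_distrib[of 2] h by simp
  qed
  moreover have "(1 - 2 * x - 2 * C * y) / 2 = 1 / 2 - x - C * y" for x y C :: real
    by (simp add: field_simps)
  ultimately show ?thesis unfolding 1 2 by (simp only:)
qed

section \<open>Angles and lengths attached to the strips\<close>

lemma beta_Suc: "real (Suc m) * \<alpha> = beta m" and hh_beta: "hh n r k = 2 * r * sin (real k * \<alpha>) * sin (beta k)"
  and hh_Suc: "hh n r (Suc k) = 2 * r * sin (beta k) * sin (beta (Suc k))"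
  and ell_Suc: "ell n r (Suc k) = 2 * r * sin (beta k)"
  by (simp_all add: beta_def hh_def ell_def)

lemma kalpha: "real k * \<alpha> = beta k - \<alpha>" and beta_add: "beta (Suc k) = beta k + \<alpha>"
  by (simp_all add: beta_def algebra_simps)

lemma beta_ge: "\<alpha> \<le> beta k"
  using alpha_pos by (simp add: beta_def algebra_simps)

lemma beta_pos: "beta k > 0"
  using beta_ge alpha_pos by (rule order_less_le_trans[rotated])

lemma beta_le_pi2_iff: "beta k \<le> pi / 2 \<longleftrightarrow> 2 * (k + 1) \<le> n" "beta k < pi / 2 \<longleftrightarrow> 2 * (k + 1) < n"
  "beta k = pi / 2 \<longleftrightarrow> 2 * (k + 1) = n"
proof -
  have e: "pi / 2 = real n / 2 * \<alpha>" using n_alpha by simp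
  have "beta k \<le> pi / 2 \<longleftrightarrow> real (k + 1) \<le> real n / 2"
    unfolding e beta_def using alpha_pos by (simp add: mult_le_cancel_right)
  also have "\<dots> \<longleftrightarrow> real (2 * (k + 1)) \<le> real n" by auto
  finally show 1: "beta k \<le> pi / 2 \<longleftrightarrow> 2 * (k + 1) \<le> n" by (simp only: of_nat_le_iff)
  have "beta k < pi / 2 \<longleftrightarrow> real (k + 1) < real n / 2"
    unfolding e beta_def using alpha_pos by (simp add: mult_less_cancel_right)
  also have "\<dots> \<longleftrightarrow> real (2 * (k + 1)) < real n" by auto
  finally show 2: "beta k < pi / 2 \<longleftrightarrow> 2 * (k + 1) < n" by (simp only: of_nat_less_iff)
  have "beta k = pi / 2 \<longleftrightarrow> beta k \<le> pi / 2 \<and> \<not> beta k < pi / 2" by linarith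
  with 1 2 show "beta k = pi / 2 \<longleftrightarrow> 2 * (k + 1) = n" by (simp only:) linarith
qed

lemma kmax_beta:
  assumes "k \<le> kmax n" shows "beta k \<le> pi / 2"
  using assms n3 unfolding beta_le_pi2_iff kmax_def by presburger

lemma sin_2beta: "beta k < pi / 2 \<Longrightarrow> sin (2 * beta k) > 0"
  using beta_pos[of k] by (intro sin_gt_zero) auto

text \<open>The hypothesis encodes that n is odd and k = \<open>kmax n\<close>. Then 2
  \<open>beta k\<close> = pi - \<alpha>, so that everything at the top reduces to the half angle
  \<alpha> / 2.\<close>

lemma odd_top:
  assumes "n = 2 * k + 3"
  shows "beta k = pi / 2 - \<alpha> / 2" "hh n r (Suc k) = lam n r" "lam n r = r + r * cos \<alpha>"
    "sin (beta k) = cos (\<alpha> / 2)" "cos (beta k) = sin (\<alpha> / 2)"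
proof -
  have "real n = 2 * real k + 3" using assms by simp
  then have "2 * beta k = real n * \<alpha> - \<alpha>" unfolding beta_def by (simp add: algebra_simps)
  then show b: "beta k = pi / 2 - \<alpha> / 2" unfolding n_alpha by simp
  then have b': "beta (Suc k) = pi / 2 + \<alpha> / 2" by (simp add: beta_add)
  have s: "sin (pi / 2 - \<alpha> / 2) = cos (\<alpha> / 2)" "sin (pi / 2 + \<alpha> / 2) = cos (\<alpha> / 2)"
    "cos (pi / 2 - \<alpha> / 2) = sin (\<alpha> / 2)"
    by (simp_all add: sin_add sin_diff cos_diff)
  show "hh n r (Suc k) = lam n r" unfolding hh_Suc b b' s by (simp add: lam_def power2_eq_square)
  show "sin (beta k) = cos (\<alpha> / 2)" "cos (beta k) = sin (\<alpha> / 2)" unfolding b s by simp_all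
  have "1 + cos \<alpha> = 2 * (cos (\<alpha> / 2))\<^sup>2" using cos_double_cos[of "\<alpha> / 2"] by simp
  then have "r * (1 + cos \<alpha>) = lam n r" by (simp add: lam_def mult_ac)
  then show "lam n r = r + r * cos \<alpha>" by (simp add: algebra_simps)
qed

lemma ell_nonneg:
  assumes "k \<le> kmax n" shows "ell n r k \<ge> 0" "hh n r k \<ge> 0" "hh n r k = ell n r k * sin (beta k)"
    "k > 0 \<Longrightarrow> ell n r k > 0"
proof -
  have b: "beta k \<le> pi / 2" by (rule kmax_beta[OF assms])
  have k: "0 \<le> real k * \<alpha>" using alpha_pos by simp
  have "sin (real k * \<alpha>) \<ge> 0" using b k kalpha[of k] alpha_pos by (intro sin_ge_zero) auto
  moreover have "sin (beta k) > 0" using b beta_pos[of k] by (intro sin_gt_zero) auto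
  ultimately show "ell n r k \<ge> 0" "hh n r k \<ge> 0" using r0 by (simp_all add: ell_def hh_beta)
  show "hh n r k = ell n r k * sin (beta k)" by (simp add: ell_def hh_beta)
  show "ell n r k > 0" if "k > 0"
    using ell_strict_mono[OF n3 r0, of 0 k] that assms by (simp add: ell_def)
qed

text \<open>While \<open>beta (Suc k)\<close> <= pi / 2, the sine increases up to \<psi> = \<alpha>,
  and \<open>ell\<close> times its value there is \<open>hh\<close>. Otherwise n is odd and k is the
  top index; then the sine reaches 1 inside the sector, which is why t <= \<lambda> enters.\<close>

lemma upper_ok:
  assumes k: "k \<le> kmax n" "beta k < pi / 2" and t: "0 \<le> t" "t \<le> ell n r (Suc k)"
    and odd: "odd n \<Longrightarrow> k = kmax n \<Longrightarrow> t \<le> lam n r" and \<psi>: "0 \<le> \<psi>" "\<psi> \<le> \<alpha>"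
  shows "t * sin (beta k + \<psi>) \<le> hh n r (k + 1)"
proof (cases "beta (Suc k) \<le> pi / 2")
  case True
  have "sin (beta k + \<psi>) \<le> sin (beta (Suc k))"
    using True \<psi> beta_pos[of k] by (intro sin_monotone_2pi_le) (auto simp: beta_add)
  moreover have "sin (beta (Suc k)) \<ge> 0" using True beta_pos[of "Suc k"] by (intro sin_ge_zero) auto
  ultimately have "t * sin (beta k + \<psi>) \<le> ell n r (Suc k) * sin (beta (Suc k))"
    using t by (meson mult_left_mono mult_right_mono order_trans)
  then show ?thesis by (simp add: hh_Suc ell_Suc)
next
  case False
  then have n: "n = 2 * k + 3" using k unfolding beta_le_pi2_iff by simp
  then have "odd n" "k = kmax n" by (auto simp: kmax_def)
  then have "t \<le> lam n r" by (rule odd)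
  moreover have "t * sin (beta k + \<psi>) \<le> t * 1" using t by (intro mult_left_mono) auto
  ultimately show ?thesis using odd_top(2)[OF n] by simp
qed

text \<open>The direction in which the chord through the vertex between the strips \<open>k - 1\<close> and \<open>k\<close> has length \<open>t\<close>.\<close>

definition psi :: "nat \<Rightarrow> real \<Rightarrow> real" where "psi k t = beta k - arcsin (hh n r k / t)"

text \<open>The two bounds on t say that h_k / t lies between sin (k \<alpha>) and sin
  (\<open>beta k\<close>), which places the switch in [0, \<alpha>]. The rest is monotonicity of the
  sine on the two sides of the switch.\<close>

lemma psi_props:
  assumes k: "k \<le> kmax n" and t: "ell n r k \<le> t" "t \<le> ell n r (Suc k)" "0 < t"
  shows "0 \<le> psi k t" "psi k t \<le> \<alpha>"
    and "\<And>x. 0 \<le> x \<Longrightarrow> x \<le> psi k t \<Longrightarrow> hh n r k \<le> t * sin (beta k - x)"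
    and "\<And>x. psi k t \<le> x \<Longrightarrow> x \<le> \<alpha> \<Longrightarrow> t * sin (beta k - x) \<le> hh n r k"
    and "\<And>x. 0 \<le> x \<Longrightarrow> x < psi k t \<Longrightarrow> hh n r k < t * sin (beta k - x)"
    and "0 \<le> hh n r k / t" "hh n r k / t \<le> 1"
proof -
  define q where "q = hh n r k / t"
  note b = kmax_beta[OF k] beta_pos[of k]
  have sb: "sin (beta k) > 0" using b by (intro sin_gt_zero) auto
  have ka: "0 \<le> real k * \<alpha>" "real k * \<alpha> \<le> pi / 2" using b alpha_pos beta_ge[of k] by (auto simp: kalpha)
  have q0: "q \<ge> 0" unfolding q_def using ell_nonneg(2)[OF k] t by simp
  have q1: "q \<le> sin (beta k)"
    unfolding q_def using t sb by (simp add: divide_le_eq ell_nonneg(3)[OF k] mult.commute)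
  have "sin (real k * \<alpha>) * t \<le> sin (real k * \<alpha>) * ell n r (Suc k)"
    using t ka by (intro mult_left_mono sin_ge_zero) auto
  also have "\<dots> = hh n r k" by (simp add: ell_Suc hh_beta)
  finally have q2: "sin (real k * \<alpha>) \<le> q" unfolding q_def using t by (simp add: le_divide_eq)
  have q3: "q \<le> 1" using q1 sin_le_one order_trans by blast
  have aq: "arcsin q \<le> beta k" "real k * \<alpha> \<le> arcsin q"
  proof -
    have "arcsin q \<le> arcsin (sin (beta k))" using q0 q1 by (intro arcsin_le_arcsin) auto
    then show "arcsin q \<le> beta k" using b by (simp add: arcsin_sin)
    have "arcsin (sin (real k * \<alpha>)) \<le> arcsin q" using q2 q3 by (intro arcsin_le_arcsin) auto
    then show "real k * \<alpha> \<le> arcsin q" using ka by (simp add: arcsin_sin)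
  qed
  have sq: "sin (arcsin q) = q" using q0 q3 by simp
  have aq0: "0 \<le> arcsin q" "arcsin q \<le> pi / 2" using aq ka b by auto
  have hq: "hh n r k = t * q" unfolding q_def using t by simp
  show "0 \<le> psi k t" "psi k t \<le> \<alpha>" unfolding psi_def q_def[symmetric] using aq by (auto simp: kalpha)
  show "0 \<le> hh n r k / t" "hh n r k / t \<le> 1" using q0 q3 by (simp_all add: q_def)
  {
    fix x assume x: "0 \<le> x" "x \<le> psi k t"
    have "sin (arcsin q) \<le> sin (beta k - x)"
      using x b aq0 unfolding psi_def q_def[symmetric] by (intro sin_monotone_2pi_le) auto
    then show "hh n r k \<le> t * sin (beta k - x)" unfolding hq sq using t by simp
  next
    fix x assume x: "psi k t \<le> x" "x \<le> \<alpha>"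
    have "sin (beta k - x) \<le> sin (arcsin q)"
      using x b aq0 ka unfolding psi_def q_def[symmetric]
      by (intro sin_monotone_2pi_le) (auto simp: kalpha)
    then show "t * sin (beta k - x) \<le> hh n r k" unfolding hq sq using t by simp
  next
    fix x assume x: "0 \<le> x" "x < psi k t"
    have "sin (arcsin q) < sin (beta k - x)"
      using x b aq0 unfolding psi_def q_def[symmetric] by (intro sin_monotone_2pi) auto
    then show "hh n r k < t * sin (beta k - x)" unfolding hq sq using t by simp
  }
qed

section \<open>The integral over one sector, piece by piece\<close>

text \<open>Beyond the switch the pair of edges of strip m = k - 1 is extremal, read backwards by
  \<open>supp_strip_below\<close>; this explains the argument
  \<open>psi (Suc m) t - \<alpha>\<close>. For k = 0 the switch is at \<alpha> and this piece
  shrinks to a point.\<close>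

lemma lower_part:
  assumes k: "Suc m \<le> kmax n" and t: "ell n r (Suc m) \<le> t" "t \<le> ell n r (Suc (Suc m))"
  shows "((\<lambda>\<psi>. supp t (\<psi> - real (Suc m) * \<alpha>)) has_integral - Sfun m t (psi (Suc m) t - \<alpha>))
    {psi (Suc m) t..\<alpha>}"
proof -
  have t0: "t > 0" using ell_nonneg(4)[OF k] t by simp
  note p = psi_props[OF k t t0]
  have b: "beta m < pi / 2" using kmax_beta[OF k] alpha_pos by (simp add: beta_add)
  have eq: "supp t (x - real (Suc m) * \<alpha>) = splus m t (\<alpha> - x)" if x: "x \<in> {psi (Suc m) t..\<alpha>}" for x
  proof -
    have x': "0 \<le> x" "x \<le> \<alpha>" using x p(1) by auto
    have m0: "0 \<le> real m * \<alpha>" using alpha_pos by simp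
    have mb: "real m * \<alpha> + x \<le> pi / 2" using b x' by (simp add: kalpha)
    have m1: "- (pi / 2) \<le> real m * \<alpha>" "real m * \<alpha> \<le> pi" using m0 mb x' by linarith+
    have "hh n r m = ell n r (Suc m) * sin (real m * \<alpha>)" by (simp add: hh_beta ell_Suc)
    also have "\<dots> \<le> t * sin (real m * \<alpha> + x)"
      using t x' m0 m1 mb t0
      by (intro mult_mono sin_monotone_2pi_le sin_ge_zero) (assumption | simp)+
    finally have "hh n r m \<le> t * sin (real m * \<alpha> + x)" .
    moreover have "t * sin (beta (m + 1) - x) \<le> hh n r (m + 1)" using p(4)[of x] x by simp
    ultimately show ?thesis
      using supp_strip_below[OF x' b, of t] t0 by simp
  qed
  have "(splus m t has_integral (Sfun m t (\<alpha> - psi (Suc m) t) - Sfun m t 0)) {0..\<alpha> - psi (Suc m) t}"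
    using p(2) sin_2beta[OF b] by (intro splus_has_integral) auto
  from has_integral_reflect_at[OF this, of \<alpha>]
  have "((\<lambda>x. splus m t (\<alpha> - x)) has_integral Sfun m t (\<alpha> - psi (Suc m) t)) {psi (Suc m) t..\<alpha>}"
    by (simp add: Sfun_0)
  moreover have "Sfun m t (\<alpha> - psi (Suc m) t) = - Sfun m t (psi (Suc m) t - \<alpha>)"
    using Sfun_minus[of m t "psi (Suc m) t - \<alpha>"] by simp
  ultimately show ?thesis
    using has_integral_cong[of "{psi (Suc m) t..\<alpha>}" "\<lambda>\<psi>. supp t (\<psi> - real (Suc m) * \<alpha>)" "\<lambda>x. splus m t (\<alpha> - x)"] eq
    by simp
qed

lemma upper_part:
  assumes k: "k \<le> kmax n" "beta k < pi / 2" and t: "ell n r k \<le> t" "t \<le> ell n r (Suc k)" "0 < t"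
    and odd: "odd n \<Longrightarrow> k = kmax n \<Longrightarrow> t \<le> lam n r"
  shows "((\<lambda>\<psi>. supp t (\<psi> - real k * \<alpha>)) has_integral Sfun k t (psi k t)) {0..psi k t}"
proof -
  note p = psi_props[OF k(1) t]
  have "(splus k t has_integral (Sfun k t (psi k t) - Sfun k t 0)) {0..psi k t}"
    using p(1) sin_2beta[OF k(2)] by (intro splus_has_integral) auto
  moreover have "supp t (x - real k * \<alpha>) = splus k t x" if x: "x \<in> {0..psi k t}" for x
  proof (rule supp_strip)
    show "t * sin (beta k + x) \<le> hh n r (k + 1)"
      using x p(2) t by (intro upper_ok[OF k _ _ odd]) auto
  qed (use x p k t in auto)
  ultimately show ?thesis
    using has_integral_cong[of "{0..psi k t}" "\<lambda>\<psi>. supp t (\<psi> - real k * \<alpha>)" "splus k t"]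
    by (simp add: Sfun_0)
qed

text \<open>For the parallel pair h_k equals the distance 2 r cos \<alpha> of the edges, so before
  the switch the chord would have to extend further than the polygon. The switch itself is a single
  direction and does not count.\<close>

lemma upper_part_even:
  assumes k: "k \<le> kmax n" "beta k = pi / 2" and t: "ell n r k \<le> t" "t \<le> ell n r (Suc k)" "0 < t"
  shows "((\<lambda>\<psi>. supp t (\<psi> - real k * \<alpha>)) has_integral 0) {0..psi k t}"
proof -
  note p = psi_props[OF k(1) t]
  have hk: "hh n r k = 2 * r * cos \<alpha>"
  proof -
    have "real k * \<alpha> = pi / 2 - \<alpha>" using k(2) by (simp add: kalpha)
    then show ?thesis by (simp add: hh_beta k(2) sin_diff)
  qed
  have z: "supp t (x - real k * \<alpha>) = 0" if x: "x \<in> {0..psi k t} - {psi k t}" for x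
  proof (rule supp_empty_even[OF k(2)])
    have "hh n r k < t * sin (beta k - x)" using x by (intro p(5)) auto
    then show "2 * r * cos \<alpha> < t * cos x" unfolding hk k(2) by (simp add: sin_diff)
  qed
  show ?thesis
    by (rule has_integral_spike_finite[of "{psi k t}" _ _ "\<lambda>_. 0"]) (use z in auto)
qed

text \<open>No chord exists where t sin (\<open>beta k\<close> + \<psi>) > \<lambda>, that is, for
  \<open>beta k\<close> + \<psi> strictly between \<theta> and pi - \<theta>. This cuts the piece
  before the switch into three; the work lies in showing that the gap is inside
  [0, \<open>psi k t\<close>].\<close>

lemma upper_part_odd:
  assumes n: "n = 2 * k + 3" and t: "lam n r < t" "t \<le> ell n r (Suc k)" "ell n r k \<le> t"
  defines "\<theta> \<equiv> arcsin (lam n r / t)"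
  shows "((\<lambda>\<psi>. supp t (\<psi> - real k * \<alpha>)) has_integral
      Sfun k t (\<theta> - beta k) - Sfun k t (pi - \<theta> - beta k) + Sfun k t (psi k t)) {0..psi k t}"
proof -
  have k: "k \<le> kmax n" "beta k < pi / 2" using n unfolding beta_le_pi2_iff by (auto simp: kmax_def)
  note top = odd_top[OF n]
  have lam0: "lam n r > 0" using r0 cos_alpha_pos unfolding top(3) by (intro add_pos_pos) auto
  then have t0: "t > 0" using t by simp
  note p = psi_props[OF k(1) t(3,2) t0]
  define q where "q = lam n r / t"
  have q: "0 < q" "q < 1" using t lam0 t0 by (auto simp: q_def)
  have s\<theta>: "sin \<theta> = q" unfolding \<theta>_def q_def[symmetric] using q by simp
  have \<theta>b: "0 < \<theta>" "\<theta> < pi / 2"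
    using arcsin_less_arcsin[of 0 q] arcsin_less_arcsin[of q 1] q
    unfolding \<theta>_def q_def[symmetric] by auto
  have ell: "ell n r (Suc k) = 2 * r * cos (\<alpha> / 2)" unfolding ell_Suc top(4) ..
  have ca2: "cos (\<alpha> / 2) > 0" using alpha_pos alpha_less_pi2 by (intro cos_gt_zero_pi) auto
  have B\<theta>: "beta k \<le> \<theta>"
  proof -
    have "cos (\<alpha> / 2) * t \<le> cos (\<alpha> / 2) * (2 * r * cos (\<alpha> / 2))"
      using t ca2 unfolding ell by (intro mult_left_mono) auto
    also have "\<dots> = lam n r" by (simp add: lam_def power2_eq_square)
    finally have "sin (beta k) \<le> q" unfolding q_def top(4) using t0 by (simp add: le_divide_eq)
    then have "arcsin (sin (beta k)) \<le> arcsin q" using q by (intro arcsin_le_arcsin) auto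
    then show ?thesis using k beta_pos[of k] by (simp add: arcsin_sin \<theta>_def q_def)
  qed
  have \<theta>\<alpha>: "0 \<le> \<theta> - \<alpha>" using B\<theta> beta_ge[of k] by simp
  have x2: "pi - \<theta> - beta k \<le> psi k t"
  proof -
    \<comment> \<open>Pythagoras in the right triangle with hypotenuse
      \<open>ell n r (Suc k)\<close>, the distance from a vertex to an end of the opposite edge,
      with the height \<lambda> as one leg and half an edge as the other.\<close>
    have tc: "t * cos \<theta> \<le> r * sin \<alpha>"
    proof (rule power2_le_imp_le)
      have "(t * cos \<theta>)\<^sup>2 = t\<^sup>2 - (t * sin \<theta>)\<^sup>2"
        by (simp add: power_mult_distrib cos_squared_eq algebra_simps)
      also have "t * sin \<theta> = lam n r" unfolding s\<theta> q_def using t0 by simp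
      also have "t\<^sup>2 - (lam n r)\<^sup>2 \<le> (2 * r * cos (\<alpha> / 2))\<^sup>2 - (lam n r)\<^sup>2"
        using t t0 unfolding ell by (intro diff_right_mono power_mono) auto
      also have "\<dots> = 2 * r * lam n r - (lam n r)\<^sup>2"
        by (simp add: lam_def power2_eq_square)
      also have "\<dots> = r\<^sup>2 * (1 - (cos \<alpha>)\<^sup>2)"
        unfolding top(3) by (simp add: power2_eq_square algebra_simps)
      also have "\<dots> = (r * sin \<alpha>)\<^sup>2" by (simp add: sin_squared_eq power_mult_distrib)
      finally show "(t * cos \<theta>)\<^sup>2 \<le> (r * sin \<alpha>)\<^sup>2" .
      show "0 \<le> r * sin \<alpha>" using r0 sin_alpha_pos by simp
    qed
    have hk: "hh n r k = r * (cos \<alpha> + cos (2 * \<alpha>))"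
    proof -
      note ka = kalpha[of k]
      have c: "cos \<alpha> = 1 - 2 * (sin (\<alpha> / 2))\<^sup>2" "cos \<alpha> = 2 * (cos (\<alpha> / 2))\<^sup>2 - 1" "sin \<alpha> = 2 * sin (\<alpha> / 2) * cos (\<alpha> / 2)"
        using cos_double_sin[of "\<alpha> / 2"] cos_double_cos[of "\<alpha> / 2"] sin_double[of "\<alpha> / 2"] by simp_all
      have "hh n r k = r * (2 * (cos (\<alpha> / 2))\<^sup>2 * cos \<alpha> - sin \<alpha> * (2 * sin (\<alpha> / 2) * cos (\<alpha> / 2)))"
        unfolding hh_beta ka sin_diff top(4,5) by (simp add: power2_eq_square algebra_simps)
      also have "2 * (cos (\<alpha> / 2))\<^sup>2 = 1 + cos \<alpha>" using c by simp
      also have "2 * sin (\<alpha> / 2) * cos (\<alpha> / 2) = sin \<alpha>" using c by simp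
      also have "(1 + cos \<alpha>) * cos \<alpha> - sin \<alpha> * sin \<alpha> = cos \<alpha> + cos (2 * \<alpha>)"
        unfolding cos_double by (simp add: power2_eq_square algebra_simps)
      finally show ?thesis .
    qed
    have "hh n r k = lam n r * cos \<alpha> - r * (sin \<alpha>)\<^sup>2"
      unfolding hk top(3) cos_double by (simp add: power2_eq_square algebra_simps)
    also have "lam n r = t * sin \<theta>" unfolding s\<theta> q_def using t0 by simp
    also have "t * sin \<theta> * cos \<alpha> - r * (sin \<alpha>)\<^sup>2 \<le> t * sin \<theta> * cos \<alpha> - t * cos \<theta> * sin \<alpha>"
      using mult_right_mono[OF tc, of "sin \<alpha>"] sin_alpha_pos by (simp add: power2_eq_square algebra_simps)
    also have "\<dots> = t * sin (\<theta> - \<alpha>)" by (simp add: sin_diff algebra_simps)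
    finally have "hh n r k / t \<le> sin (\<theta> - \<alpha>)" using t0 by (simp add: divide_le_eq mult.commute)
    then have "arcsin (hh n r k / t) \<le> arcsin (sin (\<theta> - \<alpha>))"
      using p(6) by (intro arcsin_le_arcsin) auto
    also have "\<dots> = \<theta> - \<alpha>" using \<theta>\<alpha> \<theta>b alpha_pos by (intro arcsin_sin) auto
    finally show ?thesis unfolding psi_def top(1) by (simp add: algebra_simps)
  qed
  have strip: "supp t (x - real k * \<alpha>) = splus k t x"
    if x: "0 \<le> x" "x \<le> psi k t" and le: "sin (beta k + x) \<le> q" for x
  proof (rule supp_strip)
    have "t * sin (beta k + x) \<le> t * q" using le t0 by simp
    also have "\<dots> = hh n r (k + 1)" unfolding q_def using t0 top(2) by simp
    finally show "t * sin (beta k + x) \<le> hh n r (k + 1)" .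
  qed (use x p k t0 in auto)
  have 1: "((\<lambda>\<psi>. supp t (\<psi> - real k * \<alpha>)) has_integral Sfun k t (\<theta> - beta k)) {0..\<theta> - beta k}"
  proof -
    have "(splus k t has_integral (Sfun k t (\<theta> - beta k) - Sfun k t 0)) {0..\<theta> - beta k}"
      using B\<theta> sin_2beta[OF k(2)] by (intro splus_has_integral) auto
    moreover have "supp t (x - real k * \<alpha>) = splus k t x" if x: "x \<in> {0..\<theta> - beta k}" for x
    proof (rule strip)
      show "x \<le> psi k t" using x x2 \<theta>b by auto
      have "sin (beta k + x) \<le> sin \<theta>"
        using x \<theta>b beta_pos[of k] by (intro sin_monotone_2pi_le) auto
      then show "sin (beta k + x) \<le> q" by (simp add: s\<theta>)
    qed (use x in auto)
    ultimately show ?thesis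
      using has_integral_cong[of "{0..\<theta> - beta k}" "\<lambda>\<psi>. supp t (\<psi> - real k * \<alpha>)" "splus k t"]
      by (simp add: Sfun_0)
  qed
  have 2: "((\<lambda>\<psi>. supp t (\<psi> - real k * \<alpha>)) has_integral 0) {\<theta> - beta k..pi - \<theta> - beta k}"
  proof (rule has_integral_spike_finite[of "{\<theta> - beta k, pi - \<theta> - beta k}" _ _ "\<lambda>_. 0"])
    fix x assume x: "x \<in> {\<theta> - beta k..pi - \<theta> - beta k} - {\<theta> - beta k, pi - \<theta> - beta k}"
    have "sin \<theta> < sin (beta k + x)"
    proof (cases "beta k + x \<le> pi / 2")
      case True
      then show ?thesis using x \<theta>b by (intro sin_monotone_2pi) auto
    next
      case False
      then have "sin \<theta> < sin (pi - (beta k + x))" using x \<theta>b by (intro sin_monotone_2pi) auto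
      then show ?thesis by simp
    qed
    then have "t * q < t * sin (beta k + x)" unfolding s\<theta> using t0 by simp
    then show "supp t (x - real k * \<alpha>) = 0"
      unfolding q_def using t0 by (intro supp_empty_odd) simp
  qed auto
  have 3: "((\<lambda>\<psi>. supp t (\<psi> - real k * \<alpha>)) has_integral Sfun k t (psi k t) - Sfun k t (pi - \<theta> - beta k))
      {pi - \<theta> - beta k..psi k t}"
  proof -
    have "(splus k t has_integral (Sfun k t (psi k t) - Sfun k t (pi - \<theta> - beta k))) {pi - \<theta> - beta k..psi k t}"
      using x2 sin_2beta[OF k(2)] by (intro splus_has_integral) auto
    moreover have "supp t (x - real k * \<alpha>) = splus k t x" if x: "x \<in> {pi - \<theta> - beta k..psi k t}" for x
    proof (rule strip)
      show "0 \<le> x" using x \<theta>b k by auto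
      have "x \<le> \<alpha>" using x p(2) by auto
      then have "sin (pi - (beta k + x)) \<le> sin \<theta>"
        using x \<theta>b unfolding top(1) using alpha_less_pi2
        by (intro sin_monotone_2pi_le) (auto simp: top(1))
      then show "sin (beta k + x) \<le> q" by (simp add: s\<theta>)
    qed (use x in auto)
    ultimately show ?thesis
      using has_integral_cong[of "{pi - \<theta> - beta k..psi k t}" "\<lambda>\<psi>. supp t (\<psi> - real k * \<alpha>)" "splus k t"]
      by simp
  qed
  have "((\<lambda>\<psi>. supp t (\<psi> - real k * \<alpha>)) has_integral
      (Sfun k t (\<theta> - beta k) + 0 + (Sfun k t (psi k t) - Sfun k t (pi - \<theta> - beta k)))) {0..psi k t}"
    using B\<theta> \<theta>b x2 by (intro has_integral_combine[OF _ _ has_integral_combine[OF _ _ 1 2] 3]) auto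
  then show ?thesis by (simp add: algebra_simps)
qed

end

section \<open>Comparison with the closed form\<close>

context regular_ngon
begin

definition Jt :: "real \<Rightarrow> real" where "Jt t = integral {0..\<alpha>} (supp t)"

lemma Jt_eq:
  assumes "((\<lambda>\<psi>. supp t (\<psi> - real k * \<alpha>)) has_integral J) {0..\<alpha>}"
  shows "Jt t = J" "(supp t has_integral Jt t) {0..\<alpha>}"
proof -
  note I = supp_has_integral_sector[OF assms]
  then show "Jt t = J" unfolding Jt_def by (rule integral_unique)
  with I show "(supp t has_integral Jt t) {0..\<alpha>}" by simp
qed

lemma hh_less: assumes "k \<le> kmax n" "ell n r k < t" shows "hh n r k < t"
proof -
  have "hh n r k \<le> ell n r k * 1"
    unfolding ell_nonneg(3)[OF assms(1)] using ell_nonneg(1)[OF assms(1)] by (intro mult_left_mono) auto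
  with assms(2) show ?thesis by simp
qed

lemma arcsin_quotient:
  assumes "0 \<le> a" "a < t"
  shows "sin (arcsin (a / t)) = a / t" "cos (arcsin (a / t)) = sqrt (t\<^sup>2 - a\<^sup>2) / t" "t * sin (arcsin (a / t)) = a"
proof -
  have t: "t > 0" using assms by simp
  have q: "0 \<le> a / t" "a / t \<le> 1" using assms t by simp_all
  show "sin (arcsin (a / t)) = a / t" using q by simp
  with t show "t * sin (arcsin (a / t)) = a" by simp
  have "1 - (a / t)\<^sup>2 = (t\<^sup>2 - a\<^sup>2) / t\<^sup>2" using t by (simp add: power_divide diff_divide_distrib)
  moreover have "cos (arcsin (a / t)) = sqrt (1 - (a / t)\<^sup>2)" using q by (intro cos_arcsin) auto
  ultimately show "cos (arcsin (a / t)) = sqrt (t\<^sup>2 - a\<^sup>2) / t" using t by (simp add: real_sqrt_divide)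
qed

lemma hh_0: "hh n r 0 = 0" and ell_0: "ell n r 0 = 0" and beta_0: "beta 0 = \<alpha>" and psi_0: "psi 0 t = \<alpha>"
  by (simp_all add: hh_def ell_def beta_def psi_def)

lemma odd_kmax: assumes "odd n" "k = kmax n" shows "n = 2 * k + 3"
  using assms n3 unfolding kmax_def by presburger

lemma even_kmax: assumes "even n" "k = kmax n" shows "n = 2 * k + 2" "k \<ge> 1"
proof -
  from assms n3 show "n = 2 * k + 2" unfolding kmax_def by presburger
  with n3 show "k \<ge> 1" by simp
qed

lemma beta_less_pi2:
  assumes "k \<le> kmax n" "odd n \<or> k < kmax n" shows "beta k < pi / 2"
  using assms n3 unfolding beta_le_pi2_iff kmax_def by presburger

text \<open>For k = 0 one has h_0 = 0, so the switch sits at \<alpha> and a single pair of edges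
  serves the whole sector.\<close>

lemma Jt_bottom:
  assumes "0 < t" "t \<le> ell n r 1" "n = 3 \<Longrightarrow> t \<le> lam n r"
  shows "Jt t = Sfun 0 t \<alpha>" "(supp t has_integral Jt t) {0..\<alpha>}"
proof -
  have k: "0 \<le> kmax n" "beta 0 < pi / 2" using alpha_less_pi2 by (simp_all add: beta_0)
  have "t \<le> lam n r" if "odd n" "0 = kmax n" using odd_kmax[OF that] assms(3) by simp
  then have "((\<lambda>\<psi>. supp t (\<psi> - real 0 * \<alpha>)) has_integral Sfun 0 t (psi 0 t)) {0..psi 0 t}"
    using assms by (intro upper_part[OF k]) (auto simp: ell_0)
  then have "((\<lambda>\<psi>. supp t (\<psi> - real 0 * \<alpha>)) has_integral Sfun 0 t \<alpha>) {0..\<alpha>}" unfolding psi_0 .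
  from Jt_eq[OF this] show "Jt t = Sfun 0 t \<alpha>" "(supp t has_integral Jt t) {0..\<alpha>}" .
qed

section \<open>Derivatives of the functions H\<close>

lemma tan_cot: "tan \<alpha> - cot \<alpha> = - 2 * cot (2 * \<alpha>)"
  unfolding tan_def cot_def cos_double sin_double
  using cos_alpha_pos sin_alpha_pos by (simp add: field_simps power2_eq_square)

lemma sin_2alpha: "sin (2 * \<alpha>) > 0"
  using alpha_pos alpha_less_pi2 by (intro sin_gt_zero) auto

lemma two_Sfun_bottom: "2 * Sfun 0 t \<alpha> = ell n r 1 - (1 / 2 - \<alpha> * cot (2 * \<alpha>)) * t"
proof -
  have "cos \<alpha> * tan \<alpha> = sin \<alpha>" using cos_alpha_pos by (simp add: tan_def)
  then have 1: "2 * r * cos \<alpha> * tan \<alpha> = ell n r 1" by (simp add: ell_def mult.assoc)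
  have "2 * Sfun 0 t \<alpha> = 2 * r * cos \<alpha> * tan \<alpha> - t * (1 / 2 - \<alpha> * cot (2 * \<alpha>))"
    using Sfun_shift[of 0 t 0] sin_2alpha unfolding beta_0 by simp
  then show ?thesis unfolding 1 by (simp add: algebra_simps)
qed

lemma H0_deriv: "(H0 n r k has_real_derivative 2 * Sfun 0 t \<alpha>) (at t)"
proof -
  have "(H0 n r k has_real_derivative ell n r 1 - (1 + \<alpha> * (tan \<alpha> - cot \<alpha>)) * (2 * t) / 4) (at t)"
    unfolding H0_def[abs_def] by (auto intro!: derivative_eq_intros)
  also have "ell n r 1 - (1 + \<alpha> * (tan \<alpha> - cot \<alpha>)) * (2 * t) / 4 = 2 * Sfun 0 t \<alpha>"
    unfolding tan_cot two_Sfun_bottom by (simp add: field_simps)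
  finally show ?thesis .
qed

lemma times_two_half: "c * (2 * t) / 2 = c * t" for c t :: real
  by simp

lemma two_angles: "2 * real (Suc m) * \<alpha> = 2 * beta m" "2 * real (Suc m + 1) * \<alpha> = 2 * beta (Suc m)"
  "real (k + 1) * \<alpha> = beta k" "2 * real (k + 1) * \<alpha> = 2 * beta k"
  by (simp_all add: beta_def)

lemma pp_beta: "n \<noteq> 3 \<Longrightarrow> pp n (Suc m) = cot (2 * beta m) - cot (2 * beta (Suc m))"
  and qq_beta: "qq n (Suc m) = tan (beta m) - tan (beta (Suc m))"
  unfolding pp_def qq_def two_angles beta_Suc by simp_all

lemma two_Sfun_lower:
  assumes b: "beta m < pi / 2" and h: "0 \<le> h" "h < t"
  defines "\<eta> \<equiv> arcsin (h / t)"
  shows "2 * Sfun m t (beta m - \<eta>) = 2 * r * cos \<alpha> * (tan (beta m) * cos \<eta> - sin \<eta>)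
    - (t / 2 - h * sin \<eta> - cot (2 * beta m) * (h * cos \<eta>) - (beta m - \<eta>) * cot (2 * beta m) * t)"
proof -
  have e: "h = t * sin \<eta>" unfolding \<eta>_def using arcsin_quotient(3)[OF h] by simp
  have "2 * Sfun m t (beta m - \<eta>) = 2 * r * cos \<alpha> * (tan (beta m) * cos \<eta> - sin \<eta>)
    - t * (1 / 2 - (sin \<eta>)\<^sup>2 - cot (2 * beta m) * (sin \<eta> * cos \<eta>) - (beta m - \<eta>) * cot (2 * beta m))"
    using sin_2beta[OF b] by (intro Sfun_shift) simp
  also have "t * (1 / 2 - (sin \<eta>)\<^sup>2 - cot (2 * beta m) * (sin \<eta> * cos \<eta>) - (beta m - \<eta>) * cot (2 * beta m))
    = t / 2 - t * sin \<eta> * sin \<eta> - cot (2 * beta m) * (t * sin \<eta> * cos \<eta>) - (beta m - \<eta>) * cot (2 * beta m) * t"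
    by (simp add: algebra_simps power2_eq_square)
  finally show ?thesis unfolding e[symmetric] .
qed

text \<open>Both values of \<open>Sfun\<close> belong to the same \<eta>, so the terms t / 2, h sin
  \<eta> and 2 r cos \<alpha> sin \<eta> cancel. Multiples of t \<eta>, t and cos \<eta> are left,
  with the differences of cotangents and tangents collected in \<open>pp\<close> and
  \<open>qq\<close>.\<close>

lemma H1_deriv:
  assumes n: "n \<noteq> 3" and k: "Suc m \<le> kmax n" "beta (Suc m) < pi / 2" and t: "ell n r (Suc m) < t"
  shows "(H1 n r (Suc m) has_real_derivative
     2 * Sfun (Suc m) t (psi (Suc m) t) - 2 * Sfun m t (psi (Suc m) t - \<alpha>)) (at t)"
proof -
  define h where "h = hh n r (Suc m)"
  have h: "0 \<le> h" "h < t" unfolding h_def using ell_nonneg(2)[OF k(1)] hh_less[OF k(1) t] by simp_all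
  define \<eta> where "\<eta> = arcsin (h / t)"
  have c: "sqrt (t\<^sup>2 - h\<^sup>2) / t = cos \<eta>" unfolding \<eta>_def using arcsin_quotient(2)[OF h] by simp
  have b: "beta m < pi / 2" using k(2) alpha_pos by (simp add: beta_add)
  have psi: "psi (Suc m) t = beta (Suc m) - \<eta>" "psi (Suc m) t - \<alpha> = beta m - \<eta>"
    by (simp_all add: psi_def \<eta>_def h_def beta_add)
  have "(H1 n r (Suc m) has_real_derivative
     pp n (Suc m) * (t * arcsin (h / t))
     - (beta m * cot (2 * beta m) - beta (Suc m) * cot (2 * beta (Suc m))) * (2 * t) / 2
     - (h * pp n (Suc m) + 2 * r * qq n (Suc m) * cos \<alpha>) * (sqrt (t\<^sup>2 - h\<^sup>2) / t)) (at t)"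
    unfolding H1_def[abs_def] two_angles beta_Suc h_def[symmetric]
    by (auto intro!: derivative_eq_intros sigma1_deriv[OF h] tau_m1_deriv[OF h])
  also have "pp n (Suc m) * (t * arcsin (h / t))
     - (beta m * cot (2 * beta m) - beta (Suc m) * cot (2 * beta (Suc m))) * (2 * t) / 2
     - (h * pp n (Suc m) + 2 * r * qq n (Suc m) * cos \<alpha>) * (sqrt (t\<^sup>2 - h\<^sup>2) / t)
    = 2 * Sfun (Suc m) t (psi (Suc m) t) - 2 * Sfun m t (psi (Suc m) t - \<alpha>)"
    unfolding psi(2) unfolding psi(1) c \<eta>_def[symmetric] two_Sfun_lower[OF b h, folded \<eta>_def]
      two_Sfun_lower[OF k(2) h, folded \<eta>_def] pp_beta[OF n] qq_beta times_two_half
    by (simp add: algebra_simps)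
  finally show ?thesis .
qed

text \<open>Only one \<open>Sfun\<close> is present, so the terms that cancel in
  \<open>H1_deriv\<close> survive; sin \<eta> = h / t is the source of the logarithm.\<close>

lemma H2_deriv:
  assumes k: "Suc m \<le> kmax n" and t: "ell n r (Suc m) < t"
  shows "(H2 n r (Suc m) has_real_derivative - 2 * Sfun m t (psi (Suc m) t - \<alpha>)) (at t)"
proof -
  define h where "h = hh n r (Suc m)"
  have h: "0 \<le> h" "h < t" unfolding h_def using ell_nonneg(2)[OF k(1)] hh_less[OF k(1) t] by simp_all
  define \<eta> where "\<eta> = arcsin (h / t)"
  have t0: "t > 0" using h by simp
  have c: "sqrt (t\<^sup>2 - h\<^sup>2) / t = cos \<eta>" unfolding \<eta>_def using arcsin_quotient(2)[OF h] by simp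
  have s: "1 / t * h = sin \<eta>" unfolding \<eta>_def using arcsin_quotient(1)[OF h] by simp
  have b: "beta m < pi / 2" using kmax_beta[OF k] alpha_pos by (simp add: beta_add)
  have psi: "psi (Suc m) t - \<alpha> = beta m - \<eta>"
    by (simp add: psi_def \<eta>_def h_def beta_add)
  have "(H2 n r (Suc m) has_real_derivative
     (1 / 2 - beta m * cot (2 * beta m)) * (2 * t) / 2 + cot (2 * beta m) * (t * arcsin (h / t))
     - (h - 2 * r * cos \<alpha>) * (1 / t * h)
     - (h * cot (2 * beta m) + 2 * r * cos \<alpha> * tan (beta m)) * (sqrt (t\<^sup>2 - h\<^sup>2) / t)) (at t)"
    unfolding H2_def[abs_def] two_angles beta_Suc h_def[symmetric]
    using t0 by (auto intro!: derivative_eq_intros sigma1_deriv[OF h] tau_m1_deriv[OF h])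
  also have "(1 / 2 - beta m * cot (2 * beta m)) * (2 * t) / 2 + cot (2 * beta m) * (t * arcsin (h / t))
     - (h - 2 * r * cos \<alpha>) * (1 / t * h)
     - (h * cot (2 * beta m) + 2 * r * cos \<alpha> * tan (beta m)) * (sqrt (t\<^sup>2 - h\<^sup>2) / t)
    = - 2 * Sfun m t (psi (Suc m) t - \<alpha>)"
    using two_Sfun_lower[OF b h, folded \<eta>_def]
    unfolding psi c s \<eta>_def[symmetric] times_two_half
    by (simp add: algebra_simps)
  finally show ?thesis .
qed

text \<open>The ends of the gap correspond to \<theta> and pi - \<theta>, with equal sines and
  opposite cosines: the pure sine terms cancel and the cosine terms double. The relation 2
  \<open>beta k\<close> = pi - \<alpha> then produces the secant and cosecant of
  \<open>H3\<close>.\<close>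

lemma two_Sfun_gap:
  assumes n: "n = 2 * k + 3" and t: "lam n r < t"
  defines "\<theta> \<equiv> arcsin (lam n r / t)"
  shows "2 * (Sfun k t (\<theta> - beta k) - Sfun k t (pi - \<theta> - beta k))
    = 2 * cot (2 * beta k) * (t * \<theta>) - pi * cot (2 * beta k) * t
      - 2 * cos \<alpha> * (2 * r * cos (\<alpha> / 2) * (1 / cos (beta k)) - lam n r * (1 / sin (2 * beta k))) * cos \<theta>"
proof -
  have k: "beta k < pi / 2" using n unfolding beta_le_pi2_iff by simp
  note top = odd_top[OF n]
  have lam0: "0 \<le> lam n r" using r0 by (simp add: lam_def)
  have e: "lam n r = t * sin \<theta>" unfolding \<theta>_def using arcsin_quotient(3)[OF lam0 t] by simp
  have s2: "sin (2 * beta k) \<noteq> 0" using sin_2beta[OF k] by simp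
  have "2 * beta k = pi - \<alpha>" unfolding top(1) by simp
  then have "cos (2 * beta k) = - cos \<alpha>" by simp
  then have 1: "cos \<alpha> * (1 / sin (2 * beta k)) = - cot (2 * beta k)" by (simp add: cot_def)
  have 2: "cos (\<alpha> / 2) * (1 / cos (beta k)) = tan (beta k)" unfolding top(4)[symmetric] by (simp add: tan_def)
  have "2 * Sfun k t (\<theta> - beta k) = - (2 * Sfun k t (beta k - \<theta>))"
    "2 * Sfun k t (pi - \<theta> - beta k) = - (2 * Sfun k t (beta k - (pi - \<theta>)))"
    using Sfun_minus[of k t "beta k - \<theta>"] Sfun_minus[of k t "beta k - (pi - \<theta>)"] by simp_all
  then have "2 * (Sfun k t (\<theta> - beta k) - Sfun k t (pi - \<theta> - beta k))
    = - (2 * Sfun k t (beta k - \<theta>)) + 2 * Sfun k t (beta k - (pi - \<theta>))"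
    unfolding right_diff_distrib by simp
  also have "\<dots> = - 4 * r * cos \<alpha> * tan (beta k) * cos \<theta>
      - 2 * cot (2 * beta k) * (t * sin \<theta>) * cos \<theta> + 2 * cot (2 * beta k) * (t * \<theta>) - pi * cot (2 * beta k) * t"
    unfolding Sfun_shift[OF s2] by (simp add: algebra_simps)
  also have "\<dots> = 2 * cot (2 * beta k) * (t * \<theta>) - pi * cot (2 * beta k) * t
     - (4 * r * cos \<alpha> * (cos (\<alpha> / 2) * (1 / cos (beta k)))
       - 2 * (cos \<alpha> * (1 / sin (2 * beta k))) * lam n r) * cos \<theta>"
    unfolding 1 2 e[symmetric] by (simp add: algebra_simps)
  finally show ?thesis by (simp add: algebra_simps)
qed

text \<open>The common part of the triangle and of the larger odd polygons, which differ in the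
  values of \<open>pp\<close> and \<open>ss\<close>. The gap contributes - pi G t, and the summand
  pi G t compensates for it.\<close>

lemma H3_deriv_aux:
  assumes n: "n = 2 * k + 3" and t: "lam n r < t" "ell n r k < t"
  defines "h \<equiv> hh n r k" and "G \<equiv> cot (2 * beta k)"
  shows "(H3 n r k has_real_derivative
     pp n k * (t * arcsin (h / t)) - ((pi - \<alpha>) * G + ss n k) * t + pi * G * t
     - (h * pp n k + 2 * r * qq n k * cos \<alpha>) * (sqrt (t\<^sup>2 - h\<^sup>2) / t)
     + 2 * (Sfun k t (arcsin (lam n r / t) - beta k) - Sfun k t (pi - arcsin (lam n r / t) - beta k))) (at t)"
proof -
  have k: "k \<le> kmax n" using n by (auto simp: kmax_def)
  have h: "0 \<le> h" "h < t" unfolding h_def using ell_nonneg(2)[OF k(1)] hh_less[OF k(1) t(2)] by simp_all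
  have lam0: "0 \<le> lam n r" using r0 by (simp add: lam_def)
  define \<theta> where "\<theta> = arcsin (lam n r / t)"
  have c: "sqrt (t\<^sup>2 - (lam n r)\<^sup>2) / t = cos \<theta>" unfolding \<theta>_def using arcsin_quotient(2)[OF lam0 t(1)] by simp
  have "(H3 n r k has_real_derivative
     pp n k * (t * arcsin (h / t)) + 2 * G * (t * arcsin (lam n r / t))
     - ((pi - \<alpha>) * G + ss n k) * (2 * t) / 2
     - (h * pp n k + 2 * r * qq n k * cos \<alpha>) * (sqrt (t\<^sup>2 - h\<^sup>2) / t)
     - 2 * cos \<alpha> * (2 * r * cos (\<alpha> / 2) * (1 / cos (beta k)) - lam n r * (1 / sin (2 * beta k)))
        * (sqrt (t\<^sup>2 - (lam n r)\<^sup>2) / t)) (at t)"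
    unfolding H3_def[abs_def] two_angles h_def[symmetric] G_def
    by (auto intro!: derivative_eq_intros sigma1_deriv[OF h] tau_m1_deriv[OF h]
        sigma1_deriv[OF lam0 t(1)] tau_m1_deriv[OF lam0 t(1)] simp: mult_ac)
  then show ?thesis
    unfolding \<theta>_def[symmetric]
    by (rule DERIV_cong, unfold two_Sfun_gap[OF n t(1), folded \<theta>_def G_def] c times_two_half)
       (simp add: algebra_simps)
qed

lemma H3_deriv:
  assumes n: "n = 2 * Suc m + 3" and t: "lam n r < t" "ell n r (Suc m) < t"
  shows "(H3 n r (Suc m) has_real_derivative
     2 * (Sfun (Suc m) t (arcsin (lam n r / t) - beta (Suc m)) - Sfun (Suc m) t (pi - arcsin (lam n r / t) - beta (Suc m))
     + Sfun (Suc m) t (psi (Suc m) t) - Sfun m t (psi (Suc m) t - \<alpha>))) (at t)"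
proof -
  have k: "Suc m \<le> kmax n" "beta (Suc m) < pi / 2" "n \<noteq> 3"
    using n unfolding beta_le_pi2_iff by (auto simp: kmax_def)
  define h where "h = hh n r (Suc m)"
  have h: "0 \<le> h" "h < t" unfolding h_def using ell_nonneg(2)[OF k(1)] hh_less[OF k(1) t(2)] by simp_all
  define \<eta> where "\<eta> = arcsin (h / t)"
  have c: "sqrt (t\<^sup>2 - h\<^sup>2) / t = cos \<eta>" unfolding \<eta>_def using arcsin_quotient(2)[OF h] by simp
  have b: "beta m < pi / 2" using k(2) alpha_pos by (simp add: beta_add)
  have psi: "psi (Suc m) t = beta (Suc m) - \<eta>" "psi (Suc m) t - \<alpha> = beta m - \<eta>"
    by (simp_all add: psi_def \<eta>_def h_def beta_add)
  define G where "G = cot (2 * beta (Suc m))"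
  define F where "F = cot (2 * beta m)"
  have pi: "pi = 2 * beta m + 3 * \<alpha>" and B: "beta (Suc m) = beta m + \<alpha>"
    using odd_top(1)[OF n] by (simp_all add: beta_add)
  \<comment> \<open>With this value the coefficient of t outside the gap becomes (k + 1) \<alpha> G
    - k \<alpha> F for k = m + 1, as in the derivative of \<open>H1\<close>. So \<open>H3\<close>
    has the derivative of \<open>H1\<close> plus the contribution of the gap.\<close>
  have ss: "ss n (Suc m) = beta m * (F - G)"
    using k(3) by (simp add: ss_def pp_beta F_def G_def flip: beta_Suc)
  have eq: "2 * Sfun (Suc m) t (psi (Suc m) t) - 2 * Sfun m t (psi (Suc m) t - \<alpha>)
    = pp n (Suc m) * (t * arcsin (h / t)) - ((pi - \<alpha>) * G + ss n (Suc m)) * t + pi * G * t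
     - (h * pp n (Suc m) + 2 * r * qq n (Suc m) * cos \<alpha>) * (sqrt (t\<^sup>2 - h\<^sup>2) / t)"
    unfolding psi(2) unfolding psi(1) c \<eta>_def[symmetric] two_Sfun_lower[OF b h, folded \<eta>_def]
      two_Sfun_lower[OF k(2) h, folded \<eta>_def] pp_beta[OF k(3)] qq_beta ss F_def[symmetric] G_def[symmetric]
    unfolding pi B by (simp add: algebra_simps)
  show ?thesis
    by (rule DERIV_cong[OF H3_deriv_aux[OF n t, folded h_def G_def]], simp only: eq[symmetric])
       (simp add: algebra_simps)
qed

text \<open>For k = 0 there is no lower pair and cot (2 k \<alpha>) is singular. The conventions p =
  0 and s = 1 / 2 make the part outside the gap equal to the derivative of
  \<open>H0\<close>.\<close>

lemma H3_deriv_triangle: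
  assumes n: "n = 3" and t: "lam n r < t"
  shows "(H3 n r 0 has_real_derivative
     2 * (Sfun 0 t (arcsin (lam n r / t) - beta 0) - Sfun 0 t (pi - arcsin (lam n r / t) - beta 0)
     + Sfun 0 t \<alpha>)) (at t)"
proof -
  have lam0: "0 \<le> lam n r" using r0 by (simp add: lam_def)
  have t0: "0 < t" "ell n r 0 < t" using t lam0 by (simp_all add: ell_0)
  have e: "pp n 0 = 0" "ss n 0 = 1 / 2" "qq n 0 = - tan \<alpha>" "sqrt (t\<^sup>2 - 0\<^sup>2) / t = 1"
    using n t0 by (simp_all add: pp_def ss_def qq_def)
  have "cos \<alpha> * tan \<alpha> = sin \<alpha>" using cos_alpha_pos by (simp add: tan_def)
  then have 1: "2 * r * - tan \<alpha> * cos \<alpha> = - ell n r 1" by (simp add: ell_def mult_ac)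
  have n': "n = 2 * 0 + 3" using n by simp
  show ?thesis
    using H3_deriv_aux[OF n' t t0(2)]
    unfolding hh_0 e 1 beta_0 distrib_left[of 2] two_Sfun_bottom
    by (simp add: algebra_simps 1)
qed

section \<open>The sector integral in each range of lengths\<close>

lemma Jt_middle:
  assumes k: "Suc m \<le> kmax n" "odd n \<or> Suc m < kmax n"
    and t: "ell n r (Suc m) \<le> t" "t \<le> ell n r (Suc (Suc m))" and odd: "odd n \<Longrightarrow> Suc m = kmax n \<Longrightarrow> t \<le> lam n r"
  shows "Jt t = Sfun (Suc m) t (psi (Suc m) t) - Sfun m t (psi (Suc m) t - \<alpha>)"
    "(supp t has_integral Jt t) {0..\<alpha>}"
proof -
  have t0: "t > 0" using ell_nonneg(4)[OF k(1)] t by simp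
  note p = psi_props[OF k(1) t t0]
  have "((\<lambda>\<psi>. supp t (\<psi> - real (Suc m) * \<alpha>)) has_integral
    (Sfun (Suc m) t (psi (Suc m) t) + - Sfun m t (psi (Suc m) t - \<alpha>))) {0..\<alpha>}"
    by (rule has_integral_combine[OF p(1,2) upper_part[OF k(1) beta_less_pi2[OF k] t t0 odd] lower_part[OF k(1) t]])
  from Jt_eq[OF this] show "Jt t = Sfun (Suc m) t (psi (Suc m) t) - Sfun m t (psi (Suc m) t - \<alpha>)"
    "(supp t has_integral Jt t) {0..\<alpha>}" by simp_all
qed

lemma Jt_top_even:
  assumes n: "even n" and k: "Suc m = kmax n"
    and t: "ell n r (Suc m) \<le> t" "t \<le> ell n r (Suc (Suc m))"
  shows "Jt t = - Sfun m t (psi (Suc m) t - \<alpha>)" "(supp t has_integral Jt t) {0..\<alpha>}"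
proof -
  have k': "Suc m \<le> kmax n" using k by simp
  have t0: "t > 0" using ell_nonneg(4)[OF k'] t by simp
  note p = psi_props[OF k' t t0]
  have b: "beta (Suc m) = pi / 2" unfolding beta_le_pi2_iff using even_kmax(1)[OF n k] by simp
  have "((\<lambda>\<psi>. supp t (\<psi> - real (Suc m) * \<alpha>)) has_integral
    (0 + - Sfun m t (psi (Suc m) t - \<alpha>))) {0..\<alpha>}"
    by (rule has_integral_combine[OF p(1,2) upper_part_even[OF k' b t t0] lower_part[OF k' t]])
  from Jt_eq[OF this] show "Jt t = - Sfun m t (psi (Suc m) t - \<alpha>)"
    "(supp t has_integral Jt t) {0..\<alpha>}" by simp_all
qed

lemma Jt_top_odd:
  assumes n: "odd n" and k: "Suc m = kmax n" and t: "ell n r (Suc m) \<le> t" "lam n r < t" "t \<le> ell n r (Suc (Suc m))"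
  shows "Jt t = Sfun (Suc m) t (arcsin (lam n r / t) - beta (Suc m)) - Sfun (Suc m) t (pi - arcsin (lam n r / t) - beta (Suc m))
     + Sfun (Suc m) t (psi (Suc m) t) - Sfun m t (psi (Suc m) t - \<alpha>)"
    "(supp t has_integral Jt t) {0..\<alpha>}"
proof -
  have k': "Suc m \<le> kmax n" using k by simp
  have t0: "t > 0" using ell_nonneg(4)[OF k'] t by simp
  note p = psi_props[OF k' t(1,3) t0]
  have "((\<lambda>\<psi>. supp t (\<psi> - real (Suc m) * \<alpha>)) has_integral
    (Sfun (Suc m) t (arcsin (lam n r / t) - beta (Suc m)) - Sfun (Suc m) t (pi - arcsin (lam n r / t) - beta (Suc m))
     + Sfun (Suc m) t (psi (Suc m) t) + - Sfun m t (psi (Suc m) t - \<alpha>))) {0..\<alpha>}"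
    by (rule has_integral_combine[OF p(1,2) upper_part_odd[OF odd_kmax[OF n k] t(2,3,1)] lower_part[OF k' t(1,3)]])
  from Jt_eq[OF this] show "Jt t = Sfun (Suc m) t (arcsin (lam n r / t) - beta (Suc m)) - Sfun (Suc m) t (pi - arcsin (lam n r / t) - beta (Suc m))
     + Sfun (Suc m) t (psi (Suc m) t) - Sfun m t (psi (Suc m) t - \<alpha>)"
    "(supp t has_integral Jt t) {0..\<alpha>}" by simp_all
qed

lemma Jt_top_triangle:
  assumes n: "n = 3" and t: "lam n r < t" "t \<le> ell n r 1"
  shows "Jt t = Sfun 0 t (arcsin (lam n r / t) - beta 0) - Sfun 0 t (pi - arcsin (lam n r / t) - beta 0) + Sfun 0 t \<alpha>"
    "(supp t has_integral Jt t) {0..\<alpha>}"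
proof -
  have n': "n = 2 * 0 + 3" using n by simp
  have lam0: "0 \<le> lam n r" using r0 by (simp add: lam_def)
  have "((\<lambda>\<psi>. supp t (\<psi> - real 0 * \<alpha>)) has_integral
    (Sfun 0 t (arcsin (lam n r / t) - beta 0) - Sfun 0 t (pi - arcsin (lam n r / t) - beta 0) + Sfun 0 t (psi 0 t))) {0..psi 0 t}"
    using t lam0 by (intro upper_part_odd[OF n']) (auto simp: ell_0)
  from Jt_eq[OF this[unfolded psi_0]]
  show "Jt t = Sfun 0 t (arcsin (lam n r / t) - beta 0) - Sfun 0 t (pi - arcsin (lam n r / t) - beta 0) + Sfun 0 t \<alpha>"
    "(supp t has_integral Jt t) {0..\<alpha>}" .
qed

text \<open>Evaluated in the top sector. For even n the diameter is 2 r. For odd n it is 2 r cos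
  (\<alpha> / 2), and sin (\<open>beta (kmax n)\<close> + x) >= cos (\<alpha> / 2) on the whole
  sector, so that a longer chord would extend beyond \<lambda>.\<close>

lemma supp_far:
  assumes t: "ell n r (kmax n + 1) < t"
  shows "Jt t = 0" "(supp t has_integral Jt t) {0..\<alpha>}"
proof -
  have z: "supp t (x - real (kmax n) * \<alpha>) = 0" if x: "x \<in> {0..\<alpha>}" for x
  proof (cases "even n")
    case True
    then have "beta (kmax n) = pi / 2" unfolding beta_le_pi2_iff using even_kmax(1)[OF True refl] by simp
    then have "sin (beta (kmax n)) = 1" by (simp only: sin_pi_half)
    then have "2 * r < t" using t by (simp add: ell_Suc)
    then show ?thesis by (rule supp_empty_far)
  next
    case False
    note top = odd_top[OF odd_kmax[OF False refl]]
    have c: "cos (\<alpha> / 2) > 0" using alpha_pos alpha_less_pi2 by (intro cos_gt_zero_pi) auto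
    have e: "2 * r * cos (\<alpha> / 2) < t" using t by (simp add: ell_Suc top(4))
    have t0: "t > 0" using e c r0 by (smt (verit) mult_pos_pos)
    have "cos (\<alpha> / 2) \<le> sin (beta (kmax n) + x)"
    proof -
      have "cos (\<alpha> / 2) \<le> cos \<bar>x - \<alpha> / 2\<bar>"
      proof (rule cos_monotone_0_pi_le)
        show "\<bar>x - \<alpha> / 2\<bar> \<le> \<alpha> / 2" using x unfolding abs_le_iff by (simp add: field_simps)
        show "\<alpha> / 2 \<le> pi" using alpha_less_pi2 alpha_pos by linarith
      qed simp
      also have "\<dots> = cos (pi / 2 - (beta (kmax n) + x))" 
        unfolding top(1) by (simp add: abs_if cos_minus[of "x - \<alpha> / 2", symmetric] del: cos_minus)
      also have "\<dots> = sin (beta (kmax n) + x)" by (simp add: sin_cos_eq)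
      finally show ?thesis .
    qed
    then have "t * cos (\<alpha> / 2) \<le> t * sin (beta (kmax n) + x)" using t0 by simp
    moreover have "lam n r < t * cos (\<alpha> / 2)"
      using mult_strict_right_mono[OF e c] by (simp add: lam_def power2_eq_square)
    ultimately show ?thesis by (intro supp_empty_odd) simp
  qed
  have "((\<lambda>\<psi>. supp t (\<psi> - real (kmax n) * \<alpha>)) has_integral 0) {0..\<alpha>}"
    using has_integral_cong[of "{0..\<alpha>}" "\<lambda>\<psi>. supp t (\<psi> - real (kmax n) * \<alpha>)" "\<lambda>_. 0"] z by simp
  from Jt_eq[OF this] show "Jt t = 0" "(supp t has_integral Jt t) {0..\<alpha>}" .
qed

section \<open>Position of \<lambda> among the lengths, and integrability\<close>

lemma ell_mono: "i \<le> j \<Longrightarrow> j \<le> kmax n + 1 \<Longrightarrow> ell n r i \<le> ell n r j"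
  using ell_strict_mono[OF n3 r0, of i j] by (cases "i = j") auto

text \<open>Places the change of regime at \<lambda> inside the top strip.\<close>

lemma ell_less_lam:
  assumes "odd n" shows "ell n r (kmax n) < lam n r"
proof -
  define K where "K = kmax n"
  note top = odd_top[OF odd_kmax[OF assms refl], folded K_def]
  have c: "cos (\<alpha> / 2) > 0" "sin (\<alpha> / 2) > 0"
    using alpha_pos alpha_less_pi2 by (auto intro!: cos_gt_zero_pi sin_gt_zero)
  have "ell n r K = 2 * r * sin (beta K - \<alpha>)" unfolding ell_def kalpha ..
  also have "\<dots> = 2 * r * (cos (\<alpha> / 2) * cos \<alpha> - sin (\<alpha> / 2) * sin \<alpha>)" unfolding sin_diff top(4,5) ..
  also have "\<dots> < 2 * r * (cos (\<alpha> / 2) * cos (\<alpha> / 2))"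
  proof -
    have "cos \<alpha> \<le> cos (\<alpha> / 2)" using alpha_pos alpha_less_pi2 by (intro cos_monotone_0_pi_le) auto
    then have "cos (\<alpha> / 2) * cos \<alpha> \<le> cos (\<alpha> / 2) * cos (\<alpha> / 2)" using c by simp
    moreover have "sin (\<alpha> / 2) * sin \<alpha> > 0" using c sin_alpha_pos by simp
    ultimately show ?thesis using r0 by simp
  qed
  finally show ?thesis by (simp add: K_def lam_def power2_eq_square)
qed

text \<open>Consequently x >= \<lambda> in the bottom strip forces a triangle. For \<alpha> <= pi /
  4 one adds sin \<alpha> <= cos \<alpha> and sin \<alpha> < 1.\<close>

lemma ell_1_less_lam:
  assumes "n \<noteq> 3" shows "ell n r 1 < lam n r"
proof -
  have n4: "4 \<le> n" using assms n3 by simp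
  have "pi * 4 \<le> pi * real n" by (rule mult_left_mono) (use n4 in auto)
  then have a: "\<alpha> \<le> pi / 4" using n3 by (simp add: alpha_def field_simps)
  have "sin \<alpha> \<le> sin (pi / 4)" using a alpha_pos by (intro sin_monotone_2pi_le) auto
  moreover have "cos (pi / 4) \<le> cos \<alpha>" using a alpha_pos by (intro cos_monotone_0_pi_le) auto
  moreover have "sin (pi / 4) = cos (pi / 4)" by (simp add: sin_45 cos_45)
  moreover have "sin \<alpha> < 1"
    using sin_monotone_2pi[of \<alpha> "pi / 2"] alpha_pos alpha_less_pi2 by simp
  ultimately have "2 * sin \<alpha> < 1 + cos \<alpha>" by linarith
  also have "1 + cos \<alpha> = 2 * (cos (\<alpha> / 2))\<^sup>2" using cos_double_cos[of "\<alpha> / 2"] by simp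
  finally have "r * (2 * sin \<alpha>) < r * (2 * (cos (\<alpha> / 2))\<^sup>2)" by (rule mult_strict_left_mono[OF _ r0])
  then show ?thesis by (simp add: ell_def lam_def mult_ac)
qed

lemma lam_pos: "lam n r > 0"
proof -
  have "cos (\<alpha> / 2) > 0" using alpha_pos alpha_less_pi2 by (intro cos_gt_zero_pi) auto
  then show ?thesis using r0 by (simp add: lam_def)
qed

text \<open>The single length \<lambda> left out is a null set in the later integrals over
  t.\<close>

lemma supp_integrable:
  assumes t: "0 < t" "t \<noteq> lam n r"
  shows "(supp t has_integral Jt t) {0..\<alpha>}"
proof (cases "t < ell n r (kmax n + 1)")
  case False
  show ?thesis
  proof (cases "t = ell n r (kmax n + 1)")
    case False
    with \<open>\<not> t < _\<close> show ?thesis by (intro supp_far(2)) simp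
  next
    case te: True
    have le: "ell n r (kmax n) \<le> t" unfolding te by (intro ell_mono) auto
    show ?thesis
    proof (cases "kmax n")
      case 0
      then have n: "n = 3" using n3 by (simp add: kmax_def)
      from le t te 0 n show ?thesis
        using Jt_bottom(2)[of t] Jt_top_triangle(2)[OF n, of t] by (cases "t < lam n r") auto
    next
      case (Suc m)
      from le t te Suc show ?thesis
        using Jt_top_even(2)[of m t] Jt_top_odd(2)[of m t] Jt_middle(2)[of m t]
        by (cases "even n"; cases "t < lam n r") auto
    qed
  qed
next
  case True
  from ell_index_ex1[OF n3 r0 _ True] t obtain k where k: "k \<le> kmax n" "ell n r k \<le> t" "t < ell n r (k + 1)"
    by auto
  show ?thesis
  proof (cases k)
    case 0
    show ?thesis
    proof (cases "n = 3 \<and> lam n r < t")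
      case True
      then show ?thesis using k 0 by (intro Jt_top_triangle(2)) auto
    next
      case False
      then show ?thesis using k 0 t by (intro Jt_bottom(2)) auto
    qed
  next
    case (Suc m)
    consider "even n" "k = kmax n" | "odd n" "k = kmax n" "lam n r < t"
      | "odd n \<or> k < kmax n" "odd n \<Longrightarrow> k = kmax n \<Longrightarrow> t \<le> lam n r"
      using k(1) by force
    then show ?thesis
    proof cases
      case 1 then show ?thesis using k Suc by (intro Jt_top_even(2)[of m]) auto
    next
      case 2 then show ?thesis using k Suc by (intro Jt_top_odd(2)[of m]) auto
    next
      case 3 then show ?thesis using k Suc by (intro Jt_middle(2)[of m]) auto
    qed
  qed
qed

section \<open>Integration over the lengths\<close>

lemma Jt_has_integral:
  assumes "l \<le> u" "continuous_on {l..u} H" "\<And>t. l < t \<Longrightarrow> t < u \<Longrightarrow> (H has_real_derivative 2 * Jt t) (at t)"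
  shows "((\<lambda>t. 2 * Jt t) has_integral H u - H l) {l..u}"
  using assms
  by (intro fundamental_theorem_of_calculus_interior) (auto simp: has_real_derivative_iff_has_vector_derivative[symmetric])

text \<open>The subtracted boundary values in \<open>J_flat\<close> make its pieces fit together
  continuously at \<lambda>. The right end x = \<open>ell n r (Suc k)\<close> is included because
  the sum in \<open>phi_flat\<close> evaluates there.\<close>

lemma J_flat_has_integral:
  assumes k: "k \<le> kmax n" and x: "ell n r k \<le> x" "x \<le> ell n r (Suc k)"
  shows "((\<lambda>t. 2 * Jt t) has_integral J_flat n r k x) {ell n r k..x}"
proof (cases k)
  case 0
  have H0c: "continuous_on S (H0 n r 0)" for S unfolding H0_def[abs_def] by (intro continuous_intros) auto
  have H00: "H0 n r 0 0 = 0" by (simp add: H0_def)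
  have bot: "((\<lambda>t. 2 * Jt t) has_integral H0 n r 0 u) {0..u}"
    if u: "0 \<le> u" "u \<le> ell n r 1" "n = 3 \<Longrightarrow> u \<le> lam n r" for u
  proof -
    have "((\<lambda>t. 2 * Jt t) has_integral H0 n r 0 u - H0 n r 0 0) {0..u}"
    proof (rule Jt_has_integral[OF u(1) H0c])
      fix t assume "0 < t" "t < u"
      then have "Jt t = Sfun 0 t \<alpha>" using u by (intro Jt_bottom(1)) auto
      then show "(H0 n r 0 has_real_derivative 2 * Jt t) (at t)" using H0_deriv by simp
    qed
    then show ?thesis by (simp add: H00)
  qed
  show ?thesis
  proof (cases "x < lam n r")
    case True
    have "((\<lambda>t. 2 * Jt t) has_integral H0 n r 0 x) {0..x}"
      by (rule bot) (use x True 0 in \<open>auto simp: ell_0\<close>)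
    then show ?thesis using True unfolding 0 by (simp add: J_flat_def ell_0)
  next
    case False
    then have n: "n = 3" using ell_1_less_lam x 0 by fastforce
    have J: "J_flat n r k x = H0 n r 0 (lam n r) + (H3 n r 0 x - H3 n r 0 (lam n r))"
      using False 0 n by (simp add: J_flat_def)
    have "((\<lambda>t. 2 * Jt t) has_integral H3 n r 0 x - H3 n r 0 (lam n r)) {lam n r..x}"
    proof (rule Jt_has_integral)
      show "lam n r \<le> x" using False by simp
      show "continuous_on {lam n r..x} (H3 n r 0)"
        unfolding H3_def[abs_def] using lam_pos
        by (intro continuous_intros continuous_on_sigma1 continuous_on_tau_m1) (auto simp: hh_0)
      fix t assume "lam n r < t" "t < x"
      then show "(H3 n r 0 has_real_derivative 2 * Jt t) (at t)"
        using Jt_top_triangle(1)[OF n, of t] H3_deriv_triangle[OF n, of t] x 0 by simp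
    qed
    moreover have "((\<lambda>t. 2 * Jt t) has_integral H0 n r 0 (lam n r)) {0..lam n r}"
      using False x lam_pos 0 by (intro bot) auto
    ultimately have "((\<lambda>t. 2 * Jt t) has_integral H0 n r 0 (lam n r) + (H3 n r 0 x - H3 n r 0 (lam n r))) {0..x}"
      using False lam_pos by (intro has_integral_combine[of 0 "lam n r" x]) auto
    then show ?thesis unfolding J[unfolded 0] 0 ell_0 .
  qed
next
  case (Suc m)
  have k': "Suc m \<le> kmax n" using k Suc by simp
  have l0: "ell n r (Suc m) > 0" using ell_nonneg(4)[OF k'] by simp
  have hl: "0 \<le> hh n r (Suc m)" "hh n r (Suc m) \<le> ell n r (Suc m)"
  proof -
    show "0 \<le> hh n r (Suc m)" by (rule ell_nonneg(2)[OF k'])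
    have "hh n r (Suc m) \<le> ell n r (Suc m) * 1"
      unfolding ell_nonneg(3)[OF k'] using l0 by (intro mult_left_mono) auto
    then show "hh n r (Suc m) \<le> ell n r (Suc m)" by simp
  qed
  have n3': "n \<noteq> 3"
  proof
    assume "n = 3"
    then have "kmax n = 0" by (simp add: kmax_def)
    with k' show False by simp
  qed
  have mid_int: "((\<lambda>t. 2 * Jt t) has_integral H1 n r (Suc m) u - H1 n r (Suc m) (ell n r (Suc m))) {ell n r (Suc m)..u}"
    if u: "ell n r (Suc m) \<le> u" "u \<le> ell n r (Suc (Suc m))" "odd n \<or> Suc m < kmax n"
      "odd n \<Longrightarrow> Suc m = kmax n \<Longrightarrow> u \<le> lam n r" for u
  proof (rule Jt_has_integral[OF u(1)])
    show "continuous_on {ell n r (Suc m)..u} (H1 n r (Suc m))"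
      unfolding H1_def[abs_def]
      by (intro continuous_intros continuous_on_sigma1[OF hl l0] continuous_on_tau_m1[OF hl l0]) auto
    fix t assume t: "ell n r (Suc m) < t" "t < u"
    have "Jt t = Sfun (Suc m) t (psi (Suc m) t) - Sfun m t (psi (Suc m) t - \<alpha>)"
      by (rule Jt_middle(1)[OF k' u(3)]) (use t u in auto)
    then show "(H1 n r (Suc m) has_real_derivative 2 * Jt t) (at t)"
      using H1_deriv[OF n3' k' beta_less_pi2[OF k' u(3)] t(1)] by simp
  qed
  consider (top_even) "even n" "k = kmax n" | (top_odd) "odd n" "k = kmax n" "lam n r \<le> x"
    | (mid) "odd n \<or> k < kmax n" "odd n \<Longrightarrow> k = kmax n \<Longrightarrow> x < lam n r"
    using k by force
  then show ?thesis
  proof cases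
    case mid
    \<comment> \<open>For odd n and k >= 1 the case distinction in \<open>J_flat\<close> tests x <
      \<lambda> in every strip. Below the top strip the test succeeds because the strip ends at or
      before \<open>ell n r (kmax n)\<close>.\<close>
    have "x < lam n r" if "odd n"
    proof (cases "k = kmax n")
      case False
      then have "x \<le> ell n r (kmax n)" using x(2) k ell_mono[of "Suc k" "kmax n"] by simp
      then show ?thesis using ell_less_lam[OF that] by simp
    qed (use mid that in simp)
    with mid Suc k have J: "J_flat n r k x = H1 n r (Suc m) x - H1 n r (Suc m) (ell n r (Suc m))"
      by (auto simp: J_flat_def)
    show ?thesis
      unfolding J[unfolded Suc] Suc
      by (rule mid_int) (use x mid Suc in auto)
  next
    case top_even
    have J: "J_flat n r k x = H2 n r (Suc m) x - H2 n r (Suc m) (ell n r (Suc m))"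
      using top_even Suc by (auto simp: J_flat_def)
    have "((\<lambda>t. 2 * Jt t) has_integral H2 n r (Suc m) x - H2 n r (Suc m) (ell n r (Suc m))) {ell n r (Suc m)..x}"
    proof (rule Jt_has_integral)
      show "continuous_on {ell n r (Suc m)..x} (H2 n r (Suc m))"
        unfolding H2_def[abs_def]
        using l0 by (intro continuous_intros continuous_on_sigma1[OF hl l0] continuous_on_tau_m1[OF hl l0]) auto
      fix t assume t: "ell n r (Suc m) < t" "t < x"
      have "Jt t = - Sfun m t (psi (Suc m) t - \<alpha>)"
        by (rule Jt_top_even(1)) (use t x Suc top_even in auto)
      then show "(H2 n r (Suc m) has_real_derivative 2 * Jt t) (at t)"
        using H2_deriv[OF k' t(1)] by simp
    qed (use x Suc in auto)
    then show ?thesis unfolding J[unfolded Suc] Suc .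
  next
    case top_odd
    have Km: "Suc m = kmax n" using top_odd Suc by simp
    have ll: "ell n r (Suc m) < lam n r" using ell_less_lam[OF top_odd(1)] Km by simp
    have J: "J_flat n r k x = (H1 n r (Suc m) (lam n r) - H1 n r (Suc m) (ell n r (Suc m)))
        + (H3 n r (Suc m) x - H3 n r (Suc m) (lam n r))"
      using top_odd Suc n3 n3' by (auto simp: J_flat_def)
    have "((\<lambda>t. 2 * Jt t) has_integral H3 n r (Suc m) x - H3 n r (Suc m) (lam n r)) {lam n r..x}"
    proof (rule Jt_has_integral)
      show "continuous_on {lam n r..x} (H3 n r (Suc m))"
        unfolding H3_def[abs_def] using lam_pos hl ll
        by (intro continuous_intros continuous_on_sigma1 continuous_on_tau_m1) auto
      fix t assume t: "lam n r < t" "t < x"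
      have "Jt t = Sfun (Suc m) t (arcsin (lam n r / t) - beta (Suc m)) - Sfun (Suc m) t (pi - arcsin (lam n r / t) - beta (Suc m))
         + Sfun (Suc m) t (psi (Suc m) t) - Sfun m t (psi (Suc m) t - \<alpha>)"
        by (rule Jt_top_odd(1)[OF top_odd(1) Km]) (use t x Suc ll in auto)
      then show "(H3 n r (Suc m) has_real_derivative 2 * Jt t) (at t)"
        using H3_deriv[OF odd_kmax[OF top_odd(1) Km] t(1)] t ll by simp
    qed (use top_odd in auto)
    moreover have "((\<lambda>t. 2 * Jt t) has_integral H1 n r (Suc m) (lam n r) - H1 n r (Suc m) (ell n r (Suc m)))
        {ell n r (Suc m)..lam n r}"
      by (rule mid_int) (use ll top_odd x Suc in auto)
    ultimately show ?thesis
      unfolding J[unfolded Suc] Suc using ll top_odd by (intro has_integral_combine[of "ell n r (Suc m)" "lam n r" x]) auto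
  qed
qed

lemma phi_flat_has_integral_aux:
  assumes "k \<le> kmax n" "ell n r k \<le> x" "x \<le> ell n r (Suc k)"
  shows "((\<lambda>t. 2 * Jt t) has_integral ((\<Sum>\<nu><k. J_flat n r \<nu> (ell n r (\<nu> + 1))) + J_flat n r k x)) {0..x}"
  using assms
proof (induction k arbitrary: x)
  case 0
  then show ?case using J_flat_has_integral[of 0 x] by (simp add: ell_0)
next
  case (Suc k)
  have "((\<lambda>t. 2 * Jt t) has_integral ((\<Sum>\<nu><k. J_flat n r \<nu> (ell n r (\<nu> + 1))) + J_flat n r k (ell n r (Suc k)))) {0..ell n r (Suc k)}"
    using Suc.prems by (intro Suc.IH ell_mono) auto
  moreover have "((\<lambda>t. 2 * Jt t) has_integral J_flat n r (Suc k) x) {ell n r (Suc k)..x}"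
    using Suc.prems by (intro J_flat_has_integral)
  ultimately have "((\<lambda>t. 2 * Jt t) has_integral (((\<Sum>\<nu><k. J_flat n r \<nu> (ell n r (\<nu> + 1))) + J_flat n r k (ell n r (Suc k)))
     + J_flat n r (Suc k) x)) {0..x}"
    using Suc.prems ell_nonneg(1) by (intro has_integral_combine[of 0 "ell n r (Suc k)" x]) auto
  then show ?case by simp
qed

lemma phi_flat_has_integral:
  assumes "0 \<le> x" "x < ell n r (kmax n + 1)"
  shows "((\<lambda>t. 2 * Jt t) has_integral phi_flat n r x) {0..x}"
proof -
  from theI'[OF ell_index_ex1[OF n3 r0 assms]]
  have "ell_index n r x \<le> kmax n \<and> ell n r (ell_index n r x) \<le> x \<and> x < ell n r (ell_index n r x + 1)"
    unfolding ell_index_def .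
  then show ?thesis
    unfolding phi_flat_def Let_def by (intro phi_flat_has_integral_aux) auto
qed

text \<open>The value of \<phi> at the diameter. It is never evaluated from the closed form;
  \<open>n_Phi\<close> determines it by comparing areas.\<close>

definition Phi :: real where "Phi = integral {0..ell n r (kmax n + 1)} (\<lambda>t. 2 * Jt t)"

lemma Phi_has_integral: "((\<lambda>t. 2 * Jt t) has_integral Phi) {0..ell n r (kmax n + 1)}"
proof -
  have "ell n r (kmax n) \<le> ell n r (Suc (kmax n))" by (rule ell_mono) auto
  from phi_flat_has_integral_aux[OF order_refl this order_refl]
  have "(\<lambda>t. 2 * Jt t) integrable_on {0..ell n r (Suc (kmax n))}" by (rule has_integral_integrable)
  then show ?thesis unfolding Phi_def Suc_eq_plus1 by (rule integrable_integral)
qed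

lemma Phi_minus_phi_flat:
  assumes "0 \<le> x" "x < ell n r (kmax n + 1)"
  shows "((\<lambda>t. 2 * Jt t) has_integral (Phi - phi_flat n r x)) {x..ell n r (kmax n + 1)}"
proof -
  have i: "(\<lambda>t. 2 * Jt t) integrable_on {0..ell n r (kmax n + 1)}"
    using Phi_has_integral by blast
  then have i': "(\<lambda>t. 2 * Jt t) integrable_on {x..ell n r (kmax n + 1)}"
    by (rule integrable_subinterval_real) (use assms in auto)
  have "integral {0..x} (\<lambda>t. 2 * Jt t) + integral {x..ell n r (kmax n + 1)} (\<lambda>t. 2 * Jt t) = Phi"
    unfolding Phi_def by (rule Henstock_Kurzweil_Integration.integral_combine[OF _ _ i]) (use assms in auto)
  moreover have "integral {0..x} (\<lambda>t. 2 * Jt t) = phi_flat n r x"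
    by (rule integral_unique[OF phi_flat_has_integral[OF assms]])
  ultimately have "integral {x..ell n r (kmax n + 1)} (\<lambda>t. 2 * Jt t) = Phi - phi_flat n r x" by simp
  with integrable_integral[OF i'] show ?thesis by simp
qed

end

section \<open>The distance distribution\<close>

text \<open>The bridge from gauge integrals to nonnegative Lebesgue integrals. Measurability comes
  from g, which is an integral or a measure of sections, and is transferred to the integrand f off
  the finite set S.\<close>

lemma nn_integral_has_integral_interval:
  fixes g :: "real \<Rightarrow> ennreal" and f :: "real \<Rightarrow> real"
  assumes g[measurable]: "g \<in> borel_measurable borel" and S: "finite S"
    and I: "(f has_integral I) {a..b}"
    and eq: "\<And>x. a < x \<Longrightarrow> x < b \<Longrightarrow> x \<notin> S \<Longrightarrow> 0 \<le> f x \<and> g x = ennreal (f x)"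
    and out: "\<And>x. x \<notin> S \<Longrightarrow> x \<le> a \<or> b \<le> x \<Longrightarrow> g x = 0"
  shows "(\<integral>\<^sup>+x. g x \<partial>lborel) = ennreal I"
proof -
  define h where "h x = enn2real (g x * indicator ({a<..<b} - S) x)" for x
  have [measurable]: "S \<in> sets borel" using S by (simp add: finite_imp_closed)
  have hm: "h \<in> borel_measurable borel" unfolding h_def by measurable
  have hx: "h x = (if x \<in> {a<..<b} - S then f x else 0)" for x
    using eq[of x] by (auto simp: h_def)
  have "(h has_integral I) {a..b}"
    by (rule has_integral_spike_finite[of "S \<union> {a, b}" _ _ f]) (use S I in \<open>auto simp: hx\<close>)
  then have "((\<lambda>x. if x \<in> {a..b} then h x else 0) has_integral I) UNIV"
    by (simp only: has_integral_restrict_UNIV)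
  moreover have "(\<lambda>x. if x \<in> {a..b} then h x else 0) = h" by (auto simp: hx fun_eq_iff)
  ultimately have "(\<integral>\<^sup>+x. h x \<partial>lborel) = ennreal I"
    by (intro nn_integral_has_integral_lborel[OF hm]) (simp_all add: h_def)
  moreover have "(\<integral>\<^sup>+x. g x \<partial>lborel) = (\<integral>\<^sup>+x. h x \<partial>lborel)"
  proof (rule nn_integral_cong_AE)
    have "AE x in lborel. x \<notin> S" by (rule AE_not_in[OF finite_imp_null_set_lborel[OF S]])
    then show "AE x in lborel. g x = ennreal (h x)"
    proof eventually_elim
      case (elim x)
      show ?case
      proof (cases "a < x \<and> x < b")
        case True
        then show ?thesis using eq[of x] elim by (simp add: hx)
      next
        case False
        then show ?thesis using out[of x] elim by (auto simp: hx)
      qed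
    qed
  qed
  ultimately show ?thesis by simp
qed

context regular_ngon
begin

section \<open>Area of the polygon\<close>

lemma P_borel[measurable]: "P \<in> sets borel"
  using compact_P by (rule borel_compact)

text \<open>The centre is the mean of the vertices, whose sum is a geometric sum over powers of a
  root of unity.\<close>

lemma zero_in_P: "0 \<in> P"
proof -
  define w where "w = cis (2 * \<alpha>)"
  have v: "vert j = of_real r * w ^ j" for j
  proof -
    have "2 * real j * \<alpha> = real j * (2 * \<alpha>)" by simp
    then show ?thesis by (simp only: vert_def w_def Complex.DeMoivre)
  qed
  have "Im w \<noteq> 0" unfolding w_def using sin_2alpha by simp
  then have w1: "w \<noteq> 1" by auto
  have e: "real n * (2 * \<alpha>) = 2 * pi" using n_alpha by simp
  have wn: "w ^ n = 1" unfolding w_def Complex.DeMoivre e by simp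
  have "(\<Sum>j<n. (1 / real n) *\<^sub>R vert j) \<in> P"
  proof (rule convex_sum[OF _ convex_P])
    show "(\<Sum>j<n. 1 / real n) = 1" using n3 by simp
    show "vert j \<in> P" if "j \<in> {..<n}" for j unfolding P_eq using that by (intro hull_inc) auto
  qed auto
  also have "(\<Sum>j<n. (1 / real n) *\<^sub>R vert j) = (1 / real n) *\<^sub>R (of_real r * (\<Sum>j<n. w ^ j))"
    by (simp add: v scaleR_sum_right sum_distrib_left)
  also have "(\<Sum>j<n. w ^ j) = 0" unfolding geometric_sum[OF w1] wn by simp
  finally show ?thesis by simp
qed

text \<open>In this half sector the boundary is the edge with normal \<alpha>, met at radius r cos
  \<alpha> / cos (\<phi> - \<alpha>). Smaller radii follow by convexity with the centre.\<close>

lemma polar_P: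
  assumes \<phi>: "0 \<le> \<phi>" "\<phi> \<le> \<alpha>" and \<rho>: "0 < \<rho>"
  shows "of_real \<rho> * cis \<phi> \<in> P \<longleftrightarrow> \<rho> \<le> r * cos \<alpha> / cos (\<phi> - \<alpha>)"
proof -
  have c: "cos (\<phi> - \<alpha>) > 0" using \<phi> alpha_less_pi2 by (intro cos_gt_zero_pi) auto
  define R where "R = r * cos \<alpha> / cos (\<phi> - \<alpha>)"
  have R0: "R > 0" unfolding R_def using c r0 cos_alpha_pos by simp
  show ?thesis
  proof
    assume "of_real \<rho> * cis \<phi> \<in> P"
    from halfplane_P[OF this] have "\<rho> * cos (\<phi> - \<alpha>) \<le> r * cos \<alpha>"
      by (simp add: cos_diff algebra_simps)
    then show "\<rho> \<le> r * cos \<alpha> / cos (\<phi> - \<alpha>)" using c by (simp add: le_divide_eq)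
  next
    assume "\<rho> \<le> r * cos \<alpha> / cos (\<phi> - \<alpha>)"
    then have le: "\<rho> \<le> R" unfolding R_def .
    have "tan (\<alpha> - \<phi>) \<le> tan \<alpha>" "0 \<le> tan (\<alpha> - \<phi>)"
      using \<phi> alpha_less_pi2 alpha_pos tan_mono_le[of "\<alpha> - \<phi>" \<alpha>] tan_mono_le[of 0 "\<alpha> - \<phi>"] by auto
    then have "\<bar>tan (\<phi> - \<alpha>)\<bar> \<le> tan \<alpha>" using tan_minus[of "\<alpha> - \<phi>"] by simp
    then have "r * cos \<alpha> * \<bar>tan (\<phi> - \<alpha>)\<bar> \<le> r * cos \<alpha> * tan \<alpha>"
      using r0 cos_alpha_pos by (intro mult_left_mono) auto
    then have "\<bar>r * cos \<alpha> * tan (\<phi> - \<alpha>)\<bar> \<le> r * sin \<alpha>"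
      using r0 cos_alpha_pos by (simp add: abs_mult tan_def)
    moreover have "of_real r * cis (\<alpha> + \<alpha>) \<in> (*) (cis 0) ` P" "of_real r * cis (\<alpha> - \<alpha>) \<in> (*) (cis 0) ` P"
      using vertex_in_P[of 1] vertex_in_P[of 0] by simp_all
    ultimately have "Complex (r * cos \<alpha>) (r * cos \<alpha> * tan (\<phi> - \<alpha>)) * cis \<alpha> \<in> (*) (cis 0) ` P"
      by (intro edge_in_rotated_P)
    then have "Complex (r * cos \<alpha>) (r * cos \<alpha> * tan (\<phi> - \<alpha>)) * cis \<alpha> \<in> P" by simp
    moreover have "Complex (r * cos \<alpha>) (r * cos \<alpha> * tan (\<phi> - \<alpha>)) = of_real R * cis (\<phi> - \<alpha>)"
      unfolding R_def tan_def using c by (simp add: complex_eq_iff)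
    ultimately have RP: "of_real R * cis \<phi> \<in> P" by (simp add: mult.assoc cis_mult)
    have "(\<rho> / R) *\<^sub>R (of_real R * cis \<phi>) + (1 - \<rho> / R) *\<^sub>R 0 \<in> P"
      by (rule convexD[OF convex_P RP zero_in_P]) (use R0 le \<rho> in auto)
    also have "(\<rho> / R) *\<^sub>R (of_real R * cis \<phi>) + (1 - \<rho> / R) *\<^sub>R 0 = of_real \<rho> * cis \<phi>"
      using R0 by (simp add: scaleR_conv_of_real)
    finally show "of_real \<rho> * cis \<phi> \<in> P" .
  qed
qed

text \<open>The radial integral is R^2 / 2, a multiple of the derivative of tan (\<phi> - \<alpha>)
  on one half sector. The real-valued copy q of Q makes the dihedral lemma applicable and brings in
  all 2 n half sectors.\<close>

lemma emeasure_P: "emeasure lborel P = ennreal (area n r)"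
proof -
  define Q where "Q \<phi> = (\<integral>\<^sup>+\<rho>. indicator {0<..} \<rho> * (ennreal \<rho> * indicator P (of_real \<rho> * cis \<phi>)) \<partial>lborel)" for \<phi>
  have Qm[measurable]: "Q \<in> borel_measurable borel" unfolding Q_def by measurable
  define q where "q \<phi> = enn2real (Q \<phi>)" for \<phi>
  have Qfin: "Q \<phi> < \<infinity>" for \<phi>
  proof -
    have "Q \<phi> \<le> (\<integral>\<^sup>+\<rho>. ennreal r * indicator {0..r} \<rho> \<partial>lborel)"
      unfolding Q_def
    proof (rule nn_integral_mono)
      fix \<rho> :: real
      show "indicator {0<..} \<rho> * (ennreal \<rho> * indicator P (of_real \<rho> * cis \<phi>)) \<le> ennreal r * indicator {0..r} \<rho>"
        using norm_P[of "of_real \<rho> * cis \<phi>"] by (auto simp: indicator_def norm_mult ennreal_leI)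
    qed
    also have "\<dots> < \<infinity>" using r0 by (simp add: nn_integral_cmult ennreal_mult_less_top)
    finally show ?thesis .
  qed
  have per: "q (\<phi> + 2 * \<alpha>) = q \<phi>" for \<phi>
  proof -
    have "of_real \<rho> * cis (\<phi> + 2 * \<alpha>) \<in> P \<longleftrightarrow> of_real \<rho> * cis \<phi> \<in> P" for \<rho>
      using rotate_P_iff[of 1 "of_real \<rho> * cis \<phi>"]
      by (simp add: mult.left_commute cis_mult add.commute)
    then show ?thesis unfolding q_def Q_def by (simp add: indicator_def)
  qed
  have even: "q (- \<phi>) = q \<phi>" for \<phi>
  proof -
    have "of_real \<rho> * cis (- \<phi>) \<in> P \<longleftrightarrow> of_real \<rho> * cis \<phi> \<in> P" for \<rho>
      using cnj_P_iff[of "of_real \<rho> * cis \<phi>"] by (simp add: cis_cnj)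
    then show ?thesis unfolding q_def Q_def by (simp add: indicator_def)
  qed
  have qR: "q \<phi> = (r * cos \<alpha>)\<^sup>2 / 2 * inverse ((cos (\<phi> - \<alpha>))\<^sup>2)" if \<phi>: "\<phi> \<in> {0..\<alpha>}" for \<phi>
  proof -
    define R where "R = r * cos \<alpha> / cos (\<phi> - \<alpha>)"
    have c: "cos (\<phi> - \<alpha>) > 0" using \<phi> alpha_less_pi2 by (intro cos_gt_zero_pi) auto
    have R0: "R > 0" unfolding R_def using c r0 cos_alpha_pos by simp
    have "Q \<phi> = (\<integral>\<^sup>+\<rho>. ennreal \<rho> * indicator {0..R} \<rho> \<partial>lborel)"
      unfolding Q_def
    proof (rule nn_integral_cong)
      fix \<rho> :: real
      show "indicator {0<..} \<rho> * (ennreal \<rho> * indicator P (of_real \<rho> * cis \<phi>)) = ennreal \<rho> * indicator {0..R} \<rho>"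
        using polar_P[of \<phi> \<rho>] \<phi> by (cases "\<rho> > 0") (auto simp: indicator_def R_def)
    qed
    also have "\<dots> = ennreal (R\<^sup>2 / 2 - 0\<^sup>2 / 2)"
      by (rule nn_integral_FTC_Icc) (use R0 in \<open>auto intro!: derivative_eq_intros\<close>)
    finally have "q \<phi> = R\<^sup>2 / 2" unfolding q_def by simp
    then show ?thesis unfolding R_def power_divide by (simp add: inverse_eq_divide mult.commute)
  qed
  have "((\<lambda>\<phi>. (r * cos \<alpha>)\<^sup>2 / 2 * inverse ((cos (\<phi> - \<alpha>))\<^sup>2)) has_integral
      (r * cos \<alpha>)\<^sup>2 / 2 * tan (\<alpha> - \<alpha>) - (r * cos \<alpha>)\<^sup>2 / 2 * tan (0 - \<alpha>)) {0..\<alpha>}"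
  proof (rule fundamental_theorem_of_calculus)
    fix x assume "x \<in> {0..\<alpha>}"
    then have "cos (x - \<alpha>) \<noteq> 0" using alpha_less_pi2 cos_gt_zero_pi[of "x - \<alpha>"] by auto
    from DERIV_tan[OF this] have "((\<lambda>x. tan (x - \<alpha>)) has_real_derivative inverse ((cos (x - \<alpha>))\<^sup>2) * 1) (at x)"
      by (rule DERIV_chain2) (auto intro!: derivative_eq_intros)
    from DERIV_cmult[OF this, of "(r * cos \<alpha>)\<^sup>2 / 2"]
    show "((\<lambda>x. (r * cos \<alpha>)\<^sup>2 / 2 * tan (x - \<alpha>)) has_vector_derivative
        (r * cos \<alpha>)\<^sup>2 / 2 * inverse ((cos (x - \<alpha>))\<^sup>2)) (at x within {0..\<alpha>})"
      by (simp add: has_real_derivative_iff_has_vector_derivative has_vector_derivative_at_within)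
  qed (use alpha_pos in simp)
  also have "(r * cos \<alpha>)\<^sup>2 / 2 * tan (\<alpha> - \<alpha>) - (r * cos \<alpha>)\<^sup>2 / 2 * tan (0 - \<alpha>) = r\<^sup>2 * sin \<alpha> * cos \<alpha> / 2"
    using cos_alpha_pos by (simp add: tan_def power2_eq_square)
  finally have "(q has_integral r\<^sup>2 * sin \<alpha> * cos \<alpha> / 2) {0..\<alpha>}"
    by (subst has_integral_cong[where g = "\<lambda>\<phi>. (r * cos \<alpha>)\<^sup>2 / 2 * inverse ((cos (\<phi> - \<alpha>))\<^sup>2)"]) (rule qR)
  from dihedral_has_integral_period[of q, OF per even this, of "2 * n" 0]
  have "(q has_integral real (2 * n) * (r\<^sup>2 * sin \<alpha> * cos \<alpha> / 2)) {0..real (2 * n) * \<alpha>}"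
    by simp
  also have "real (2 * n) * \<alpha> = 2 * pi" using n_alpha by simp
  also have "real (2 * n) * (r\<^sup>2 * sin \<alpha> * cos \<alpha> / 2) = area n r"
    by (simp add: area_def sin_double)
  finally have I: "(q has_integral area n r) {0..2 * pi}" .
  have "emeasure lborel P = (\<integral>\<^sup>+z. indicator P z \<partial>lborel)" by simp
  also have "\<dots> = (\<integral>\<^sup>+\<rho>. indicator {0<..} \<rho> * (ennreal \<rho> *
       (\<integral>\<^sup>+\<phi>. indicator {0<..<2 * pi} \<phi> * indicator P (of_real \<rho> * cis \<phi>) \<partial>lborel)) \<partial>lborel)"
    by (rule nn_integral_polar) measurable
  also have "\<dots> = (\<integral>\<^sup>+\<rho>. \<integral>\<^sup>+\<phi>. indicator {0<..<2 * pi} \<phi> * (indicator {0<..} \<rho> * (ennreal \<rho> *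
       indicator P (of_real \<rho> * cis \<phi>))) \<partial>lborel \<partial>lborel)"
    by (simp add: nn_integral_cmult[symmetric] mult_ac)
  also have "\<dots> = (\<integral>\<^sup>+\<phi>. \<integral>\<^sup>+\<rho>. indicator {0<..<2 * pi} \<phi> * (indicator {0<..} \<rho> * (ennreal \<rho> *
       indicator P (of_real \<rho> * cis \<phi>))) \<partial>lborel \<partial>lborel)"
    by (rule lborel_pair.Fubini') measurable
  also have "\<dots> = (\<integral>\<^sup>+\<phi>. indicator {0<..<2 * pi} \<phi> * Q \<phi> \<partial>lborel)"
    unfolding Q_def by (simp add: nn_integral_cmult)
  also have "\<dots> = ennreal (area n r)"
    by (rule nn_integral_has_integral_interval[OF _ _ I, of _ "{}"])
       (use Qfin in \<open>auto simp: q_def indicator_def less_top[symmetric]\<close>)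
  finally show ?thesis .
qed

lemma area_pos: "area n r > 0"
  using sin_2alpha r0 n3 by (simp add: area_def)

section \<open>Integrals over all directions\<close>

text \<open>For odd n, pi is an odd multiple of \<alpha>, so the second summand is not the first one
  again. Its integral is that of \<open>supp\<close> over [pi, 3 pi], carried to [0, 2 pi] by the
  reflection \<phi> -> 3 pi - \<phi> and two full turns.\<close>

lemma supp_sum_has_integral:
  assumes "(supp t has_integral J) {0..\<alpha>}"
  shows "((\<lambda>\<phi>. supp t \<phi> + supp t (\<phi> + pi)) has_integral 4 * real n * J) {0..2 * pi}"
proof -
  note I = dihedral_has_integral_period[of "supp t", OF supp_periodic supp_even assms, of "2 * n"]
  have e: "real (n + 2 * n) * \<alpha> = 3 * pi" "real (0 + 2 * n) * \<alpha> = 2 * pi"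
    using n_alpha by (simp_all add: algebra_simps)
  from I[of 0] have 1: "(supp t has_integral real (2 * n) * J) {0..2 * pi}" unfolding e by simp
  from I[of n] have "(supp t has_integral real (2 * n) * J) {pi..3 * pi}" unfolding e n_alpha .
  from has_integral_reflect_at[OF this, of "3 * pi"]
  have "((\<lambda>\<phi>. supp t (3 * pi - \<phi>)) has_integral real (2 * n) * J) {0..2 * pi}" by simp
  moreover have "supp t (3 * pi - \<phi>) = supp t (\<phi> + pi)" for \<phi>
  proof -
    have "supp t (3 * pi - \<phi>) = supp t (- (3 * pi - \<phi>))" by (simp only: supp_even)
    also have "\<dots> = supp t (- (3 * pi - \<phi>) + 2 * real (2 * n) * \<alpha>)" by (simp only: supp_shift)
    also have "- (3 * pi - \<phi>) + 2 * real (2 * n) * \<alpha> = \<phi> + pi" using n_alpha by simp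
    finally show ?thesis .
  qed
  ultimately have "((\<lambda>\<phi>. supp t (\<phi> + pi)) has_integral real (2 * n) * J) {0..2 * pi}" by simp
  from has_integral_add[OF 1 this] show ?thesis by (simp add: algebra_simps)
qed

text \<open>\<open>supp\<close> itself can be negative: a side of a triangle, seen with reversed
  normal, is the only chord of its length. Only the sum over opposite directions, a width, is
  nonnegative, so the sign is read off from the full turn.\<close>

lemma Jt_nonneg: assumes "0 \<le> t" shows "0 \<le> Jt t"
proof (cases "supp t integrable_on {0..\<alpha>}")
  case True
  then have "(supp t has_integral Jt t) {0..\<alpha>}" unfolding Jt_def by (rule integrable_integral)
  from supp_sum_has_integral[OF this] have "0 \<le> 4 * real n * Jt t"
    by (rule has_integral_nonneg) (use emeasure_T(2) assms in auto)
  then show ?thesis using n3 by (simp add: zero_le_mult_iff)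
next
  case False
  \<comment> \<open>The integral of a function that is not integrable is 0 by convention.\<close>
  then show ?thesis unfolding Jt_def by (simp add: not_integrable_integral)
qed

definition Omega :: "real \<Rightarrow> ennreal" where
  "Omega t = (\<integral>\<^sup>+\<phi>. indicator {0<..<2 * pi} \<phi> * (indicator {0<..} t * emeasure lborel (T \<phi> t)) \<partial>lborel)"

lemma Omega_measurable[measurable]: "Omega \<in> borel_measurable borel"
proof -
  have "(\<lambda>(\<phi>, t). indicator {0<..<2 * pi} \<phi> * (indicator {0<..} t * emeasure lborel (T \<phi> t)))
      \<in> borel_measurable (lborel \<Otimes>\<^sub>M lborel)"
    using chord_measurable[OF compact_P] by (simp cong: measurable_cong_sets sets_pair_measure_cong)
  from measurable_pair_swap[OF this]
  show ?thesis unfolding Omega_def by (intro lborel.borel_measurable_nn_integral) (simp add: case_prod_beta)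
qed

lemma Omega_eq:
  assumes t: "0 < t" "t \<noteq> lam n r"
  shows "Omega t = ennreal (4 * real n * Jt t)"
  unfolding Omega_def
proof (rule nn_integral_has_integral_interval[OF _ _ supp_sum_has_integral[OF supp_integrable[OF t]], of _ "{}"])
  show "(\<lambda>\<phi>. indicator {0<..<2 * pi} \<phi> * (indicator {0<..} t * emeasure lborel (T \<phi> t))) \<in> borel_measurable borel"
    using measurable_compose[OF _ chord_measurable[OF compact_P], of "\<lambda>\<phi>. (\<phi>, t)" borel] by simp
  fix \<phi> :: real
  assume "0 < \<phi>" "\<phi> < 2 * pi"
  then show "0 \<le> supp t \<phi> + supp t (\<phi> + pi) \<and>
      indicator {0<..<2 * pi} \<phi> * (indicator {0<..} t * emeasure lborel (T \<phi> t)) = ennreal (supp t \<phi> + supp t (\<phi> + pi))"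
    using emeasure_T[of \<phi> t] t by simp
qed auto

text \<open>The factor \<i> is there because chords are indexed by the angle of their normal; a
  quarter turn removes it in \<open>nn_integral_norm_covariogram\<close>.\<close>

definition W :: "real \<Rightarrow> ennreal" where
  "W \<rho> = (\<integral>\<^sup>+\<phi>. indicator {0<..<2 * pi} \<phi> * covariogram P (of_real \<rho> * (\<i> * cis \<phi>)) \<partial>lborel)"

lemma W_measurable[measurable]: "W \<in> borel_measurable borel"
proof -
  note [measurable] = covariogram_measurable[OF P_borel]
  show ?thesis unfolding W_def by measurable
qed

lemma W_Omega:
  assumes "0 \<le> \<rho>"
  shows "W \<rho> = (\<integral>\<^sup>+t. indicator {\<rho><..} t * Omega t \<partial>lborel)"
proof -
  define G where "G \<phi> t = indicator {0<..<2 * pi} \<phi> * (indicator {0<..} t * emeasure lborel (T \<phi> t))" for \<phi> t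
  have Gm[measurable]: "(\<lambda>(\<phi>, t). G \<phi> t) \<in> borel_measurable (borel \<Otimes>\<^sub>M borel)"
    unfolding G_def by (rule chord_measurable[OF compact_P])
  have Gm': "(\<lambda>t. G \<phi> t) \<in> borel_measurable borel" "(\<lambda>\<phi>. G \<phi> t) \<in> borel_measurable borel" for \<phi> t
    using measurable_compose[OF _ Gm, of "\<lambda>t. (\<phi>, t)" borel] measurable_compose[OF _ Gm, of "\<lambda>\<phi>. (\<phi>, t)" borel] by simp_all
  have "W \<rho> = (\<integral>\<^sup>+\<phi>. \<integral>\<^sup>+t. indicator {\<rho><..} t * G \<phi> t \<partial>lborel \<partial>lborel)"
    unfolding W_def
  proof (rule nn_integral_cong)
    fix \<phi> :: real
    show "indicator {0<..<2 * pi} \<phi> * covariogram P (of_real \<rho> * (\<i> * cis \<phi>)) = (\<integral>\<^sup>+t. indicator {\<rho><..} t * G \<phi> t \<partial>lborel)"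
    proof (cases "\<phi> \<in> {0<..<2 * pi}")
      case True
      then show ?thesis
        unfolding covariogram_direction[OF compact_P convex_P assms True]
        using assms by (auto intro!: nn_integral_cong simp: G_def indicator_def)
    qed (simp add: G_def)
  qed
  also have "\<dots> = (\<integral>\<^sup>+t. \<integral>\<^sup>+\<phi>. indicator {\<rho><..} t * G \<phi> t \<partial>lborel \<partial>lborel)"
  proof (rule lborel_pair.Fubini')
    have [measurable]: "(\<lambda>p. G (snd p) (fst p)) \<in> borel_measurable (borel \<Otimes>\<^sub>M borel)"
      using measurable_compose[OF _ Gm, of "\<lambda>p. (snd p, fst p)" "borel \<Otimes>\<^sub>M borel"] by simp
    have "(\<lambda>p. indicator {\<rho><..} (fst p) * G (snd p) (fst p)) \<in> borel_measurable (borel \<Otimes>\<^sub>M borel)"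
      by measurable
    then show "(\<lambda>(t, \<phi>). indicator {\<rho><..} t * G \<phi> t) \<in> borel_measurable (lborel \<Otimes>\<^sub>M lborel)"
      by (simp add: case_prod_beta cong: measurable_cong_sets sets_pair_measure_cong)
  qed
  also have "\<dots> = (\<integral>\<^sup>+t. indicator {\<rho><..} t * Omega t \<partial>lborel)"
    unfolding Omega_def G_def[symmetric] using Gm' by (simp add: nn_integral_cmult)
  finally show ?thesis .
qed

abbreviation diam :: real where "diam \<equiv> ell n r (kmax n + 1)"

lemma diam_pos: "diam > 0"
  using ell_strict_mono[OF n3 r0, of 0 "kmax n + 1"] by (simp add: ell_0)

lemma W_far: assumes "diam \<le> \<rho>" shows "W \<rho> = 0"
proof -
  have "W \<rho> = (\<integral>\<^sup>+t. indicator {\<rho><..} t * Omega t \<partial>lborel)"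
    using assms diam_pos by (intro W_Omega) simp
  also have "\<dots> = (\<integral>\<^sup>+t. 0 \<partial>(lborel :: real measure))"
  proof (rule nn_integral_cong_AE)
    show "AE t in lborel. indicator {\<rho><..} t * Omega t = 0"
      using AE_lborel_singleton[of "lam n r"]
    proof eventually_elim
      case (elim t)
      show ?case
      proof (cases "\<rho> < t")
        case True
        then have "Omega t = 0"
          using Omega_eq[of t] supp_far(1)[of t] elim assms diam_pos by simp
        then show ?thesis by simp
      qed simp
    qed
  qed
  finally show ?thesis by simp
qed

lemma W_near:
  assumes "0 \<le> \<rho>" "\<rho> < diam"
  shows "W \<rho> = ennreal (2 * real n * (Phi - phi_flat n r \<rho>))" "phi_flat n r \<rho> \<le> Phi"
proof -
  note I = Phi_minus_phi_flat[OF assms]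
  have "0 \<le> Phi - phi_flat n r \<rho>"
    by (rule has_integral_nonneg[OF I]) (use Jt_nonneg assms in auto)
  then show "phi_flat n r \<rho> \<le> Phi" by simp
  have I': "((\<lambda>t. 4 * real n * Jt t) has_integral 2 * real n * (Phi - phi_flat n r \<rho>)) {\<rho>..diam}"
    using has_integral_mult_right[OF I, of "2 * real n"] by (simp add: algebra_simps)
  show "W \<rho> = ennreal (2 * real n * (Phi - phi_flat n r \<rho>))"
    unfolding W_Omega[OF assms(1)]
  \<comment> \<open>Two exceptional lengths: \<open>Omega_eq\<close> leaves out \<lambda>, and
    \<open>supp_far\<close> speaks only of lengths strictly above the diameter.\<close>
  proof (rule nn_integral_has_integral_interval[OF _ _ I', of _ "{lam n r, diam}"])
    fix t assume t: "\<rho> < t" "t < diam" "t \<notin> {lam n r, diam}"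
    then show "0 \<le> 4 * real n * Jt t \<and> indicator {\<rho><..} t * Omega t = ennreal (4 * real n * Jt t)"
      using Omega_eq[of t] Jt_nonneg[of t] assms by simp
  next
    fix t assume t: "t \<notin> {lam n r, diam}" "t \<le> \<rho> \<or> diam \<le> t"
    show "indicator {\<rho><..} t * Omega t = 0"
    proof (cases "t \<le> \<rho>")
      case False
      with t have "diam < t" by auto
      then have "Omega t = 0" using Omega_eq[of t] supp_far(1)[of t] t diam_pos by simp
      then show ?thesis by simp
    qed simp
  qed auto
qed

lemma n_Phi: "real n * Phi = pi * area n r"
proof -
  have "phi_flat n r 0 = integral {0..0} (\<lambda>t. 2 * Jt t)"
    using integral_unique[OF phi_flat_has_integral[of 0]] diam_pos by simp
  then have z: "phi_flat n r 0 = 0" by simp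
  have "W 0 = (\<integral>\<^sup>+\<phi>. indicator {0<..<2 * pi} \<phi> * emeasure lborel P \<partial>lborel)"
    by (simp add: W_def covariogram_def)
  also have "\<dots> = ennreal (2 * pi) * ennreal (area n r)"
    by (simp add: nn_integral_multc emeasure_P)
  also have "\<dots> = ennreal (2 * pi * area n r)" using area_pos by (simp add: ennreal_mult)
  finally have "ennreal (2 * real n * Phi) = ennreal (2 * pi * area n r)"
    using W_near(1)[of 0] diam_pos by (simp add: z)
  moreover have "0 \<le> Phi" using W_near(2)[of 0] diam_pos by (simp add: z)
  ultimately show ?thesis using area_pos by simp
qed

text \<open>Since the perimeter is n \<open>ell n r 1\<close>, the bracket in the density is pi - n
  \<phi> / A. By \<open>n_Phi\<close> this equals n (\<open>Phi\<close> - \<phi>) / A = W / (2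
  A).\<close>

lemma distance_density_W:
  "0 \<le> distance_density n r x"
  "ennreal (distance_density n r x) = indicator {0<..} x * (ennreal x * W x) / ennreal (area n r) / ennreal (area n r)"
proof -
  have A: "area n r > 0" by (rule area_pos)
  have "perimeter n r = real n * ell n r 1" by (simp add: perimeter_def ell_def)
  moreover have "ell n r 1 > 0" using sin_alpha_pos r0 by (simp add: ell_def)
  ultimately have L: "perimeter n r * f / (area n r * ell n r 1) = real n * f / area n r" for f
    by simp
  have "0 \<le> distance_density n r x \<and>
    ennreal (distance_density n r x) = indicator {0<..} x * (ennreal x * W x) / ennreal (area n r) / ennreal (area n r)"
  proof (cases "0 \<le> x \<and> x < diam")
    case True
    define w where "w = 2 * real n * (Phi - phi_flat n r x)"
    have w: "W x = ennreal w" "0 \<le> w"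
      using W_near[of x] True by (simp_all add: w_def)
    have "distance_density n r x = 2 * x / area n r * (pi - real n * phi_flat n r x / area n r)"
      using True unfolding distance_density_def L by simp
    also have "\<dots> = x * w / area n r / area n r"
    proof -
      have "pi = real n * Phi / area n r" using A n_Phi by (simp add: field_simps)
      then show ?thesis unfolding w_def using A by (simp add: field_simps)
    qed
    finally have d: "distance_density n r x = x * w / area n r / area n r" .
    show ?thesis
      unfolding d w(1) using True w(2) A
      by (auto simp: indicator_def ennreal_mult[symmetric] divide_ennreal)
  next
    case False
    then have "distance_density n r x = 0" by (auto simp: distance_density_def)
    moreover have "indicator {0<..} x * (ennreal x * W x) = 0"
      using False W_far[of x] by (auto simp: indicator_def)
    ultimately show ?thesis by simp
  qed
  then show "0 \<le> distance_density n r x"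
    "ennreal (distance_density n r x) = indicator {0<..} x * (ennreal x * W x) / ennreal (area n r) / ennreal (area n r)"
    by auto
qed

section \<open>Arbitrary position of the polygon\<close>

lemma regular_polygon_eq: "regular_polygon n r c \<theta> = (\<lambda>z. c + cis \<theta> * z) ` P"
proof -
  have "(\<lambda>z. c + cis \<theta> * z) ` P = (+) c ` (*) (cis \<theta>) ` P" by (simp add: image_image)
  also have "(*) (cis \<theta>) ` P = convex hull ((*) (cis \<theta>) ` vert ` {..<n})"
    unfolding P_eq by (rule convex_hull_linear_image[OF linear_times])
  also have "(+) c ` \<dots> = convex hull ((+) c ` (*) (cis \<theta>) ` vert ` {..<n})"
    by (rule convex_hull_translation[symmetric])
  also have "(+) c ` (*) (cis \<theta>) ` vert ` {..<n}
      = (\<lambda>j. c + of_real r * cis (\<theta> + 2 * pi * real j / real n)) ` {..<n}"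
    unfolding image_image vert_def
    by (intro image_cong refl) (simp add: mult.left_commute cis_mult alpha_def mult_ac)
  finally show ?thesis unfolding regular_polygon_def by simp
qed

text \<open>A translation of the body leaves the covariogram unchanged and a rotation only rotates
  its argument. This is why the law of the distance is the same for all c and \<theta>.\<close>

lemma covariogram_regular_polygon:
  "covariogram (regular_polygon n r c \<theta>) (cis \<theta> * v) = covariogram P v"
proof -
  define S where "S = {z. z \<in> P \<and> z + v \<in> P}"
  define S' where "S' = {y. y \<in> regular_polygon n r c \<theta> \<and> y + cis \<theta> * v \<in> regular_polygon n r c \<theta>}"
  have mem: "c + cis \<theta> * z \<in> regular_polygon n r c \<theta> \<longleftrightarrow> z \<in> P" for z
    unfolding regular_polygon_eq by (auto simp: image_iff)
  have "compact (regular_polygon n r c \<theta>)"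
    unfolding regular_polygon_def by (intro finite_imp_compact_convex_hull) auto
  then have [measurable]: "regular_polygon n r c \<theta> \<in> sets borel" by (rule borel_compact)
  have [measurable]: "S \<in> sets borel" "S' \<in> sets borel" unfolding S_def S'_def by measurable
  have SS: "cis \<theta> * z + c \<in> S' \<longleftrightarrow> z \<in> S" for z
    using mem[of z] mem[of "z + v"] by (simp add: S_def S'_def algebra_simps)
  have "covariogram (regular_polygon n r c \<theta>) (cis \<theta> * v) = (\<integral>\<^sup>+y. indicator S' y \<partial>lborel)"
    by (simp add: covariogram_def S'_def[symmetric])
  also have "\<dots> = (\<integral>\<^sup>+y. indicator S' (y + c) \<partial>lborel)"
    by (rule nn_integral_lborel_shift[symmetric]) measurable
  also have "\<dots> = (\<integral>\<^sup>+z. indicator S' (cis \<theta> * z + c) \<partial>lborel)"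
    by (rule nn_integral_rotate[symmetric]) measurable
  also have "\<dots> = (\<integral>\<^sup>+z. indicator S z \<partial>lborel)" by (simp add: indicator_def SS)
  also have "\<dots> = covariogram P v" by (simp add: covariogram_def S_def)
  finally show ?thesis .
qed

lemma emeasure_regular_polygon: "emeasure lborel (regular_polygon n r c \<theta>) = ennreal (area n r)"
  using covariogram_regular_polygon[of c \<theta> 0] emeasure_P by (simp add: covariogram_def)

lemma nn_integral_norm_covariogram:
  assumes [measurable]: "B \<in> sets borel"
  shows "(\<integral>\<^sup>+v. indicator B (norm v) * covariogram (regular_polygon n r c \<theta>) v \<partial>lborel)
    = (\<integral>\<^sup>+x. indicator B x * (indicator {0<..} x * (ennreal x * W x)) \<partial>lborel)"
proof -
  have "compact (regular_polygon n r c \<theta>)"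
    unfolding regular_polygon_def by (intro finite_imp_compact_convex_hull) auto
  then have "regular_polygon n r c \<theta> \<in> sets borel" by (rule borel_compact)
  note [measurable] = covariogram_measurable[OF this] covariogram_measurable[OF P_borel]
  have "(\<integral>\<^sup>+v. indicator B (norm v) * covariogram (regular_polygon n r c \<theta>) v \<partial>lborel)
    = (\<integral>\<^sup>+v. indicator B (norm (cis \<theta> * v)) * covariogram (regular_polygon n r c \<theta>) (cis \<theta> * v) \<partial>lborel)"
    by (rule nn_integral_rotate[symmetric]) measurable
  also have "\<dots> = (\<integral>\<^sup>+v. indicator B (norm v) * covariogram P v \<partial>lborel)"
    by (simp add: covariogram_regular_polygon norm_mult)
  \<comment> \<open>This quarter turn turns the polar angle into the angle of the normal used in
    \<open>W\<close>.\<close>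
  also have "\<dots> = (\<integral>\<^sup>+v. indicator B (norm (cis (pi / 2) * v)) * covariogram P (cis (pi / 2) * v) \<partial>lborel)"
    by (rule nn_integral_rotate[symmetric]) measurable
  also have "\<dots> = (\<integral>\<^sup>+\<rho>. indicator {0<..} \<rho> * (ennreal \<rho> *
       (\<integral>\<^sup>+\<phi>. indicator {0<..<2 * pi} \<phi> * (indicator B (norm (cis (pi / 2) * (of_real \<rho> * cis \<phi>)))
          * covariogram P (cis (pi / 2) * (of_real \<rho> * cis \<phi>))) \<partial>lborel)) \<partial>lborel)"
    by (rule nn_integral_polar) measurable
  also have "\<dots> = (\<integral>\<^sup>+x. indicator B x * (indicator {0<..} x * (ennreal x * W x)) \<partial>lborel)"
  proof (rule nn_integral_cong)
    fix \<rho> :: real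
    show "indicator {0<..} \<rho> * (ennreal \<rho> *
       (\<integral>\<^sup>+\<phi>. indicator {0<..<2 * pi} \<phi> * (indicator B (norm (cis (pi / 2) * (of_real \<rho> * cis \<phi>)))
          * covariogram P (cis (pi / 2) * (of_real \<rho> * cis \<phi>))) \<partial>lborel))
      = indicator B \<rho> * (indicator {0<..} \<rho> * (ennreal \<rho> * W \<rho>))"
    proof (cases "\<rho> > 0 \<and> \<rho> \<in> B")
      case True
      then show ?thesis by (simp add: norm_mult W_def mult.left_commute)
    next
      case False
      then show ?thesis by (cases "\<rho> > 0") (simp_all add: norm_mult)
    qed
  qed
  finally show ?thesis .
qed

end

theorem theorem2:
  fixes n :: nat and r :: real and c :: complex and \<theta> :: real
    and M :: "'w measure" and X Y :: "'w \<Rightarrow> complex"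
  assumes "n \<ge> 3" and "r > 0"
    and "prob_space M"
    and "prob_space.indep_var M borel X borel Y"
    and "distr M borel X = uniform_measure lborel (regular_polygon n r c \<theta>)"
    and "distr M borel Y = uniform_measure lborel (regular_polygon n r c \<theta>)"
  shows "(\<forall>x. 0 \<le> distance_density n r x) \<and>
    distributed M lborel (\<lambda>\<omega>. dist (X \<omega>) (Y \<omega>)) (\<lambda>x. ennreal (distance_density n r x))"
proof -
  interpret regular_ngon n r using assms(1,2) by unfold_locales
  interpret prob_space M by (rule assms(3))
  let ?P = "regular_polygon n r c \<theta>" and ?d = "\<lambda>x. ennreal (distance_density n r x)"
  have [measurable]: "X \<in> borel_measurable M" "Y \<in> borel_measurable M"
    using assms(4) by (simp_all add: indep_var_distribution_eq)
  have "compact ?P" unfolding regular_polygon_def by (intro finite_imp_compact_convex_hull) auto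
  then have P[measurable]: "?P \<in> sets borel" by (rule borel_compact)
  have dm[measurable]: "?d \<in> borel_measurable borel"
    unfolding distance_density_W(2) by measurable
  have "distr M lborel (\<lambda>\<omega>. dist (X \<omega>) (Y \<omega>)) = density lborel ?d"
  proof (rule measure_eqI)
    fix B assume "B \<in> sets (distr M lborel (\<lambda>\<omega>. dist (X \<omega>) (Y \<omega>)))"
    then have B[measurable]: "B \<in> sets borel" by simp
    have "emeasure (distr M lborel (\<lambda>\<omega>. dist (X \<omega>) (Y \<omega>))) B
      = (\<integral>\<^sup>+x. indicator B x * (indicator {0<..} x * (ennreal x * W x)) \<partial>lborel) / ennreal (area n r) / ennreal (area n r)"
      unfolding emeasure_distr_dist[OF assms(3-6) P B] emeasure_regular_polygon
        nn_integral_norm_covariogram[OF B] ..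
    also have "\<dots> = (\<integral>\<^sup>+x. indicator B x * (indicator {0<..} x * (ennreal x * W x)) / ennreal (area n r) / ennreal (area n r) \<partial>lborel)"
      by (simp add: nn_integral_divide)
    also have "\<dots> = (\<integral>\<^sup>+x. ?d x * indicator B x \<partial>lborel)"
      unfolding distance_density_W(2) by (simp add: ennreal_times_divide mult.commute)
    also have "\<dots> = emeasure (density lborel ?d) B"
      by (rule emeasure_density[symmetric]) (use dm B in auto)
    finally show "emeasure (distr M lborel (\<lambda>\<omega>. dist (X \<omega>) (Y \<omega>))) B = emeasure (density lborel ?d) B" .
  qed simp
  then have "distributed M lborel (\<lambda>\<omega>. dist (X \<omega>) (Y \<omega>)) ?d"
    unfolding distributed_def by simp
  with distance_density_W(1) show ?thesis by blast
qed

end
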